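(* The following properties of bounded linear operators on complex separable Hilbert spaces are equivalent: (1) Every quasinilpotent operator has a non-trivial closed invariant subspace. (2) Every pair of idempotents $(T_1, T_2)$ (acting on the same Hilbert space) with a quasinilpotent commutator $T_1T_2 - T_2T_1$ has a non-trivial common closed invariant subspace.
   Context: For a Hilbert space $\mathcal{H}$, $\mathscr{B}(\mathcal{H})$ denotes the algebra of bounded linear operators on $\mathcal{H}$. An operator $T \in \mathscr{B}(\mathcal{H})$ is idempotent if $T^2 = T$ (it need not be self-adjoint). It is quasinilpotent if its spectrum satisfies $\sigma(T) = \{0\}$. A closed subspace $\mathcal{S} \subseteq \mathcal{H}$ is invariant under $T$ if $T\mathcal{S} \subseteq \mathcal{S}$; it is non-trivial if $\mathcal{S} \neq \{0\}$ and $\mathcal{S} \neq \mathcal{H}$. A common invariant subspace of $T_1$ and $T_2$ is one that is invariant under both. *)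

theory Defs
  imports "HOL-Analysis.Analysis" "HOL-Algebra.Module"
begin

definition complex_field :: "complex ring" where
  "complex_field = \<lparr>carrier = UNIV, mult = (*), one = 1, zero = 0, add = (+)\<rparr>"

(* Hilbert spaces are carrier-based structures over an arbitrary element type 'a, so that one
   statement can quantify over all of them. As in HOL-Algebra, a module record also contains ring
   fields mult and one; they carry no meaning here. A separable Hilbert space has at most
   continuum many points, so 'a = (nat => complex) already hosts an isometric copy of each. *)
record 'a hilbert = "(complex, 'a) module" +
  cinner :: "'a \<Rightarrow> 'a \<Rightarrow> complex"

definition hnorm :: "('a, 'm) hilbert_scheme \<Rightarrow> 'a \<Rightarrow> real" where
  "hnorm H x = sqrt (Re (cinner H x x))"

(* The value off the carrier is a dummy: Metric_space requires a function that is nonnegative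
   and symmetric on the whole type. *)
definition hdist :: "('a, 'm) hilbert_scheme \<Rightarrow> 'a \<Rightarrow> 'a \<Rightarrow> real" where
  "hdist H x y = (if x \<in> carrier H \<and> y \<in> carrier H then hnorm H (x \<ominus>\<^bsub>H\<^esub> y) else 0)"

abbreviation htopology :: "('a, 'm) hilbert_scheme \<Rightarrow> 'a topology" where
  "htopology H \<equiv> Metric_space.mtopology (carrier H) (hdist H)"

locale complex_inner_space = Module.module complex_field H for H (structure) +
  assumes cinner_add_left:
      "\<lbrakk>x \<in> carrier H; y \<in> carrier H; z \<in> carrier H\<rbrakk>
        \<Longrightarrow> cinner H (x \<oplus> y) z = cinner H x z + cinner H y z"
    and cinner_smult_left:
      "\<lbrakk>x \<in> carrier H; y \<in> carrier H\<rbrakk> \<Longrightarrow> cinner H (a \<odot> x) y = a * cinner H x y"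
    and cinner_commute:
      "\<lbrakk>x \<in> carrier H; y \<in> carrier H\<rbrakk> \<Longrightarrow> cinner H x y = cnj (cinner H y x)"
    and cinner_pos:
      "\<lbrakk>x \<in> carrier H; x \<noteq> \<zero>\<rbrakk> \<Longrightarrow> 0 < Re (cinner H x x)"

locale separable_hilbert_space = complex_inner_space +
  assumes complete: "Metric_space.mcomplete (carrier H) (hdist H)"
    and separable: "separable_space (htopology H)"

(* On a one-dimensional space no non-trivial subspace exists, while 0 is quasinilpotent; without
   excluding this case both properties of the equivalence would be false for that reason alone. *)
definition dim_at_least_two :: "('a, 'm) hilbert_scheme \<Rightarrow> bool" where
  "dim_at_least_two H \<longleftrightarrow> (\<exists>x\<in>carrier H. \<exists>y\<in>carrier H. \<forall>a b.
     a \<odot>\<^bsub>H\<^esub> x \<oplus>\<^bsub>H\<^esub> b \<odot>\<^bsub>H\<^esub> y = \<zero>\<^bsub>H\<^esub> \<longrightarrow> a = 0 \<and> b = 0)"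

(* Only the values on the carrier matter; two operators are the same if they agree there. *)
definition bounded_operators :: "('a, 'm) hilbert_scheme \<Rightarrow> ('a \<Rightarrow> 'a) set" where
  "bounded_operators H = {T. T \<in> carrier H \<rightarrow> carrier H
     \<and> (\<forall>x\<in>carrier H. \<forall>y\<in>carrier H. T (x \<oplus>\<^bsub>H\<^esub> y) = T x \<oplus>\<^bsub>H\<^esub> T y)
     \<and> (\<forall>a. \<forall>x\<in>carrier H. T (a \<odot>\<^bsub>H\<^esub> x) = a \<odot>\<^bsub>H\<^esub> T x)
     \<and> (\<exists>K. \<forall>x\<in>carrier H. hnorm H (T x) \<le> K * hnorm H x)}"

definition op_minus ::
    "('a, 'm) hilbert_scheme \<Rightarrow> ('a \<Rightarrow> 'a) \<Rightarrow> ('a \<Rightarrow> 'a) \<Rightarrow> 'a \<Rightarrow> 'a" where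
  "op_minus H A B = (\<lambda>x. A x \<ominus>\<^bsub>H\<^esub> B x)"

definition invertible_op :: "('a, 'm) hilbert_scheme \<Rightarrow> ('a \<Rightarrow> 'a) \<Rightarrow> bool" where
  "invertible_op H T \<longleftrightarrow>
     (\<exists>S\<in>bounded_operators H. \<forall>x\<in>carrier H. S (T x) = x \<and> T (S x) = x)"

definition spectrum :: "('a, 'm) hilbert_scheme \<Rightarrow> ('a \<Rightarrow> 'a) \<Rightarrow> complex set" where
  "spectrum H T = {c. \<not> invertible_op H (op_minus H T (\<lambda>x. c \<odot>\<^bsub>H\<^esub> x))}"

definition quasinilpotent :: "('a, 'm) hilbert_scheme \<Rightarrow> ('a \<Rightarrow> 'a) \<Rightarrow> bool" where
  "quasinilpotent H T \<longleftrightarrow> spectrum H T = {0}"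

definition idempotent_op :: "('a, 'm) hilbert_scheme \<Rightarrow> ('a \<Rightarrow> 'a) \<Rightarrow> bool" where
  "idempotent_op H T \<longleftrightarrow> (\<forall>x\<in>carrier H. T (T x) = T x)"

definition commutator ::
    "('a, 'm) hilbert_scheme \<Rightarrow> ('a \<Rightarrow> 'a) \<Rightarrow> ('a \<Rightarrow> 'a) \<Rightarrow> 'a \<Rightarrow> 'a" where
  "commutator H A B = op_minus H (A \<circ> B) (B \<circ> A)"

definition closed_subspace :: "('a, 'm) hilbert_scheme \<Rightarrow> 'a set \<Rightarrow> bool" where
  "closed_subspace H S \<longleftrightarrow> submodule S complex_field H \<and> closedin (htopology H) S"

definition nontrivial_closed_subspace :: "('a, 'm) hilbert_scheme \<Rightarrow> 'a set \<Rightarrow> bool" where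
  "nontrivial_closed_subspace H S \<longleftrightarrow>
     closed_subspace H S \<and> S \<noteq> {\<zero>\<^bsub>H\<^esub>} \<and> S \<noteq> carrier H"

definition invariant_under :: "('a \<Rightarrow> 'a) \<Rightarrow> 'a set \<Rightarrow> bool" where
  "invariant_under T S \<longleftrightarrow> T ` S \<subseteq> S"

end

theory Submission
  imports Defs "HOL-Complex_Analysis.Complex_Analysis"
begin

text \<open>
  From single operators to pairs: for idempotents \<open>E\<close>, \<open>F\<close> with commutator \<open>C\<close>, the compression \<open>T\<close> of
  \<open>F\<close> to the range of \<open>E\<close> satisfies \<open>T - T\<^sup>2 = - C\<^sup>2\<close> there, so the spectrum of \<open>T\<close> lies in \<open>{0, 1}\<close>. If it
  is a single point, \<open>T\<close> or \<open>T - 1\<close> is quasinilpotent; otherwise the Riesz idempotent of \<open>T\<close> splits the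
  range. Either way \<open>T\<close> has a non-trivial closed invariant subspace \<open>M\<close>, and the vectors \<open>x\<close> with
  \<open>E x\<close> and \<open>E F x\<close> in \<open>M\<close> form a common invariant subspace of \<open>E\<close> and \<open>F\<close>. If the range of \<open>E\<close> is at
  most one-dimensional, \<open>1 - E\<close> takes the role of \<open>E\<close>, and the plane remains as a special case.

  From pairs to single operators: on the direct sum of two copies of the space, the idempotents
  \<open>[[1, 0], [0, 0]]\<close> and \<open>[[1 - T, 1], [T (1 - T), T]]\<close> have a quasinilpotent commutator, and a common
  invariant subspace of them is the sum of two closed subspaces invariant under \<open>T\<close>.
\<close>

section \<open>Norm and topology\<close>

text \<open>The hypothesis on \<open>C\<close> reaches the compression because \<open>C^2\<close>,
  unlike \<open>C\<close>, commutes with \<open>E\<close>: the inverse of \<open>C^2 + c\<close>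
  then maps the range of \<open>E\<close> into itself. \<open>C^2\<close> is reached from
  \<open>C\<close> by factoring \<open>C^2 + c\<close> with a square root of \<open>-c\<close>. The
  Riesz idempotent is not a contour integral here but a limit of polynomials in \<open>T\<close>.
  These converge geometrically once \<open>T - T^2\<close> is small; a quasinilpotent operator may
  have a large norm, so the norm is first replaced by an equivalent one. The plane is separate
  because the assumption on single operators says nothing about one-dimensional ranges. There,
  failure of all candidate subspaces would make \<open>C^2\<close> a non-zero scalar. The second
  idempotent of the converse reverses the first computation: prescribe the compression
  \<open>1 - T\<close> and the upper right corner \<open>1\<close>; then idempotency forces the
  lower row \<open>T (1 - T)\<close>, \<open>T\<close>. The corner \<open>1\<close> also forces the
  second part of an invariant subspace into the first. Both properties speak of one element type, so
  subspaces arise by changing the carrier alone.\<close>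

lemma complex_field_simps [simp]:
  "carrier complex_field = UNIV"
  "\<one>\<^bsub>complex_field\<^esub> = 1"
  "\<zero>\<^bsub>complex_field\<^esub> = 0"
  "a \<oplus>\<^bsub>complex_field\<^esub> b = a + b"
  "a \<otimes>\<^bsub>complex_field\<^esub> b = a * b"
  by (simp_all add: complex_field_def)

lemma cring_complex_field: "cring complex_field"
  by (rule cringI; (rule abelian_groupI comm_monoidI)?)
     (auto simp: algebra_simps intro: exI[of _ "- x" for x])

context complex_inner_space
begin

lemma smult_closed' [simp, intro]: "x \<in> carrier H \<Longrightarrow> a \<odot> x \<in> carrier H"
  using smult_closed by simp

lemma cinner_zero_left [simp]: "y \<in> carrier H \<Longrightarrow> cinner H \<zero> y = 0"
  using cinner_add_left[of \<zero> \<zero> y] by simp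

lemma cinner_uminus_left [simp]:
  assumes "x \<in> carrier H" "y \<in> carrier H"
  shows "cinner H (\<ominus> x) y = - cinner H x y"
  using cinner_add_left[of x "\<ominus> x" y] assms by (simp add: M.r_neg add_eq_0_iff)

lemma cinner_diff_left [simp]:
  assumes "x \<in> carrier H" "y \<in> carrier H" "z \<in> carrier H"
  shows "cinner H (x \<ominus> y) z = cinner H x z - cinner H y z"
  using assms by (simp add: a_minus_def cinner_add_left)

lemmas cinner_left [simp] = cinner_add_left cinner_smult_left

lemma cinner_right:
  "x \<in> carrier H \<Longrightarrow> y \<in> carrier H \<Longrightarrow> z \<in> carrier H \<Longrightarrow> cinner H z (x \<oplus> y) = cinner H z x + cinner H z y"
  "x \<in> carrier H \<Longrightarrow> y \<in> carrier H \<Longrightarrow> z \<in> carrier H \<Longrightarrow> cinner H z (x \<ominus> y) = cinner H z x - cinner H z y"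
  "x \<in> carrier H \<Longrightarrow> z \<in> carrier H \<Longrightarrow> cinner H z (a \<odot> x) = cnj a * cinner H z x"
  "z \<in> carrier H \<Longrightarrow> cinner H z \<zero> = 0"
  using cinner_commute[of z "x \<oplus> y"] cinner_commute[of z "x \<ominus> y"] cinner_commute[of z "a \<odot> x"]
    cinner_commute[of z x] cinner_commute[of z y] cinner_commute[of z \<zero>]
  by simp_all

lemma cinner_self_real:
  assumes "x \<in> carrier H"
  shows "cinner H x x = of_real (Re (cinner H x x))"
  by (metis assms cinner_commute Reals_cnj_iff of_real_Re)

lemma cinner_self_nonneg: "x \<in> carrier H \<Longrightarrow> 0 \<le> Re (cinner H x x)"
  using cinner_pos[of x] by (cases "x = \<zero>") (auto intro: less_imp_le)

lemma minus_eq_zero_iff [simp]: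
  assumes "x \<in> carrier H" "y \<in> carrier H"
  shows "x \<ominus> y = \<zero> \<longleftrightarrow> x = y"
proof
  assume "x \<ominus> y = \<zero>"
  then have "\<ominus> (\<ominus> y) = x" using assms by (intro M.minus_equality) (auto simp: a_minus_def)
  then show "x = y" using assms by simp
qed (use assms in \<open>simp add: a_minus_def M.r_neg\<close>)

lemma minus_self [simp]: "x \<in> carrier H \<Longrightarrow> x \<ominus> x = \<zero>"
  by simp

text \<open>Vector identities on the carrier become identities between complex numbers.\<close>
lemma vec_eqI:
  assumes "x \<in> carrier H" "y \<in> carrier H"
    and "\<And>z. z \<in> carrier H \<Longrightarrow> cinner H x z = cinner H y z"
  shows "x = y"
proof -
  have "cinner H (x \<ominus> y) (x \<ominus> y) = 0"
    using assms by simp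
  then have "x \<ominus> y = \<zero>"
    using cinner_pos[of "x \<ominus> y"] assms by auto
  then show ?thesis using assms(1,2) by simp
qed

lemma hnorm_sq: "x \<in> carrier H \<Longrightarrow> (hnorm H x)\<^sup>2 = Re (cinner H x x)"
  by (simp add: hnorm_def cinner_self_nonneg)

lemma cinner_self: "x \<in> carrier H \<Longrightarrow> cinner H x x = of_real ((hnorm H x)\<^sup>2)"
  using hnorm_sq cinner_self_real by simp

lemma hnorm_nonneg [simp]: "x \<in> carrier H \<Longrightarrow> 0 \<le> hnorm H x"
  by (simp add: hnorm_def cinner_self_nonneg)

lemma hnorm_zero [simp]: "hnorm H \<zero> = 0"
  by (simp add: hnorm_def)

lemma hnorm_eq_0_iff [simp]: "x \<in> carrier H \<Longrightarrow> hnorm H x = 0 \<longleftrightarrow> x = \<zero>"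
  using cinner_pos[of x] by (cases "x = \<zero>") (auto simp: hnorm_def)

lemma hnorm_smult [simp]:
  assumes "x \<in> carrier H"
  shows "hnorm H (a \<odot> x) = cmod a * hnorm H x"
proof -
  have "cinner H (a \<odot> x) (a \<odot> x) = (a * cnj a) * cinner H x x"
    using assms by (simp add: cinner_right)
  then have "Re (cinner H (a \<odot> x) (a \<odot> x)) = (cmod a)\<^sup>2 * Re (cinner H x x)"
    by (simp add: complex_norm_square[symmetric])
  then show ?thesis
    by (simp add: hnorm_def real_sqrt_mult)
qed

lemma Cauchy_Schwarz:
  assumes x: "x \<in> carrier H" and y: "y \<in> carrier H"
  shows "cmod (cinner H x y) \<le> hnorm H x * hnorm H y"
proof (cases "y = \<zero>")
  case True
  then show ?thesis using x by (simp add: cinner_right)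
next
  case False
  define c where "c = cinner H x y"
  define n where "n = (hnorm H y)\<^sup>2"
  have n: "n > 0" using False y by (simp add: n_def)
  \<comment> \<open>The component of \<open>x\<close> orthogonal to \<open>y\<close>; that its
    squared norm is non-negative is the inequality.\<close>
  define w where "w = x \<ominus> (c / n) \<odot> y"
  have w: "w \<in> carrier H" using x y by (simp add: w_def)
  have yx: "cinner H y x = cnj c"
    unfolding c_def using x y cinner_commute by blast
  have "cinner H w w = cinner H x x - c * cnj c / n"
    using x y n by (simp add: w_def cinner_right yx c_def[symmetric] cinner_self[OF y] n_def[symmetric]
        field_simps)
  also have "\<dots> = of_real ((hnorm H x)\<^sup>2 - (cmod c)\<^sup>2 / n)"
    using x by (simp add: cinner_self complex_norm_square of_real_diff del: of_real_power)
  finally have "0 \<le> (hnorm H x)\<^sup>2 - (cmod c)\<^sup>2 / n"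
    using cinner_self_nonneg[OF w] by simp
  then have "(cmod c)\<^sup>2 \<le> (hnorm H x * hnorm H y)\<^sup>2"
    using n by (simp add: field_simps n_def)
  then show ?thesis
    unfolding c_def using x y by - (rule power2_le_imp_le, simp_all)
qed

lemma hnorm_triangle:
  assumes x: "x \<in> carrier H" and y: "y \<in> carrier H"
  shows "hnorm H (x \<oplus> y) \<le> hnorm H x + hnorm H y"
proof (rule power2_le_imp_le)
  have "cinner H (x \<oplus> y) (x \<oplus> y) = cinner H x x + cinner H y y + (cinner H x y + cnj (cinner H x y))"
    using x y cinner_commute[of y x] by (simp add: cinner_right)
  then have "(hnorm H (x \<oplus> y))\<^sup>2 = (hnorm H x)\<^sup>2 + (hnorm H y)\<^sup>2 + 2 * Re (cinner H x y)"
    using x y by (simp add: hnorm_sq)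
  also have "\<dots> \<le> (hnorm H x)\<^sup>2 + (hnorm H y)\<^sup>2 + 2 * (hnorm H x * hnorm H y)"
    using Cauchy_Schwarz[OF x y] complex_Re_le_cmod[of "cinner H x y"] by linarith
  finally show "(hnorm H (x \<oplus> y))\<^sup>2 \<le> (hnorm H x + hnorm H y)\<^sup>2"
    by (simp add: power2_sum)
qed (use x y in auto)

lemma hnorm_minus_commute:
  assumes "x \<in> carrier H" "y \<in> carrier H"
  shows "hnorm H (x \<ominus> y) = hnorm H (y \<ominus> x)"
proof -
  have "x \<ominus> y = (-1) \<odot> (y \<ominus> x)"
    by (rule vec_eqI) (use assms in auto)
  then show ?thesis using assms by simp
qed

lemma hnorm_triangle_minus:
  assumes x: "x \<in> carrier H" and y: "y \<in> carrier H"
  shows "hnorm H (x \<ominus> y) \<le> hnorm H x + hnorm H y"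
proof -
  have "x \<ominus> y = x \<oplus> (-1) \<odot> y"
    by (rule vec_eqI) (use assms in auto)
  then show ?thesis using hnorm_triangle[of x "(-1) \<odot> y"] assms by simp
qed

lemma hnorm_dist_triangle:
  assumes "x \<in> carrier H" "y \<in> carrier H" "z \<in> carrier H"
  shows "hnorm H (x \<ominus> z) \<le> hnorm H (x \<ominus> y) + hnorm H (y \<ominus> z)"
proof -
  have "x \<ominus> z = (x \<ominus> y) \<oplus> (y \<ominus> z)"
    by (rule vec_eqI) (use assms in auto)
  then show ?thesis using hnorm_triangle[of "x \<ominus> y" "y \<ominus> z"] assms by simp
qed

lemma Metric_space_hdist: "Metric_space (carrier H) (hdist H)"
proof
  fix x y z
  show "0 \<le> hdist H x y" "hdist H x y = hdist H y x"
    by (auto simp: hdist_def hnorm_minus_commute)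
  show "x \<in> carrier H \<Longrightarrow> y \<in> carrier H \<Longrightarrow> (hdist H x y = 0) = (x = y)"
    by (simp add: hdist_def)
  show "x \<in> carrier H \<Longrightarrow> y \<in> carrier H \<Longrightarrow> z \<in> carrier H \<Longrightarrow> hdist H x z \<le> hdist H x y + hdist H y z"
    using hnorm_dist_triangle[of x y z] by (simp add: hdist_def)
qed

section \<open>Metric and topological notions expressed by the norm\<close>

sublocale HM: Metric_space "carrier H" "hdist H"
  by (rule Metric_space_hdist)

lemma hdist_eq: "x \<in> carrier H \<Longrightarrow> y \<in> carrier H \<Longrightarrow> hdist H x y = hnorm H (x \<ominus> y)"
  by (simp add: hdist_def)

lemma mball_iff: "x \<in> carrier H \<Longrightarrow> y \<in> HM.mball x r \<longleftrightarrow> y \<in> carrier H \<and> hnorm H (x \<ominus> y) < r"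
  using hdist_eq unfolding HM.in_mball by metis

text \<open>Closedness, completeness and separability enter all later arguments only through this
  equivalence and the next two, as estimates on \<open>hnorm\<close>.\<close>

lemma closedin_iff:
  "closedin HM.mtopology S \<longleftrightarrow> S \<subseteq> carrier H \<and>
     (\<forall>x\<in>carrier H. (\<forall>e>0. \<exists>y\<in>S. hnorm H (x \<ominus> y) < e) \<longrightarrow> x \<in> S)"
proof (cases "S \<subseteq> carrier H")
  case True
  have "disjnt S (HM.mball x r) \<longleftrightarrow> \<not> (\<exists>y\<in>S. hnorm H (x \<ominus> y) < r)" if "x \<in> carrier H" for x r
    using True mball_iff[OF that] unfolding disjnt_iff by blast
  then show ?thesis
    unfolding HM.closedin_metric using True by (metis Diff_iff)
next
  case False
  then show ?thesis unfolding HM.closedin_metric by blast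
qed

lemma mcomplete_iff:
  "HM.mcomplete \<longleftrightarrow> (\<forall>s. range s \<subseteq> carrier H \<longrightarrow>
     (\<forall>e>0. \<exists>N. \<forall>m\<ge>N. \<forall>n\<ge>N. hnorm H (s m \<ominus> s n) < e) \<longrightarrow>
     (\<exists>x\<in>carrier H. (\<lambda>n. hnorm H (s n \<ominus> x)) \<longlonglongrightarrow> 0))"
proof -
  have 1: "HM.MCauchy s \<longleftrightarrow> (\<forall>e>0. \<exists>N. \<forall>m\<ge>N. \<forall>n\<ge>N. hnorm H (s m \<ominus> s n) < e)"
    if "range s \<subseteq> carrier H" for s :: "nat \<Rightarrow> 'a"
  proof -
    have "hdist H (s m) (s n) = hnorm H (s m \<ominus> s n)" for m n
      using that by (intro hdist_eq) auto
    then show ?thesis using that unfolding HM.MCauchy_def by simp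
  qed
  have 2: "limitin HM.mtopology s x sequentially \<longleftrightarrow> x \<in> carrier H \<and> (\<lambda>n. hnorm H (s n \<ominus> x)) \<longlonglongrightarrow> 0"
    if "range s \<subseteq> carrier H" for s x
  proof (cases "x \<in> carrier H")
    case True
    then have "hdist H (s n) x = hnorm H (s n \<ominus> x)" for n
      using that by (intro hdist_eq) auto
    moreover have "\<forall>\<^sub>F n in sequentially. s n \<in> carrier H" using that by (intro always_eventually) auto
    ultimately show ?thesis unfolding HM.limitin_metric_dist_null using True by simp
  qed (simp add: HM.limitin_metric_dist_null)
  have 3: "HM.MCauchy s \<Longrightarrow> range s \<subseteq> carrier H" for s
    by (simp add: HM.MCauchy_def)
  show ?thesis
    unfolding HM.mcomplete_def
  proof (intro iffI allI impI)
    fix s :: "nat \<Rightarrow> 'a"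
    assume *: "\<forall>s. HM.MCauchy s \<longrightarrow> (\<exists>x. limitin HM.mtopology s x sequentially)"
      and s: "range s \<subseteq> carrier H"
      and cau: "\<forall>e>0. \<exists>N. \<forall>m\<ge>N. \<forall>n\<ge>N. hnorm H (s m \<ominus> s n) < e"
    have "HM.MCauchy s" using 1[OF s] cau by (rule iffD2)
    then obtain x where "limitin HM.mtopology s x sequentially" using * by iprover
    then have "x \<in> carrier H \<and> (\<lambda>n. hnorm H (s n \<ominus> x)) \<longlonglongrightarrow> 0" by (rule iffD1[OF 2[OF s]])
    then show "\<exists>x\<in>carrier H. (\<lambda>n. hnorm H (s n \<ominus> x)) \<longlonglongrightarrow> 0" by blast
  next
    fix s :: "nat \<Rightarrow> 'a"
    assume *: "\<forall>s. range s \<subseteq> carrier H \<longrightarrow>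
      (\<forall>e>0. \<exists>N. \<forall>m\<ge>N. \<forall>n\<ge>N. hnorm H (s m \<ominus> s n) < e) \<longrightarrow>
      (\<exists>x\<in>carrier H. (\<lambda>n. hnorm H (s n \<ominus> x)) \<longlonglongrightarrow> 0)" and s: "HM.MCauchy s"
    have "\<exists>x\<in>carrier H. (\<lambda>n. hnorm H (s n \<ominus> x)) \<longlonglongrightarrow> 0"
      by (rule *[THEN spec, THEN mp, THEN mp, OF 3[OF s] iffD1[OF 1[OF 3[OF s]] s]])
    then obtain x where "x \<in> carrier H \<and> (\<lambda>n. hnorm H (s n \<ominus> x)) \<longlonglongrightarrow> 0" by blast
    then have "limitin HM.mtopology s x sequentially" by (rule iffD2[OF 2[OF 3[OF s]]])
    then show "\<exists>x. limitin HM.mtopology s x sequentially" ..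
  qed
qed

lemma separable_iff:
  "separable_space HM.mtopology \<longleftrightarrow>
    (\<exists>D\<subseteq>carrier H. countable D \<and> (\<forall>x\<in>carrier H. \<forall>e>0. \<exists>d\<in>D. hnorm H (x \<ominus> d) < e))"
proof -
  have "HM.mtopology closure_of D = carrier H \<longleftrightarrow> (\<forall>x\<in>carrier H. \<forall>e>0. \<exists>d\<in>D. hnorm H (x \<ominus> d) < e)"
    if D: "D \<subseteq> carrier H" for D
  proof -
    have "HM.mtopology closure_of D = {x \<in> carrier H. \<forall>e>0. \<exists>d\<in>D. hnorm H (x \<ominus> d) < e}"
    proof -
      have "(\<exists>y\<in>D. y \<in> HM.mball x r) \<longleftrightarrow> (\<exists>d\<in>D. hnorm H (x \<ominus> d) < r)" if "x \<in> carrier H" for x r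
        using D mball_iff[OF that] by blast
      then show ?thesis unfolding HM.metric_closure_of by blast
    qed
    then show ?thesis by blast
  qed
  then show ?thesis unfolding separable_space_def HM.topspace_mtopology by metis
qed

end

section \<open>Polynomials in an operator\<close>

text \<open>Horner's scheme needs no finite sums over the carrier. It also never consults the
  carrier, so a polynomial of an operator on a closed subspace is literally the same function as on
  the whole space.\<close>

primrec horner :: "('a, 'm) hilbert_scheme \<Rightarrow> ('a \<Rightarrow> 'a) \<Rightarrow> complex list \<Rightarrow> 'a \<Rightarrow> 'a" where
  "horner H T [] x = \<zero>\<^bsub>H\<^esub>"
| "horner H T (a # as) x = a \<odot>\<^bsub>H\<^esub> x \<oplus>\<^bsub>H\<^esub> T (horner H T as x)"

definition poly_op :: "('a, 'm) hilbert_scheme \<Rightarrow> ('a \<Rightarrow> 'a) \<Rightarrow> complex poly \<Rightarrow> 'a \<Rightarrow> 'a" where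
  "poly_op H T p = horner H T (coeffs p)"

context complex_inner_space
begin

lemma bounded_operatorsI:
  assumes "\<And>x. x \<in> carrier H \<Longrightarrow> T x \<in> carrier H"
    and "\<And>x y. x \<in> carrier H \<Longrightarrow> y \<in> carrier H \<Longrightarrow> T (x \<oplus> y) = T x \<oplus> T y"
    and "\<And>a x. x \<in> carrier H \<Longrightarrow> T (a \<odot> x) = a \<odot> T x"
    and "\<And>x. x \<in> carrier H \<Longrightarrow> hnorm H (T x) \<le> K * hnorm H x"
  shows "T \<in> bounded_operators H"
  unfolding bounded_operators_def using assms by (auto intro!: exI[of _ K])

context
  fixes T assumes T: "T \<in> bounded_operators H"
begin

lemma op_closed [simp, intro]: "x \<in> carrier H \<Longrightarrow> T x \<in> carrier H"
  using T by (auto simp: bounded_operators_def)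

lemma op_add: "x \<in> carrier H \<Longrightarrow> y \<in> carrier H \<Longrightarrow> T (x \<oplus> y) = T x \<oplus> T y"
  using T by (auto simp: bounded_operators_def)

lemma op_smult: "x \<in> carrier H \<Longrightarrow> T (a \<odot> x) = a \<odot> T x"
  using T by (auto simp: bounded_operators_def)

lemma op_zero: "T \<zero> = \<zero>"
proof -
  have "T (0 \<odot> \<zero>) = 0 \<odot> T \<zero>" by (rule op_smult) simp
  moreover have "0 \<odot> x = \<zero>" if "x \<in> carrier H" for x
    using that smult_l_null by simp
  ultimately show ?thesis by simp
qed

lemma op_diff:
  assumes "x \<in> carrier H" "y \<in> carrier H"
  shows "T (x \<ominus> y) = T x \<ominus> T y"
proof -
  have "x \<ominus> y = x \<oplus> (-1) \<odot> y"
    by (rule vec_eqI) (use assms in auto)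
  then have "T (x \<ominus> y) = T x \<oplus> (-1) \<odot> T y"
    using assms by (simp add: op_add op_smult)
  also have "\<dots> = T x \<ominus> T y"
    by (rule vec_eqI) (use assms in auto)
  finally show ?thesis .
qed

lemmas op_linear = op_add op_smult op_diff op_zero

lemma op_bound: "\<exists>K\<ge>0. \<forall>x\<in>carrier H. hnorm H (T x) \<le> K * hnorm H x"
proof -
  obtain K where K: "\<forall>x\<in>carrier H. hnorm H (T x) \<le> K * hnorm H x"
    using T by (auto simp: bounded_operators_def)
  have "hnorm H (T x) \<le> \<bar>K\<bar> * hnorm H x" if "x \<in> carrier H" for x
  proof -
    have "K * hnorm H x \<le> \<bar>K\<bar> * hnorm H x"
      using that by (intro mult_right_mono) auto
    then show ?thesis using K that by force
  qed
  then show ?thesis by (intro exI[of _ "\<bar>K\<bar>"]) auto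
qed

end

lemma op_cong:
  assumes "T \<in> bounded_operators H" "\<And>x. x \<in> carrier H \<Longrightarrow> T' x = T x"
  shows "T' \<in> bounded_operators H"
  using assms unfolding bounded_operators_def by (auto simp: Pi_def)

lemma bounded_id: "(\<lambda>x. x) \<in> bounded_operators H"
  by (rule bounded_operatorsI[where K = 1]) auto

lemma bounded_compose:
  assumes A: "A \<in> bounded_operators H" and B: "B \<in> bounded_operators H"
  shows "(\<lambda>x. A (B x)) \<in> bounded_operators H"
proof -
  obtain K where K: "K \<ge> 0" "\<forall>x\<in>carrier H. hnorm H (A x) \<le> K * hnorm H x"
    using op_bound[OF A] by blast
  obtain L where L: "L \<ge> 0" "\<forall>x\<in>carrier H. hnorm H (B x) \<le> L * hnorm H x"
    using op_bound[OF B] by blast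
  have "hnorm H (A (B x)) \<le> K * L * hnorm H x" if "x \<in> carrier H" for x
  proof -
    have "hnorm H (A (B x)) \<le> K * hnorm H (B x)"
      using K op_closed[OF B that] by blast
    also have "\<dots> \<le> K * (L * hnorm H x)"
      using K L that by (intro mult_left_mono) auto
    finally show ?thesis by (simp add: mult.assoc)
  qed
  then show ?thesis
    using assms by (intro bounded_operatorsI) (auto simp: op_linear)
qed

lemma bounded_smult_add:
  assumes A: "A \<in> bounded_operators H" and B: "B \<in> bounded_operators H"
  shows "(\<lambda>x. a \<odot> A x \<oplus> B x) \<in> bounded_operators H"
proof -
  obtain K where K: "K \<ge> 0" "\<forall>x\<in>carrier H. hnorm H (A x) \<le> K * hnorm H x"
    using op_bound[OF A] by blast
  obtain L where L: "L \<ge> 0" "\<forall>x\<in>carrier H. hnorm H (B x) \<le> L * hnorm H x"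
    using op_bound[OF B] by blast
  show ?thesis
  proof (rule bounded_operatorsI)
    fix x assume x: "x \<in> carrier H"
    show "a \<odot> A x \<oplus> B x \<in> carrier H" using assms x by auto
    have "hnorm H (a \<odot> A x \<oplus> B x) \<le> cmod a * hnorm H (A x) + hnorm H (B x)"
      using hnorm_triangle[of "a \<odot> A x" "B x"] assms x by simp
    also have "\<dots> \<le> cmod a * (K * hnorm H x) + L * hnorm H x"
      using K L x by (intro add_mono mult_left_mono) auto
    finally show "hnorm H (a \<odot> A x \<oplus> B x) \<le> (cmod a * K + L) * hnorm H x"
      by (simp add: algebra_simps)
  next
    fix x y assume "x \<in> carrier H" "y \<in> carrier H"
    then show "a \<odot> A (x \<oplus> y) \<oplus> B (x \<oplus> y) = a \<odot> A x \<oplus> B x \<oplus> (a \<odot> A y \<oplus> B y)"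
      using assms by (intro vec_eqI) (auto simp: op_linear algebra_simps)
  next
    fix b x assume "x \<in> carrier H"
    then show "a \<odot> A (b \<odot> x) \<oplus> B (b \<odot> x) = b \<odot> (a \<odot> A x \<oplus> B x)"
      using assms by (intro vec_eqI) (auto simp: op_linear algebra_simps)
  qed
qed

lemma bounded_smult:
  assumes A: "A \<in> bounded_operators H"
  shows "(\<lambda>x. a \<odot> A x) \<in> bounded_operators H"
proof -
  have *: "a \<odot> A x = (a - 1) \<odot> A x \<oplus> A x" if "x \<in> carrier H" for x
    using that A by (intro vec_eqI) (auto simp: algebra_simps)
  show ?thesis by (rule op_cong[OF bounded_smult_add[OF A A, of "a - 1"] *])
qed

lemma bounded_diff:
  assumes A: "A \<in> bounded_operators H" and B: "B \<in> bounded_operators H"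
  shows "(\<lambda>x. A x \<ominus> B x) \<in> bounded_operators H"
proof (rule op_cong[OF bounded_smult_add[OF B A, of "-1"]])
  fix x assume "x \<in> carrier H"
  then show "A x \<ominus> B x = - 1 \<odot> B x \<oplus> A x"
    using A B by (intro vec_eqI) auto
qed

lemma op_minus_bounded:
  "A \<in> bounded_operators H \<Longrightarrow> B \<in> bounded_operators H \<Longrightarrow> op_minus H A B \<in> bounded_operators H"
  unfolding op_minus_def by (rule bounded_diff)

lemma poly_op_0 [simp]: "poly_op H T 0 x = \<zero>"
  by (simp add: poly_op_def)

lemma smult_zero_left [simp]: "x \<in> carrier H \<Longrightarrow> 0 \<odot> x = \<zero>"
  using smult_l_null by simp

lemma smult_one_left [simp]: "x \<in> carrier H \<Longrightarrow> 1 \<odot> x = x"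
  using smult_one by simp

context
  fixes T assumes T: "T \<in> bounded_operators H"
begin

lemma poly_op_pCons [simp]:
  "x \<in> carrier H \<Longrightarrow> poly_op H T (pCons a p) x = a \<odot> x \<oplus> T (poly_op H T p x)"
  by (simp add: poly_op_def cCons_def op_zero[OF T])

lemma poly_op_bounded: "poly_op H T p \<in> bounded_operators H"
proof (induction p)
  case 0
  show ?case by (rule bounded_operatorsI[where K = 0]) (simp_all add: vec_eqI)
next
  case (pCons a p)
  show ?case
    by (rule op_cong[OF bounded_smult_add[OF bounded_id bounded_compose[OF T pCons.IH], of a]]) simp
qed

lemma poly_op_closed [simp, intro]: "x \<in> carrier H \<Longrightarrow> poly_op H T p x \<in> carrier H"
  by (rule op_closed[OF poly_op_bounded])

lemma poly_op_add: "x \<in> carrier H \<Longrightarrow> poly_op H T (p + q) x = poly_op H T p x \<oplus> poly_op H T q x"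
  by (induction p q rule: poly_induct2)
    (auto intro!: vec_eqI simp: op_linear[OF T] op_closed[OF T] algebra_simps)

lemma poly_op_smult: "x \<in> carrier H \<Longrightarrow> poly_op H T (Polynomial.smult a p) x = a \<odot> poly_op H T p x"
  by (induction p)
    (auto intro!: vec_eqI simp: op_linear[OF T] op_closed[OF T] algebra_simps)

lemma poly_op_diff:
  assumes "x \<in> carrier H"
  shows "poly_op H T (p - q) x = poly_op H T p x \<ominus> poly_op H T q x"
proof -
  have "p - q = p + Polynomial.smult (-1) q" by simp
  then have "poly_op H T (p - q) x = poly_op H T p x \<oplus> (-1) \<odot> poly_op H T q x"
    using assms by (simp only: poly_op_add poly_op_smult)
  also have "\<dots> = poly_op H T p x \<ominus> poly_op H T q x"
    using assms by (intro vec_eqI) auto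
  finally show ?thesis .
qed

lemma poly_op_mult: "x \<in> carrier H \<Longrightarrow> poly_op H T (p * q) x = poly_op H T p (poly_op H T q x)"
  by (induction p) (auto simp: poly_op_add poly_op_smult op_closed[OF T])

lemma poly_op_1 [simp]: "x \<in> carrier H \<Longrightarrow> poly_op H T 1 x = x"
  by (simp add: one_pCons op_zero[OF T])

lemma poly_op_power: "x \<in> carrier H \<Longrightarrow> poly_op H T (p ^ n) x = (poly_op H T p ^^ n) x"
  by (induction n) (auto simp: poly_op_mult)

lemma poly_op_commute:
  assumes S: "S \<in> bounded_operators H" and ST: "\<And>x. x \<in> carrier H \<Longrightarrow> S (T x) = T (S x)"
    and x: "x \<in> carrier H"
  shows "S (poly_op H T p x) = poly_op H T p (S x)"
  by (induction p) (use x in \<open>auto simp: op_linear[OF S] op_closed[OF S] op_closed[OF T] ST\<close>)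

end

lemma poly_op_swap:
  assumes "T \<in> bounded_operators H" "x \<in> carrier H"
  shows "poly_op H T p (poly_op H T q x) = poly_op H T q (poly_op H T p x)"
  using assms by (simp flip: poly_op_mult add: mult.commute)

lemma funpow_closed: "T \<in> bounded_operators H \<Longrightarrow> x \<in> carrier H \<Longrightarrow> (T ^^ n) x \<in> carrier H"
  by (induction n) auto

section \<open>Invertible operators and their factors\<close>

lemma invertible_op_cong:
  assumes "\<And>x. x \<in> carrier H \<Longrightarrow> T x = T' x"
  shows "invertible_op H T \<longleftrightarrow> invertible_op H T'"
proof -
  have "(\<forall>x\<in>carrier H. S (T x) = x \<and> T (S x) = x) \<longleftrightarrow> (\<forall>x\<in>carrier H. S (T' x) = x \<and> T' (S x) = x)"
    if "S \<in> bounded_operators H" for S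
    using assms op_closed[OF that] by auto
  then show ?thesis unfolding invertible_op_def by (rule bex_cong[OF refl])
qed

text \<open>Insert \<open>G (S x)\<close> for \<open>x\<close>, move \<open>A\<close> past
  \<open>G\<close> and cancel. This is how inverses come to preserve the range of an idempotent that
  commutes with \<open>G\<close>.\<close>

lemma inverse_commute:
  assumes "A \<in> bounded_operators H" "G \<in> bounded_operators H" "S \<in> bounded_operators H"
    and "\<And>x. x \<in> carrier H \<Longrightarrow> A (G x) = G (A x)"
    and "\<And>x. x \<in> carrier H \<Longrightarrow> S (G x) = x" "\<And>x. x \<in> carrier H \<Longrightarrow> G (S x) = x"
    and "x \<in> carrier H"
  shows "A (S x) = S (A x)"
proof -
  have "S (A x) = S (A (G (S x)))" using assms by simp
  also have "\<dots> = S (G (A (S x)))" using assms by (metis op_closed)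
  also have "\<dots> = A (S x)" using assms by (simp add: op_closed)
  finally show ?thesis by simp
qed

text \<open>If \<open>S\<close> inverts the product, then \<open>B S\<close> inverts
  \<open>A\<close>: \<open>A B S = 1\<close> is immediate, and \<open>B S A = 1\<close> because
  \<open>A\<close> commutes with the product and hence with \<open>S\<close>.\<close>

lemma invertible_factor:
  assumes A: "A \<in> bounded_operators H" and B: "B \<in> bounded_operators H"
    and AB: "\<And>x. x \<in> carrier H \<Longrightarrow> A (B x) = B (A x)"
    and G: "invertible_op H (\<lambda>x. A (B x))"
  shows "invertible_op H A"
proof -
  obtain S where S: "S \<in> bounded_operators H" 
    "\<And>x. x \<in> carrier H \<Longrightarrow> S (A (B x)) = x" "\<And>x. x \<in> carrier H \<Longrightarrow> A (B (S x)) = x"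
    using G unfolding invertible_op_def by auto
  have "A (S x) = S (A x)" if "x \<in> carrier H" for x
    by (rule inverse_commute[OF A bounded_compose[OF A B] S(1) _ S(2,3) that])
       (use AB op_closed[OF A] in auto)
  then have "\<forall>x\<in>carrier H. B (S (A x)) = x \<and> A (B (S x)) = x"
    using AB S op_closed[OF S(1)] by metis
  then show ?thesis unfolding invertible_op_def by (rule bexI[OF _ bounded_compose[OF B S(1)]])
qed

lemma invertible_compose:
  assumes "invertible_op H A" "invertible_op H B"
    and A: "A \<in> bounded_operators H" and B: "B \<in> bounded_operators H"
  shows "invertible_op H (\<lambda>x. A (B x))"
proof -
  obtain S where S: "S \<in> bounded_operators H" "\<forall>x\<in>carrier H. S (A x) = x \<and> A (S x) = x"
    using assms unfolding invertible_op_def by blast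
  obtain R where R: "R \<in> bounded_operators H" "\<forall>x\<in>carrier H. R (B x) = x \<and> B (R x) = x"
    using assms unfolding invertible_op_def by blast
  have "\<forall>x\<in>carrier H. R (S (A (B x))) = x \<and> A (B (R (S x))) = x"
    using S R op_closed[OF A] op_closed[OF B] op_closed[OF S(1)] op_closed[OF R(1)] by simp
  then show ?thesis unfolding invertible_op_def by (rule bexI[OF _ bounded_compose[OF R(1) S(1)]])
qed

lemma invertible_smult:
  assumes "invertible_op H A" "a \<noteq> 0" and A: "A \<in> bounded_operators H"
  shows "invertible_op H (\<lambda>x. a \<odot> A x)"
proof -
  have "\<forall>x\<in>carrier H. inverse a \<odot> (a \<odot> x) = x \<and> a \<odot> (inverse a \<odot> x) = x"
    using assms by (auto intro!: vec_eqI)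
  then have "invertible_op H (\<lambda>x. a \<odot> x)"
    unfolding invertible_op_def by (rule bexI[OF _ bounded_smult[OF bounded_id, of "inverse a"]])
  from invertible_compose[OF this assms(1) bounded_smult[OF bounded_id] A] show ?thesis .
qed

text \<open>Polynomials in one operator commute. In this form a part of the spectral mapping theorem
  carries information from \<open>T - T^2\<close> to \<open>T\<close>, or from \<open>C^2\<close> to
  \<open>C\<close>.\<close>

lemma invertible_poly_op_factor:
  assumes "T \<in> bounded_operators H" "invertible_op H (poly_op H T (p * q))"
  shows "invertible_op H (poly_op H T p)"
proof (rule invertible_factor)
  show "invertible_op H (\<lambda>x. poly_op H T p (poly_op H T q x))"
    using assms(2) invertible_op_cong[OF poly_op_mult[OF assms(1)]] by simp
qed (use assms in \<open>auto simp: poly_op_bounded poly_op_swap\<close>)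

lemma invertible_poly_op_mult:
  assumes T: "T \<in> bounded_operators H"
    and "invertible_op H (poly_op H T p)" "invertible_op H (poly_op H T q)"
  shows "invertible_op H (poly_op H T (p * q))"
  using invertible_compose[OF assms(2,3) poly_op_bounded[OF T] poly_op_bounded[OF T]]
    invertible_op_cong[OF poly_op_mult[OF T]] by simp

lemma in_spectrum_iff:
  assumes T: "T \<in> bounded_operators H"
  shows "c \<in> spectrum H T \<longleftrightarrow> \<not> invertible_op H (poly_op H T [:-c, 1:])"
proof -
  have "op_minus H T (\<lambda>x. c \<odot> x) x = poly_op H T [:-c, 1:] x" if "x \<in> carrier H" for x
    using that T by (auto intro!: vec_eqI simp: op_minus_def op_zero)
  from invertible_op_cong[OF this] show ?thesis unfolding spectrum_def by simp
qed

lemma invertible_bounded_below: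
  assumes "invertible_op H T" "T \<in> bounded_operators H"
  shows "\<exists>c>0. \<forall>x\<in>carrier H. hnorm H x \<le> c * hnorm H (T x)"
proof -
  obtain S where S: "S \<in> bounded_operators H" "\<forall>x\<in>carrier H. S (T x) = x"
    using assms unfolding invertible_op_def by blast
  obtain K where K: "K \<ge> 0" "\<forall>x\<in>carrier H. hnorm H (S x) \<le> K * hnorm H x"
    using op_bound[OF S(1)] by blast
  have "hnorm H x \<le> (K + 1) * hnorm H (T x)" if "x \<in> carrier H" for x
  proof -
    have "hnorm H x \<le> K * hnorm H (T x)"
      using K S that op_closed[OF assms(2)] by metis
    then show ?thesis using hnorm_nonneg[OF op_closed[OF assms(2) that]] by (simp add: algebra_simps)
  qed
  then show ?thesis using K by (intro exI[of _ "K + 1"]) auto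
qed

text \<open>Serves to prove identities for limit operators: the difference of the two sides is
  bounded by \<open>C * a ^ k\<close> for every \<open>k\<close>, which replaces uniqueness of
  limits.\<close>

lemma hnorm_le_geometric_imp_zero:
  assumes "v \<in> carrier H" "0 \<le> a" "a < 1" "\<And>k. hnorm H v \<le> C * a ^ k"
  shows "v = \<zero>"
proof -
  have "(\<lambda>k. C * a ^ k) \<longlonglongrightarrow> C * 0"
    using assms by (intro tendsto_mult tendsto_const LIMSEQ_power_zero) auto
  then have "hnorm H v \<le> 0" using assms(4) by (intro LIMSEQ_le_const) auto
  then have "hnorm H v = 0" using hnorm_nonneg[OF assms(1)] by linarith
  then show ?thesis using assms(1) by simp
qed

end

context separable_hilbert_space
begin

text \<open>Telescoping bounds the tail of the increments by \<open>c / (1 - a) * a ^ k\<close>, so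
  the sequence is Cauchy at each vector. The rate is uniform in \<open>x\<close> and is kept in the
  conclusion, since the later properties of \<open>P\<close> are derived from it.\<close>

lemma geometric_operator_limit:
  assumes S: "\<And>k. S k \<in> bounded_operators H" and a: "0 \<le> a" "a < 1" and c: "0 \<le> c"
    and step: "\<And>k x. x \<in> carrier H \<Longrightarrow> hnorm H (S (Suc k) x \<ominus> S k x) \<le> c * a ^ k * hnorm H x"
  shows "\<exists>P\<in>bounded_operators H. \<exists>C\<ge>0. \<forall>k. \<forall>x\<in>carrier H. hnorm H (S k x \<ominus> P x) \<le> C * a ^ k * hnorm H x"
proof -
  define C where "C = c / (1 - a)"
  have C: "C \<ge> 0" using a c by (simp add: C_def)
  \<comment> \<open>The factor \<open>1 - a ^ j\<close> is the exact value of a partial geometric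
    sum; without it the induction on \<open>j\<close> would not close.\<close>
  have le1: "hnorm H (S (k + j) x \<ominus> S k x) \<le> C * a ^ k * (1 - a ^ j) * hnorm H x"
    if x: "x \<in> carrier H" for x k j
  proof (induction j)
    case 0
    then show ?case using S x by (simp add: op_closed)
  next
    case (Suc j)
    have "hnorm H (S (k + Suc j) x \<ominus> S k x) \<le>
      hnorm H (S (Suc (k + j)) x \<ominus> S (k + j) x) + hnorm H (S (k + j) x \<ominus> S k x)"
      using hnorm_dist_triangle[OF op_closed[OF S x] op_closed[OF S x] op_closed[OF S x]] by simp
    also have "\<dots> \<le> c * a ^ (k + j) * hnorm H x + C * a ^ k * (1 - a ^ j) * hnorm H x"
      using step[OF x, of "k + j"] Suc by (intro add_mono)
    also have "c = C * (1 - a)" using a by (simp add: C_def)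
    finally show ?case by (simp add: algebra_simps power_add)
  qed
  have le: "hnorm H (S (k + j) x \<ominus> S k x) \<le> C * a ^ k * hnorm H x"
    if x: "x \<in> carrier H" for x k j
  proof -
    have "C * a ^ k * (1 - a ^ j) * hnorm H x \<le> C * a ^ k * 1 * hnorm H x"
      using C a x by (intro mult_right_mono mult_left_mono) auto
    then show ?thesis using le1[OF x, of k j] by simp
  qed
  have "\<exists>y\<in>carrier H. \<forall>k. hnorm H (S k x \<ominus> y) \<le> C * a ^ k * hnorm H x" if x: "x \<in> carrier H" for x
  proof -
    have Sx: "S k x \<in> carrier H" for k using S x by (simp add: op_closed)
    have cau: "\<exists>N. \<forall>m\<ge>N. \<forall>n\<ge>N. hnorm H (S m x \<ominus> S n x) < e" if "e > 0" for e
    proof -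
      have "(\<lambda>k. 2 * C * hnorm H x * a ^ k) \<longlonglongrightarrow> 2 * C * hnorm H x * 0"
        using a by (intro tendsto_mult tendsto_const LIMSEQ_power_zero) auto
      then have "\<forall>\<^sub>F k in sequentially. 2 * C * hnorm H x * a ^ k < e"
        using \<open>e > 0\<close> by (intro order_tendstoD(2)[of _ 0]) auto
      then obtain N where "\<forall>k\<ge>N. 2 * C * hnorm H x * a ^ k < e"
        unfolding eventually_sequentially ..
      then have N: "2 * C * hnorm H x * a ^ N < e" by blast
      have "hnorm H (S m x \<ominus> S n x) < e" if mn: "m \<ge> N" "n \<ge> N" for m n
      proof -
        obtain i j where ij: "m = N + i" "n = N + j" using le_Suc_ex[OF mn(1)] le_Suc_ex[OF mn(2)] by blast
        have "hnorm H (S m x \<ominus> S n x) \<le> hnorm H (S m x \<ominus> S N x) + hnorm H (S N x \<ominus> S n x)"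
          by (rule hnorm_dist_triangle[OF Sx Sx Sx])
        also have "hnorm H (S N x \<ominus> S n x) = hnorm H (S n x \<ominus> S N x)"
          by (rule hnorm_minus_commute[OF Sx Sx])
        also have "hnorm H (S m x \<ominus> S N x) + hnorm H (S n x \<ominus> S N x) \<le> 2 * C * hnorm H x * a ^ N"
          using le[OF x, of N i] le[OF x, of N j] by (simp add: ij algebra_simps)
        finally show ?thesis using N by simp
      qed
      then show ?thesis by blast
    qed
    have ran: "range (\<lambda>k. S k x) \<subseteq> carrier H" using Sx by auto
    have "\<exists>y\<in>carrier H. (\<lambda>n. hnorm H (S n x \<ominus> y)) \<longlonglongrightarrow> 0"
    proof (rule complete[unfolded mcomplete_iff, THEN spec, THEN mp, THEN mp, OF ran], intro allI impI)
      fix e :: real assume "e > 0"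
      then show "\<exists>N. \<forall>m\<ge>N. \<forall>n\<ge>N. hnorm H (S m x \<ominus> S n x) < e" by (rule cau)
    qed
    then obtain y where y: "y \<in> carrier H" "(\<lambda>n. hnorm H (S n x \<ominus> y)) \<longlonglongrightarrow> 0" ..
    have "hnorm H (S k x \<ominus> y) \<le> C * a ^ k * hnorm H x" for k
    proof (rule LIMSEQ_le_const)
      show "(\<lambda>j. C * a ^ k * hnorm H x + hnorm H (S (j + k) x \<ominus> y)) \<longlonglongrightarrow> C * a ^ k * hnorm H x"
        using tendsto_add[OF tendsto_const LIMSEQ_ignore_initial_segment[OF y(2)]] by simp
      have "hnorm H (S k x \<ominus> y) \<le> C * a ^ k * hnorm H x + hnorm H (S (j + k) x \<ominus> y)" for j
        using hnorm_dist_triangle[OF Sx Sx y(1), of k "k + j"] le[OF x, of k j]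
          hnorm_minus_commute[OF Sx Sx, of k "k + j"] by (simp add: add.commute)
      then show "\<exists>N. \<forall>j\<ge>N. hnorm H (S k x \<ominus> y) \<le> C * a ^ k * hnorm H x + hnorm H (S (j + k) x \<ominus> y)"
        by blast
    qed
    then show ?thesis using y(1) by blast
  qed
  then obtain P where P: "\<And>x. x \<in> carrier H \<Longrightarrow> P x \<in> carrier H"
    and PS: "\<And>x k. x \<in> carrier H \<Longrightarrow> hnorm H (S k x \<ominus> P x) \<le> C * a ^ k * hnorm H x"
    by metis
  obtain K where K: "K \<ge> 0" "\<forall>x\<in>carrier H. hnorm H (S 0 x) \<le> K * hnorm H x"
    using op_bound[OF S] by blast
  have "P \<in> bounded_operators H"
  proof (rule bounded_operatorsI)
    fix x assume x: "x \<in> carrier H"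
    then show "P x \<in> carrier H" by (rule P)
    have "P x = S 0 x \<ominus> (S 0 x \<ominus> P x)"
      using P x S by (intro vec_eqI) (auto simp: op_closed)
    then have "hnorm H (P x) \<le> hnorm H (S 0 x) + hnorm H (S 0 x \<ominus> P x)"
      using hnorm_triangle_minus P x S by (metis M.minus_closed op_closed)
    then show "hnorm H (P x) \<le> (K + C) * hnorm H x"
      using K(2)[rule_format, OF x] PS[OF x, of 0] by (simp add: algebra_simps)
  next
    fix x y assume x: "x \<in> carrier H" and y: "y \<in> carrier H"
    \<comment> \<open>Each \<open>S k\<close> is additive, so the defect of \<open>P\<close> is a
      combination of three approximation errors.\<close>
    have "hnorm H (P (x \<oplus> y) \<ominus> (P x \<oplus> P y)) \<le> (C * (hnorm H (x \<oplus> y) + hnorm H x + hnorm H y)) * a ^ k" for k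
    proof -
      have "P (x \<oplus> y) \<ominus> (P x \<oplus> P y) = (S k x \<ominus> P x) \<oplus> ((S k y \<ominus> P y) \<ominus> (S k (x \<oplus> y) \<ominus> P (x \<oplus> y)))"
        using P x y S by (intro vec_eqI) (auto simp: op_closed op_add)
      also have "hnorm H \<dots> \<le> hnorm H (S k x \<ominus> P x) +
          (hnorm H (S k y \<ominus> P y) + hnorm H (S k (x \<oplus> y) \<ominus> P (x \<oplus> y)))"
        using P x y S by (intro order_trans[OF hnorm_triangle] add_left_mono hnorm_triangle_minus)
          (auto simp: op_closed)
      finally show ?thesis
        using PS[OF x, of k] PS[OF y, of k] PS[of "x \<oplus> y" k] x y by (simp add: algebra_simps)
    qed
    then have "P (x \<oplus> y) \<ominus> (P x \<oplus> P y) = \<zero>"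
      using P x y a by (intro hnorm_le_geometric_imp_zero) auto
    then show "P (x \<oplus> y) = P x \<oplus> P y" using P x y by simp
  next
    fix b x assume x: "x \<in> carrier H"
    have "hnorm H (P (b \<odot> x) \<ominus> b \<odot> P x) \<le> (C * (2 * cmod b * hnorm H x)) * a ^ k" for k
    proof -
      have "P (b \<odot> x) \<ominus> b \<odot> P x = b \<odot> (S k x \<ominus> P x) \<ominus> (S k (b \<odot> x) \<ominus> P (b \<odot> x))"
        using P x S by (intro vec_eqI) (auto simp: op_closed op_smult algebra_simps)
      also have "hnorm H \<dots> \<le> cmod b * hnorm H (S k x \<ominus> P x) + hnorm H (S k (b \<odot> x) \<ominus> P (b \<odot> x))"
        using P x S by (intro order_trans[OF hnorm_triangle_minus]) (auto simp: op_closed)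
      also have "\<dots> \<le> cmod b * (C * a ^ k * hnorm H x) + C * a ^ k * hnorm H (b \<odot> x)"
        using PS[OF x, of k] PS[of "b \<odot> x" k] x by (intro add_mono mult_left_mono) auto
      finally show ?thesis using x by (simp add: algebra_simps)
    qed
    then have "P (b \<odot> x) \<ominus> b \<odot> P x = \<zero>"
      using P x a by (intro hnorm_le_geometric_imp_zero) auto
    then show "P (b \<odot> x) = b \<odot> P x" using P x by simp
  qed
  then show ?thesis using PS C by blast
qed

end

section \<open>Powers of quasinilpotent operators\<close>

text \<open>Multiplication by \<open>w\<close> shifts Taylor coefficients by one place. The
  resolvent below satisfies an equation of exactly this shape.\<close>

lemma higher_deriv_const_plus_mult_ident:
  fixes h :: "complex \<Rightarrow> complex"
  assumes "h holomorphic_on UNIV"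
  shows "(deriv ^^ Suc n) (\<lambda>w. c + w * h w) 0 = of_nat (Suc n) * (deriv ^^ n) h 0"
proof -
  have "(deriv ^^ Suc n) (\<lambda>w. c + w * h w) 0
      = (deriv ^^ Suc n) (\<lambda>w. c) 0 + (deriv ^^ Suc n) (\<lambda>w. w * h w) 0"
    by (rule higher_deriv_add[of _ UNIV]) (auto intro!: holomorphic_intros assms)
  also have "\<dots> = (deriv ^^ Suc n) (\<lambda>w. w * h w) 0"
    using higher_deriv_const[of "Suc n" c] by simp
  also have "\<dots> = (\<Sum>i = 0..Suc n. of_nat (Suc n choose i) * (deriv ^^ i) (\<lambda>w. w) 0 * (deriv ^^ (Suc n - i)) h 0)"
    by (rule higher_deriv_mult[of _ UNIV]) (auto intro!: holomorphic_intros assms)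
  \<comment> \<open>At \<open>0\<close> the identity function has value \<open>0\<close>, first
    derivative \<open>1\<close> and no higher ones, so only \<open>i = 1\<close> survives in the
    Leibniz formula.\<close>
  also have "\<dots> = (\<Sum>i\<in>{1}. of_nat (Suc n choose i) * (deriv ^^ i) (\<lambda>w. w) 0 * (deriv ^^ (Suc n - i)) h 0)"
    by (rule sum.mono_neutral_right) (auto simp del: funpow.simps)
  also have "\<dots> = of_nat (Suc n) * (deriv ^^ n) h 0"
    by (simp del: funpow.simps)
  finally show ?thesis .
qed

context complex_inner_space
begin

text \<open>For \<open>w \<noteq> 0\<close>, \<open>1 - w T = - w (T - 1 / w)\<close>. Inverting the
  spectral variable moves the exceptional point \<open>0\<close> to infinity, so that the inverse
  exists on the whole complex plane.\<close>

lemma resolvent_family: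
  assumes T: "T \<in> bounded_operators H"
    and inv: "\<And>c. c \<noteq> 0 \<Longrightarrow> invertible_op H (poly_op H T [:-c, 1:])"
  shows "invertible_op H (poly_op H T [:1, -w:])"
proof (cases "w = 0")
  case True
  have eq: "[:1, -w:] = 1" using True by (simp add: one_pCons)
  show ?thesis
    unfolding invertible_op_def
  proof (rule bexI[OF _ bounded_id], intro ballI conjI)
    fix x assume "x \<in> carrier H"
    then show "poly_op H T [:1, -w:] x = x" unfolding eq by (rule poly_op_1[OF T])
    then show "poly_op H T [:1, -w:] x = x" .
  qed
next
  case False
  have "invertible_op H (\<lambda>x. (- w) \<odot> poly_op H T [:- (1 / w), 1:] x)"
    by (rule invertible_smult) (use False inv[of "1 / w"] poly_op_bounded[OF T] in auto)
  moreover have "(- w) \<odot> poly_op H T [:- (1 / w), 1:] x = poly_op H T [:1, -w:] x" if "x \<in> carrier H" for x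
  proof -
    have "Polynomial.smult (- w) [:- (1 / w), 1:] = [:1, -w:]" using False by simp
    then show ?thesis using poly_op_smult[OF T that, of "-w" "[:- (1 / w), 1:]"] by simp
  qed
  ultimately show ?thesis using invertible_op_cong by metis
qed

text \<open>The scalar functions \<open>\<langle>(1 - w T)\<^sup>-\<^sup>1 x, y\<rangle>\<close> are entire with Taylor coefficients \<open>\<langle>T\<^sup>n x, y\<rangle>\<close>;
  Cauchy's inequality on a circle, taken at \<open>y = T\<^sup>n x\<close>, bounds the powers without the uniform
  boundedness principle.\<close>
lemma resolvent_power_bound:
  assumes T: "T \<in> bounded_operators H"
    and inv: "\<And>c. c \<noteq> 0 \<Longrightarrow> invertible_op H (poly_op H T [:-c, 1:])"
    and r: "r > 0"
  shows "\<exists>M\<ge>0. \<forall>n. \<forall>x\<in>carrier H. r ^ n * hnorm H ((T ^^ n) x) \<le> M * hnorm H x"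
proof -
  \<comment> \<open>The inverses are chosen separately for each \<open>w\<close>; their regularity
    in \<open>w\<close> is a consequence of the resolvent identity below.\<close>
  have "\<forall>w. \<exists>S. S \<in> bounded_operators H \<and> (\<forall>x\<in>carrier H. S (poly_op H T [:1, -w:] x) = x
      \<and> poly_op H T [:1, -w:] (S x) = x)"
    using resolvent_family[OF T inv] unfolding invertible_op_def Bex_def by iprover
  then obtain R where R': "\<forall>w. R w \<in> bounded_operators H \<and> (\<forall>x\<in>carrier H. R w (poly_op H T [:1, -w:] x) = x
      \<and> poly_op H T [:1, -w:] (R w x) = x)"
    by (rule choice[THEN exE])
  have R: "R w \<in> bounded_operators H" for w using R' by iprover
  note cl = op_closed[OF T] op_closed[OF R]
  note lin = op_linear[OF T] op_linear[OF R]
  have pT: "poly_op H T [:1, -w:] x = x \<ominus> w \<odot> T x" if "x \<in> carrier H" for w x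
    using that cl by (intro vec_eqI) (auto simp: poly_op_pCons[OF T] lin)
  have R1: "R w (x \<ominus> w \<odot> T x) = x" if x: "x \<in> carrier H" for w x
    using R' x pT[OF x] by metis
  have R2: "R w x \<ominus> w \<odot> T (R w x) = x" if x: "x \<in> carrier H" for w x
    using R' x pT[OF op_closed[OF R x]] by metis
  have RT: "R w (T x) = T (R w x)" if x: "x \<in> carrier H" for w x
    by (rule inverse_commute[OF T poly_op_bounded[OF T, of "[:1,-w:]"] R, symmetric])
       (use R' x in \<open>auto simp: poly_op_commute[OF T T]\<close>)
  have resolvent: "R w x \<ominus> R v x = (w - v) \<odot> R w (T (R v x))" if x: "x \<in> carrier H" for w v x
  proof -
    define y where "y = R v x"
    have y: "y \<in> carrier H" using x cl by (simp add: y_def)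
    have "R w (y \<ominus> v \<odot> T y) \<ominus> R w (y \<ominus> w \<odot> T y) = (w - v) \<odot> R w (T y)"
      using y cl by (intro vec_eqI) (auto simp: lin algebra_simps)
    then show ?thesis using R1[OF y, of w] R2[OF x, of v] by (simp add: y_def)
  qed
  obtain L where L: "L \<ge> 0" "\<forall>x\<in>carrier H. hnorm H (T x) \<le> L * hnorm H x"
    using op_bound[OF T] by blast
  have "\<forall>w. \<exists>k. k \<ge> 0 \<and> (\<forall>x\<in>carrier H. hnorm H (R w x) \<le> k * hnorm H x)"
    using op_bound[OF R] by metis
  then obtain K where K': "\<forall>w. K w \<ge> 0 \<and> (\<forall>x\<in>carrier H. hnorm H (R w x) \<le> K w * hnorm H x)"
    by (rule choice[THEN exE])
  have K0: "K w \<ge> 0" for w using K' by iprover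
  have K: "hnorm H (R w x) \<le> K w * hnorm H x" if "x \<in> carrier H" for w x using K' that by blast
  have KT: "hnorm H (R v (T x)) \<le> K v * L * hnorm H x" if x: "x \<in> carrier H" for v x
  proof -
    have "hnorm H (R v (T x)) \<le> K v * hnorm H (T x)" by (rule K) (use x cl in simp)
    also have "\<dots> \<le> K v * (L * hnorm H x)" using L x K0 by (intro mult_left_mono) auto
    finally show ?thesis by simp
  qed
  \<comment> \<open>The radius is chosen to give \<open>d v * (K v * L) \<le> 1 / 2\<close>, so that
    the perturbation term in the local bound is absorbed by the left-hand side. The \<open>1\<close>
    covers \<open>K v * L = 0\<close>.\<close>
  define d where "d v = inverse (2 * (K v * L + 1))" for v
  have d: "d v > 0" "d v * (K v * L) \<le> 1 / 2" for v
  proof -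
    have "K v * L \<ge> 0" using K0 L by simp
    then show "d v > 0" "d v * (K v * L) \<le> 1 / 2"
      unfolding d_def by (simp_all add: field_simps)
  qed
  have loc: "hnorm H (R w x) \<le> 2 * K v * hnorm H x" if x: "x \<in> carrier H" and w: "cmod (w - v) < d v" for x w v
  proof -
    have "R w x = R v x \<oplus> (w - v) \<odot> R v (T (R w x))"
    proof -
      have "R w x = R v x \<ominus> (R v x \<ominus> R w x)" using x cl by (intro vec_eqI) auto
      also have "\<dots> = R v x \<ominus> (v - w) \<odot> R v (T (R w x))" using resolvent[OF x, of v w] by simp
      also have "\<dots> = R v x \<oplus> (w - v) \<odot> R v (T (R w x))"
        using x cl by (intro vec_eqI) (auto simp: algebra_simps)
      finally show ?thesis .
    qed
    then have "hnorm H (R w x) \<le> hnorm H (R v x) + cmod (w - v) * hnorm H (R v (T (R w x)))"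
      using hnorm_triangle[of "R v x" "(w - v) \<odot> R v (T (R w x))"] x cl by simp
    also have "cmod (w - v) * hnorm H (R v (T (R w x))) \<le> d v * (K v * L * hnorm H (R w x))"
      using w x cl d KT[of "R w x" v] by (intro mult_mono) (auto intro: less_imp_le)
    also have "\<dots> \<le> 1 / 2 * hnorm H (R w x)"
      using mult_right_mono[OF d(2)[of v], of "hnorm H (R w x)"] x cl by (simp add: mult.assoc)
    finally show ?thesis using K[OF x, of v] by simp
  qed
  have diff: "((\<lambda>w. cinner H (R w x) y) has_field_derivative cinner H (R v (T (R v x))) y) (at v)"
    if x: "x \<in> carrier H" and y: "y \<in> carrier H" for x y v
  proof -
    define z where "z = T (R v x)"
    have z: "z \<in> carrier H" using x cl by (simp add: z_def)
    have near: "eventually (\<lambda>w. w \<noteq> v \<and> cmod (w - v) < d v) (at v)"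
      using d(1)[of v] by (auto simp: eventually_at dist_norm intro!: exI[of _ "d v"])
    \<comment> \<open>By the resolvent identity the difference of the two values carries a factor
      \<open>w - v\<close>; the local bound controls the rest.\<close>
    have "((\<lambda>w. cinner H (R w z) y) \<longlongrightarrow> cinner H (R v z) y) (at v)"
    proof -
      have bnd: "eventually (\<lambda>w. norm (cinner H (R w z) y - cinner H (R v z) y)
          \<le> cmod (w - v) * (2 * K v * hnorm H z * hnorm H y * K v * L)) (at v)"
        using near
      proof eventually_elim
        case (elim w)
        have "cinner H (R w z) y - cinner H (R v z) y = cinner H (R w z \<ominus> R v z) y"
          using z y cl by simp
        also have "\<dots> = (w - v) * cinner H (R w (T (R v z))) y"
          using resolvent[OF z, of w v] y z cl by simp
        finally have "norm (cinner H (R w z) y - cinner H (R v z) y) = cmod (w - v) * cmod (cinner H (R w (T (R v z))) y)"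
          by (simp add: norm_mult)
        also have "\<dots> \<le> cmod (w - v) * (hnorm H (R w (T (R v z))) * hnorm H y)"
          using y z cl by (intro mult_left_mono Cauchy_Schwarz) auto
        also have "hnorm H (R w (T (R v z))) = hnorm H (R w (R v (T z)))"
          using RT[OF z] by simp
        also have "\<dots> \<le> 2 * K v * hnorm H (R v (T z))"
          by (rule loc) (use elim z cl in auto)
        also have "\<dots> \<le> 2 * K v * (K v * L * hnorm H z)"
          using KT[OF z, of v] K0[of v] by (intro mult_left_mono) auto
        finally show ?case using y by (simp add: mult_left_mono mult_right_mono algebra_simps)
      qed
      have "((\<lambda>w. cmod (w - v) * (2 * K v * hnorm H z * hnorm H y * K v * L)) \<longlongrightarrow> 0) (at v)"
        by (rule tendsto_eq_intros refl | simp)+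
      from Lim_null_comparison[OF bnd this] show ?thesis by (rule LIM_zero_cancel)
    qed
    moreover have "eventually (\<lambda>w. cinner H (R w z) y = (cinner H (R w x) y - cinner H (R v x) y) / (w - v)) (at v)"
      using near
    proof eventually_elim
      case (elim w)
      have "cinner H (R w x) y - cinner H (R v x) y = cinner H (R w x \<ominus> R v x) y"
        using x y cl by simp
      also have "\<dots> = (w - v) * cinner H (R w z) y"
        using resolvent[OF x, of w v] y z cl by (simp add: z_def)
      finally show ?case using elim by simp
    qed
    ultimately have "((\<lambda>w. (cinner H (R w x) y - cinner H (R v x) y) / (w - v)) \<longlongrightarrow> cinner H (R v z) y) (at v)"
      by (rule Lim_transform_eventually)
    then show ?thesis unfolding has_field_derivative_iff z_def .
  qed
  have holo: "(\<lambda>w. cinner H (R w x) y) holomorphic_on UNIV" if "x \<in> carrier H" "y \<in> carrier H" for x y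
  proof (rule holomorphic_onI)
    fix w :: complex
    show "(\<lambda>w. cinner H (R w x) y) field_differentiable at w within UNIV"
      using diff[OF that, of w] unfolding field_differentiable_def by auto
  qed
  have Tn: "(T ^^ n) x \<in> carrier H" if "x \<in> carrier H" for n x
    by (rule funpow_closed[OF T that])
  have hd: "(deriv ^^ n) (\<lambda>w. cinner H (R w x) y) 0 = fact n * cinner H ((T ^^ n) x) y"
    if x: "x \<in> carrier H" and y: "y \<in> carrier H" for n x y
    using x
  proof (induction n arbitrary: x)
    case 0
    have "R 0 x = R 0 x \<ominus> 0 \<odot> T (R 0 x)" using cl 0 by (intro vec_eqI) auto
    then have "R 0 x = x" using R2[OF 0, of 0] by simp
    then show ?case by simp
  next
    case (Suc n)
    \<comment> \<open>From \<open>R w x = x + w T (R w x)\<close> and the commutation of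
      \<open>T\<close> with \<open>R w\<close>; the next coefficient at \<open>x\<close> thereby
      becomes the present one at \<open>T x\<close>.\<close>
    have eq: "(\<lambda>w. cinner H (R w x) y) = (\<lambda>w. cinner H x y + w * cinner H (R w (T x)) y)"
    proof
      fix w
      have "cinner H (R w x \<ominus> w \<odot> T (R w x)) y = cinner H x y"
        using R2[OF Suc.prems, of w] by simp
      then show "cinner H (R w x) y = cinner H x y + w * cinner H (R w (T x)) y"
        using Suc.prems y cl RT[OF Suc.prems, of w] by (simp add: algebra_simps)
    qed
    show ?case
      unfolding eq higher_deriv_const_plus_mult_ident[OF holo[OF op_closed[OF T Suc.prems] y]]
        Suc.IH[OF op_closed[OF T Suc.prems]]
      by (simp add: funpow_swap1)
  qed
  obtain F where F: "finite F" "cball 0 r \<subseteq> (\<Union>v\<in>F. ball v (d v))"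
  proof (rule compactE_image[of "cball 0 r" UNIV "\<lambda>v. ball v (d v)"])
    show "cball 0 r \<subseteq> (\<Union>v. ball v (d v))" using d(1) by (meson UN_I UNIV_I centre_in_ball subsetI)
  qed auto
  \<comment> \<open>The sum over the finite subcover dominates each of its local bounds.\<close>
  define M where "M = (\<Sum>v\<in>F. 2 * K v)"
  have M0: "M \<ge> 0" unfolding M_def using K0 by (simp add: sum_nonneg)
  have M: "hnorm H (R w x) \<le> M * hnorm H x" if x: "x \<in> carrier H" and w: "cmod w \<le> r" for w x
  proof -
    have "w \<in> cball 0 r" using w by simp
    then obtain v where v: "v \<in> F" "w \<in> ball v (d v)" using F(2) by blast
    then have "cmod (w - v) < d v" by (simp add: dist_norm norm_minus_commute)
    from loc[OF x this] have "hnorm H (R w x) \<le> 2 * K v * hnorm H x" .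
    also have "2 * K v \<le> M" unfolding M_def
      by (rule member_le_sum[of v F "\<lambda>v. 2 * K v"]) (use v F K0 in auto)
    finally show ?thesis using x by (simp add: mult_right_mono)
  qed
  have "r ^ n * hnorm H ((T ^^ n) x) \<le> M * hnorm H x" if x: "x \<in> carrier H" for n x
  proof (cases "(T ^^ n) x = \<zero>")
    case True
    then show ?thesis using M0 x by simp
  next
    case False
    define y where "y = (T ^^ n) x"
    have y: "y \<in> carrier H" using Tn[OF x] by (simp add: y_def)
    have y0: "hnorm H y > 0" using False y hnorm_nonneg[OF y] hnorm_eq_0_iff[OF y] unfolding y_def by linarith
    have "norm ((deriv ^^ n) (\<lambda>w. cinner H (R w x) y) 0) \<le> fact n * (M * hnorm H x * hnorm H y) / r ^ n"
    proof (rule Cauchy_inequality)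
      show "(\<lambda>w. cinner H (R w x) y) holomorphic_on ball 0 r"
        using holo[OF x y] by (rule holomorphic_on_subset) simp
      show "continuous_on (cball 0 r) (\<lambda>w. cinner H (R w x) y)"
        using holomorphic_on_imp_continuous_on[OF holo[OF x y]] by (rule continuous_on_subset) simp
      fix w :: complex assume "cmod (0 - w) = r"
      then have "cmod w \<le> r" by simp
      from M[OF x this] have "hnorm H (R w x) * hnorm H y \<le> M * hnorm H x * hnorm H y"
        using y by (intro mult_right_mono) auto
      then show "cmod (cinner H (R w x) y) \<le> M * hnorm H x * hnorm H y"
        using Cauchy_Schwarz[OF op_closed[OF R x] y, of w] by linarith
    qed (rule r)
    then have "fact n * cmod (cinner H y y) \<le> fact n * (M * hnorm H x * hnorm H y) / r ^ n"
      unfolding hd[OF x y] y_def[symmetric] by (simp add: norm_mult)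
    then have "cmod (cinner H y y) * r ^ n \<le> M * hnorm H x * hnorm H y"
      using r by (simp add: field_simps)
    moreover have "cmod (cinner H y y) = hnorm H y * hnorm H y"
      using cinner_self[OF y] by (simp add: power2_eq_square norm_mult)
    ultimately have "(r ^ n * hnorm H y) * hnorm H y \<le> (M * hnorm H x) * hnorm H y"
      by (simp add: algebra_simps)
    then show ?thesis using y0 unfolding y_def by simp
  qed
  then show ?thesis using M0 by blast
qed

text \<open>Quasinilpotence requires \<open>0\<close> to lie in the spectrum, so this must be
  derived. An inverse gives \<open>|x| \<le> c^n |T^n x|\<close>, whereas the power bound at radius
  \<open>2 c\<close> gives \<open>|T^n x| \<le> M (2 c)^-n |x|\<close>; together
  \<open>|x| \<le> M 2^-n |x|\<close> for all \<open>n\<close>.\<close>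

lemma spectrum_zero_not_invertible:
  assumes T: "T \<in> bounded_operators H"
    and inv: "\<And>c. c \<noteq> 0 \<Longrightarrow> invertible_op H (poly_op H T [:-c, 1:])"
    and ne: "x \<in> carrier H" "x \<noteq> \<zero>"
  shows "\<not> invertible_op H T"
proof
  assume "invertible_op H T"
  from invertible_bounded_below[OF this T] obtain c
    where c: "c > 0" "\<forall>x\<in>carrier H. hnorm H x \<le> c * hnorm H (T x)" by blast
  obtain M where M: "\<forall>n. \<forall>x\<in>carrier H. (2 * c) ^ n * hnorm H ((T ^^ n) x) \<le> M * hnorm H x"
    using resolvent_power_bound[OF T inv, of "2 * c"] c(1) by auto
  have le: "hnorm H x \<le> c ^ n * hnorm H ((T ^^ n) x)" for n
  proof (induction n)
    case (Suc n)
    have "c ^ n * hnorm H ((T ^^ n) x) \<le> c ^ n * (c * hnorm H (T ((T ^^ n) x)))"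
      using c funpow_closed[OF T ne(1), of n] by (intro mult_left_mono) auto
    then show ?case using Suc by (simp add: algebra_simps)
  qed simp
  have "hnorm H x \<le> (M * hnorm H x) * (1 / 2) ^ n" for n
  proof -
    have "2 ^ n * hnorm H x \<le> 2 ^ n * (c ^ n * hnorm H ((T ^^ n) x))"
      using le[of n] by (intro mult_left_mono) auto
    also have "\<dots> \<le> M * hnorm H x"
      using M ne by (simp add: power_mult_distrib mult.assoc)
    finally show ?thesis by (simp add: field_simps power_divide)
  qed
  then have "x = \<zero>" using ne(1) by (intro hnorm_le_geometric_imp_zero[where a = "1 / 2"]) auto
  then show False using ne by simp
qed

end

section \<open>The spectral idempotent\<close>

text \<open>Newton's iteration \<open>e \<mapsto> 3 e\<^sup>2 - 2 e\<^sup>3\<close> for idempotents squares the defect \<open>e - e\<^sup>2\<close> up to a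
  bounded factor. It fixes \<open>0\<close> and \<open>1\<close>, so that the limit at \<open>T\<close> separates these two spectral values.\<close>
primrec newton :: "nat \<Rightarrow> complex poly" where
  "newton 0 = [:0, 1:]"
| "newton (Suc k) = newton k ^ 2 * (3 - 2 * newton k)"

text \<open>With \<open>d = e - e^2\<close> the new defect is \<open>d^2 (3 + 4 d)\<close>. The
  grouping allows the bound for \<open>d\<close> to be applied one factor at a time.\<close>

lemma newton_defect:
  "newton (Suc k) - newton (Suc k) ^ 2
     = (newton k - newton k ^ 2) * ((newton k - newton k ^ 2) * (3 + 4 * (newton k - newton k ^ 2)))"
  by (simp add: algebra_simps power2_eq_square)

text \<open>\<open>2 e - 1\<close> is the reflection attached to an idempotent \<open>e\<close>. The
  product of the factors \<open>1 + 2 d\<close> stays bounded, which controls the increments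
  \<open>d (2 e - 1)\<close> of the iteration.\<close>

lemma newton_reflection_Suc:
  "2 * newton (Suc k) - 1 = (1 + 2 * (newton k - newton k ^ 2)) * (2 * newton k - 1)"
  by (simp add: algebra_simps power2_eq_square)

lemma newton_step: "newton (Suc k) - newton k = (newton k - newton k ^ 2) * (2 * newton k - 1)"
  by (simp add: algebra_simps power2_eq_square)

text \<open>Each iterate vanishes at \<open>0\<close> and, by the next lemma, equals
  \<open>1\<close> at \<open>1\<close>. Hence \<open>T\<close> is a factor of
  \<open>newton k\<close> at \<open>T\<close>, and \<open>1 - T\<close> is a factor of its
  complement; either becomes invertible with the product.\<close>

lemma newton_dvd: "[:0, 1:] dvd newton k"
  by (induction k) (auto simp: power2_eq_square)

lemma one_minus_newton_dvd: "[:1, -1:] dvd 1 - newton k"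
proof (induction k)
  case 0
  have "1 - newton 0 = [:1, -1:]" by (simp add: one_pCons)
  then show ?case by (metis dvd_refl)
next
  case (Suc k)
  have "1 - newton (Suc k) = (1 - newton k) * ((1 - newton k) * (1 + 2 * newton k))"
    by (simp add: algebra_simps power2_eq_square)
  then show ?case using Suc by (metis dvd_mult2)
qed

context complex_inner_space
begin

declare op_closed [simp del, rule del] \<comment> \<open>its conclusion has a variable head and would match every membership goal\<close>

lemma poly_op_X:
  assumes T: "T \<in> bounded_operators H" and x: "x \<in> carrier H"
  shows "poly_op H T [:0, 1:] x = T x"
  using x op_closed[OF T] by (intro vec_eqI) (auto simp: poly_op_pCons[OF T] op_linear[OF T])

end

context separable_hilbert_space
begin

text \<open>The Neumann series in \<open>1 - G\<close>. Its partial sums are polynomials in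
  \<open>G\<close>, so they commute with \<open>G\<close>, and telescoping is the polynomial
  identity \<open>X s = 1 - (1 - X)^k\<close>.\<close>

lemma invertible_near_identity:
  assumes G: "G \<in> bounded_operators H"
    and near: "\<And>x. x \<in> carrier H \<Longrightarrow> hnorm H (G x \<ominus> x) \<le> 1 / 2 * hnorm H x"
  shows "invertible_op H G"
proof -
  \<comment> \<open>\<open>[:1, -1:]\<close> is \<open>1 - X\<close>, so \<open>s k\<close> is the
    sum of its powers below \<open>k\<close>, written recursively.\<close>
  define s :: "nat \<Rightarrow> complex poly" where "s = rec_nat 0 (\<lambda>_ s. 1 + [:1, -1:] * s)"
  have s_Suc: "s (Suc k) = 1 + [:1, -1:] * s k" and s_0: "s 0 = 0" for k by (simp_all add: s_def)
  have s_diff: "s (Suc k) - s k = [:1, -1:] ^ k" for k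
  proof (induction k)
    case 0
    show ?case by (simp add: s_def)
  next
    case (Suc k)
    have "s (Suc (Suc k)) - s (Suc k) = [:1, -1:] * (s (Suc k) - s k)"
      by (subst (1 2) s_Suc) (simp only: right_diff_distrib add_diff_cancel_left)
    then show ?case using Suc by simp
  qed
  have X: "([:0, 1:] :: complex poly) = 1 - [:1, -1:]" by (simp add: one_pCons)
  have s_mult: "[:0, 1:] * s k = 1 - [:1, -1:] ^ k" for k
  proof -
    have "[:0, 1:] * s k = s k - [:1, -1:] * s k" unfolding X by (simp only: left_diff_distrib mult_1)
    also have "\<dots> = 1 - (s (Suc k) - s k)" by (subst s_Suc) (simp only: diff_diff_eq2 diff_add_eq algebra_simps)
    finally show ?thesis by (simp only: s_diff)
  qed
  note cl = poly_op_closed[OF G] op_closed[OF G]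
  have N: "poly_op H G [:1, -1:] x = x \<ominus> G x" if "x \<in> carrier H" for x
    using that cl by (intro vec_eqI) (auto simp: poly_op_pCons[OF G] op_linear[OF G])
  have Nk: "hnorm H (poly_op H G ([:1, -1:] ^ k) x) \<le> (1 / 2) ^ k * hnorm H x" if x: "x \<in> carrier H" for k x
  proof (induction k)
    case 0
    then show ?case using x by (simp add: poly_op_1[OF G])
  next
    case (Suc k)
    have "hnorm H (poly_op H G ([:1, -1:] ^ Suc k) x) = hnorm H (G (poly_op H G ([:1, -1:] ^ k) x) \<ominus> poly_op H G ([:1, -1:] ^ k) x)"
      using x cl N[of "poly_op H G ([:1, -1:] ^ k) x"] hnorm_minus_commute
      by (simp only: power_Suc poly_op_mult[OF G])
    also have "\<dots> \<le> 1 / 2 * hnorm H (poly_op H G ([:1, -1:] ^ k) x)"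
      by (rule near) (rule poly_op_closed[OF G x])
    finally show ?case using Suc by simp
  qed
  have "\<exists>P\<in>bounded_operators H. \<exists>C\<ge>0. \<forall>k. \<forall>x\<in>carrier H.
      hnorm H (poly_op H G (s k) x \<ominus> P x) \<le> C * (1 / 2) ^ k * hnorm H x"
  proof (rule geometric_operator_limit[where c = 1])
    fix k x assume x: "x \<in> carrier H"
    have "poly_op H G (s (Suc k)) x \<ominus> poly_op H G (s k) x = poly_op H G ([:1, -1:] ^ k) x"
      using poly_op_diff[OF G x, of "s (Suc k)" "s k"] by (simp only: s_diff)
    then show "hnorm H (poly_op H G (s (Suc k)) x \<ominus> poly_op H G (s k) x) \<le> 1 * (1 / 2) ^ k * hnorm H x"
      using Nk[OF x, of k] by simp
  qed (auto intro: poly_op_bounded[OF G])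
  then obtain P C where P: "P \<in> bounded_operators H" and C: "C \<ge> 0"
    and lim: "\<And>k x. x \<in> carrier H \<Longrightarrow> hnorm H (poly_op H G (s k) x \<ominus> P x) \<le> C * (1 / 2) ^ k * hnorm H x"
    by metis
  obtain L where L: "L \<ge> 0" "\<And>x. x \<in> carrier H \<Longrightarrow> hnorm H (G x) \<le> L * hnorm H x"
    using op_bound[OF G] by metis
  note clP = op_closed[OF P]
  have Gs: "G (poly_op H G (s k) x) = x \<ominus> poly_op H G ([:1, -1:] ^ k) x" if x: "x \<in> carrier H" for k x
  proof -
    have "poly_op H G ([:0, 1:] * s k) x = G (poly_op H G (s k) x)"
      using x by (simp only: poly_op_mult[OF G] poly_op_X[OF G] poly_op_closed[OF G])
    then show ?thesis using x unfolding s_mult by (simp add: poly_op_diff[OF G] poly_op_1[OF G])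
  qed
  have GP: "G (P x) = x" if x: "x \<in> carrier H" for x
  proof -
    have "hnorm H (G (P x) \<ominus> x) \<le> ((L * C + 1) * hnorm H x) * (1 / 2) ^ k" for k
    proof -
      let ?y = "poly_op H G (s k) x" and ?z = "poly_op H G ([:1, -1:] ^ k) x"
      have "G (P x) \<ominus> x = (-1) \<odot> (G (?y \<ominus> P x) \<oplus> ?z)"
        using x cl clP by (intro vec_eqI) (auto simp: op_linear[OF G] Gs[OF x])
      then have "hnorm H (G (P x) \<ominus> x) = hnorm H (G (?y \<ominus> P x) \<oplus> ?z)"
        using x cl clP by simp
      also have "\<dots> \<le> hnorm H (G (?y \<ominus> P x)) + hnorm H ?z"
        using x cl clP by (intro hnorm_triangle) auto
      also have "\<dots> \<le> L * (C * (1 / 2) ^ k * hnorm H x) + (1 / 2) ^ k * hnorm H x"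
      proof (intro add_mono Nk x)
        have "hnorm H (G (?y \<ominus> P x)) \<le> L * hnorm H (?y \<ominus> P x)" using x cl clP by (intro L) auto
        also have "\<dots> \<le> L * (C * (1 / 2) ^ k * hnorm H x)" using L(1) lim[OF x] by (intro mult_left_mono)
        finally show "hnorm H (G (?y \<ominus> P x)) \<le> L * (C * (1 / 2) ^ k * hnorm H x)" .
      qed
      finally show ?thesis by (simp add: algebra_simps)
    qed
    then have "G (P x) \<ominus> x = \<zero>"
      using x cl clP by (intro hnorm_le_geometric_imp_zero[where a = "1 / 2"]) auto
    then show ?thesis using x cl clP by simp
  qed
  have PG: "P (G x) = x" if x: "x \<in> carrier H" for x
  proof -
    have "hnorm H (P (G x) \<ominus> x) \<le> (C * hnorm H (G x) + hnorm H x) * (1 / 2) ^ k" for k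
    proof -
      let ?y = "poly_op H G (s k) (G x)" and ?z = "poly_op H G ([:1, -1:] ^ k) x"
      have "?y = x \<ominus> ?z"
        using poly_op_commute[OF G G _ x, of "s k"] Gs[OF x, of k] by simp
      then have "P (G x) \<ominus> x = (-1) \<odot> ((?y \<ominus> P (G x)) \<oplus> ?z)"
        using x cl clP by (intro vec_eqI) auto
      then have "hnorm H (P (G x) \<ominus> x) = hnorm H ((?y \<ominus> P (G x)) \<oplus> ?z)"
        using x cl clP by simp
      also have "\<dots> \<le> hnorm H (?y \<ominus> P (G x)) + hnorm H ?z"
        using x cl clP by (intro hnorm_triangle) auto
      also have "\<dots> \<le> C * (1 / 2) ^ k * hnorm H (G x) + (1 / 2) ^ k * hnorm H x"
        by (intro add_mono lim Nk x cl)
      finally show ?thesis by (simp add: algebra_simps)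
    qed
    then have "P (G x) \<ominus> x = \<zero>"
      using x cl clP by (intro hnorm_le_geometric_imp_zero[where a = "1 / 2"]) auto
    then show ?thesis using x cl clP by simp
  qed
  show ?thesis unfolding invertible_op_def
    by (rule bexI[OF _ P]) (use GP PG in simp)
qed

text \<open>The constant: \<open>d \<le> 1 / 16\<close> gives
  \<open>d^2 (3 + 4 d) \<le> 4 d^2 \<le> d / 4\<close>, so the defects, measured in the equivalent
  norm \<open>\<nu>\<close>, decay at least like powers of \<open>1 / 4\<close>. The last two
  conclusions say that a trivial \<open>P\<close> removes \<open>0\<close> or \<open>1\<close> from
  the spectrum; this is what later shows \<open>P\<close> to be non-trivial.\<close>

lemma newton_idempotent:
  assumes T: "T \<in> bounded_operators H"
    and tri: "\<And>x y. x \<in> carrier H \<Longrightarrow> y \<in> carrier H \<Longrightarrow> \<nu> (x \<oplus> y) \<le> \<nu> x + \<nu> y"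
    and hom: "\<And>a x. x \<in> carrier H \<Longrightarrow> \<nu> (a \<odot> x) = cmod a * \<nu> x"
    and lower: "\<And>x. x \<in> carrier H \<Longrightarrow> hnorm H x \<le> \<nu> x"
    and upper: "\<And>x. x \<in> carrier H \<Longrightarrow> \<nu> x \<le> M * hnorm H x"
    and K: "K \<ge> 0" "\<And>x. x \<in> carrier H \<Longrightarrow> \<nu> (T x) \<le> K * \<nu> x"
    and small: "\<And>x. x \<in> carrier H \<Longrightarrow> \<nu> (poly_op H T ([:0, 1:] - [:0, 1:] ^ 2) x) \<le> 1 / 16 * \<nu> x"
  shows "\<exists>P\<in>bounded_operators H. (\<forall>x\<in>carrier H. P (P x) = P x) \<and> (\<forall>x\<in>carrier H. P (T x) = T (P x)) \<and>
     ((\<forall>x\<in>carrier H. P x = x) \<longrightarrow> invertible_op H T) \<and>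
     ((\<forall>x\<in>carrier H. P x = \<zero>) \<longrightarrow> invertible_op H (poly_op H T [:1, -1:]))"
proof -
  note cl = poly_op_closed[OF T] op_closed[OF T]
  note X = poly_op_X[OF T]
  note padd = poly_op_add[OF T] and pmul = poly_op_mult[OF T]
  define q where "q k = newton k - newton k ^ 2" for k
  define \<delta> where "\<delta> k = 1 / 16 * (1 / 4 :: real) ^ k" for k
  have \<delta>: "0 \<le> \<delta> k" "\<delta> k \<le> 1 / 16" for k
    unfolding \<delta>_def by (simp_all add: power_le_one)
  have nu0: "0 \<le> \<nu> x" if "x \<in> carrier H" for x using lower[OF that] hnorm_nonneg[OF that] by linarith
  have num: "poly_op H T (numeral n * p) x = numeral n \<odot> poly_op H T p x" if "x \<in> carrier H" for n p x
  proof -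
    have "numeral n * p = Polynomial.smult (numeral n) p" by (simp add: numeral_poly)
    then show ?thesis using poly_op_smult[OF T that] by simp
  qed
  have num1: "poly_op H T (numeral n) x = numeral n \<odot> x" if "x \<in> carrier H" for n x
    using num[OF that, of n 1] that by (simp add: poly_op_1[OF T])
  have qk: "\<nu> (poly_op H T (q k) x) \<le> \<delta> k * \<nu> x" if "x \<in> carrier H" for k x
    using that
  proof (induction k arbitrary: x)
    case 0
    then show ?case using small by (simp add: q_def \<delta>_def)
  next
    case (Suc k)
    let ?y = "poly_op H T (3 + 4 * q k) x"
    have y: "?y \<in> carrier H" using cl Suc by simp
    have ynu: "\<nu> ?y \<le> 4 * \<nu> x"
    proof -
      have "\<nu> ?y \<le> 3 * \<nu> x + 4 * \<nu> (poly_op H T (q k) x)"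
        using tri[of "3 \<odot> x" "4 \<odot> poly_op H T (q k) x"] Suc.prems cl by (simp add: padd num num1 hom)
      also have "\<dots> \<le> 3 * \<nu> x + 4 * (1 / 16 * \<nu> x)"
        using Suc.IH[OF Suc.prems] mult_right_mono[OF \<delta>(2) nu0[OF Suc.prems], of k] by linarith
      also have "\<dots> \<le> 4 * \<nu> x" using nu0[OF Suc.prems] by simp
      finally show ?thesis .
    qed
    have "q (Suc k) = q k * (q k * (3 + 4 * q k))"
      unfolding q_def by (rule newton_defect)
    then have "\<nu> (poly_op H T (q (Suc k)) x) = \<nu> (poly_op H T (q k) (poly_op H T (q k) ?y))"
      using Suc.prems cl by (simp add: pmul)
    also have "\<dots> \<le> \<delta> k * (\<delta> k * (4 * \<nu> x))"
      using Suc.IH[OF y] Suc.IH[OF poly_op_closed[OF T y, of "q k"]] ynu \<delta>(1)[of k]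
      by (meson mult_left_mono order_trans)
    also have "\<dots> = \<delta> k * (4 * \<delta> k) * \<nu> x" by simp
    also have "\<dots> \<le> \<delta> k * (1 / 4) * \<nu> x"
      using \<delta>(1)[of k] \<delta>(2)[of k] nu0[OF Suc.prems] by (intro mult_right_mono mult_left_mono) auto
    also have "\<delta> k * (1 / 4) = \<delta> (Suc k)" by (simp add: \<delta>_def)
    finally show ?case .
  qed
  define B where "B = 1 + 2 * K"
  have B: "B \<ge> 1" using K by (simp add: B_def)
  \<comment> \<open>The factor \<open>2 - (1 / 4) ^ k\<close> is \<open>1\<close> at the start and
    stays below \<open>2\<close>. It absorbs the factors \<open>1 + 2 * \<delta> k\<close> because
    \<open>(1 + a / 8) * (2 - a) \<le> 2 - a / 4\<close> for \<open>a \<ge> 0\<close>.\<close>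
  have uk: "\<nu> (poly_op H T (2 * newton k - 1) x) \<le> B * (2 - (1 / 4) ^ k) * \<nu> x" if "x \<in> carrier H" for k x
    using that
  proof (induction k arbitrary: x)
    case 0
    have "poly_op H T (2 * newton 0 - 1) x = 2 \<odot> T x \<ominus> x"
      using 0 by (simp only: poly_op_diff[OF T] num poly_op_1[OF T] newton.simps X)
    also have "\<dots> = 2 \<odot> T x \<oplus> (-1) \<odot> x"
      using 0 cl by (intro vec_eqI) auto
    finally have "\<nu> (poly_op H T (2 * newton 0 - 1) x) \<le> 2 * \<nu> (T x) + \<nu> x"
      using tri[of "2 \<odot> T x" "(-1) \<odot> x"] 0 cl by (simp add: hom)
    then show ?case using K(2)[OF 0] nu0[OF 0] by (simp add: B_def algebra_simps)
  next
    case (Suc k)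
    let ?y = "poly_op H T (2 * newton k - 1) x" and ?a = "(1 / 4 :: real) ^ k"
    have y: "?y \<in> carrier H" using cl Suc.prems by simp
    have a: "0 \<le> ?a" "?a \<le> 1" by (simp_all add: power_le_one)
    have "poly_op H T (2 * newton (Suc k) - 1) x = ?y \<oplus> 2 \<odot> poly_op H T (q k) ?y"
      unfolding newton_reflection_Suc q_def[symmetric] pmul[OF Suc.prems] using y
      by (simp only: padd num poly_op_1[OF T])
    then have "\<nu> (poly_op H T (2 * newton (Suc k) - 1) x) \<le> \<nu> ?y + 2 * \<nu> (poly_op H T (q k) ?y)"
      using tri[of ?y "2 \<odot> poly_op H T (q k) ?y"] cl y by (simp add: hom)
    also have "\<dots> \<le> (1 + 2 * \<delta> k) * \<nu> ?y" using qk[OF y, of k] by (simp add: algebra_simps)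
    also have "\<dots> \<le> (1 + 2 * \<delta> k) * (B * (2 - ?a) * \<nu> x)"
      using Suc.IH[OF Suc.prems] \<delta>(1)[of k] by (intro mult_left_mono) auto
    also have "\<dots> = (1 + ?a / 8) * (2 - ?a) * (B * \<nu> x)" by (simp add: \<delta>_def)
    also have "\<dots> \<le> (2 - ?a / 4) * (B * \<nu> x)"
    proof (rule mult_right_mono)
      show "(1 + ?a / 8) * (2 - ?a) \<le> 2 - ?a / 4" using a by (simp add: field_simps)
    qed (use B nu0[OF Suc.prems] in auto)
    finally show ?case by (simp add: algebra_simps)
  qed
  \<comment> \<open>The increment is the defect applied to the reflection. The two norms are
    exchanged once at each end, with \<open>\<bar>M\<bar>\<close> as \<open>M\<close> comes without
    a sign.\<close>
  have step: "hnorm H (poly_op H T (newton (Suc k)) x \<ominus> poly_op H T (newton k) x) \<le> (B * \<bar>M\<bar> / 8) * (1 / 4) ^ k * hnorm H x"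
    if x: "x \<in> carrier H" for k x
  proof -
    let ?y = "poly_op H T (2 * newton k - 1) x"
    have y: "?y \<in> carrier H" using cl x by simp
    have "poly_op H T (newton (Suc k)) x \<ominus> poly_op H T (newton k) x = poly_op H T (newton (Suc k) - newton k) x"
      using x by (simp only: poly_op_diff[OF T])
    also have "\<dots> = poly_op H T (q k) ?y"
      unfolding newton_step q_def[symmetric] by (rule pmul[OF x])
    finally have "hnorm H (poly_op H T (newton (Suc k)) x \<ominus> poly_op H T (newton k) x) \<le> \<nu> (poly_op H T (q k) ?y)"
      using lower cl y by simp
    also have "\<dots> \<le> \<delta> k * \<nu> ?y" by (rule qk[OF y])
    also have "\<dots> \<le> \<delta> k * (B * (2 - (1 / 4) ^ k) * \<nu> x)" using uk[OF x, of k] \<delta>(1) by (intro mult_left_mono)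
    also have "\<dots> \<le> \<delta> k * (B * 2 * (\<bar>M\<bar> * hnorm H x))"
    proof (intro mult_left_mono mult_mono)
      show "\<nu> x \<le> \<bar>M\<bar> * hnorm H x"
        using upper[OF x] mult_right_mono[OF abs_ge_self[of M] hnorm_nonneg[OF x]] by linarith
    qed (use B \<delta>(1) nu0[OF x] in \<open>auto simp: power_le_one\<close>)
    finally show ?thesis by (simp add: \<delta>_def algebra_simps)
  qed
  have "\<exists>P\<in>bounded_operators H. \<exists>C\<ge>0. \<forall>k. \<forall>x\<in>carrier H.
      hnorm H (poly_op H T (newton k) x \<ominus> P x) \<le> C * (1 / 4) ^ k * hnorm H x"
    by (rule geometric_operator_limit[where c = "B * \<bar>M\<bar> / 8"])
      (use step B poly_op_bounded[OF T] in auto)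
  then obtain P C where P: "P \<in> bounded_operators H" and C: "C \<ge> 0"
    and lim: "\<And>k x. x \<in> carrier H \<Longrightarrow> hnorm H (poly_op H T (newton k) x \<ominus> P x) \<le> C * (1 / 4) ^ k * hnorm H x"
    by metis
  note clP = op_closed[OF P]
  obtain KP where KP: "KP \<ge> 0" "\<And>x. x \<in> carrier H \<Longrightarrow> hnorm H (P x) \<le> KP * hnorm H x"
    using op_bound[OF P] by metis
  obtain L where L: "L \<ge> 0" "\<And>x. x \<in> carrier H \<Longrightarrow> hnorm H (T x) \<le> L * hnorm H x"
    using op_bound[OF T] by metis
  have idem: "P (P x) = P x" if x: "x \<in> carrier H" for x
  proof -
    \<comment> \<open>With \<open>e\<close> the iterate at \<open>T\<close>, the difference splits
      into errors \<open>e - P\<close> and the defect \<open>e - e^2\<close>, all of order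
      \<open>(1 / 4) ^ k\<close>.\<close>
    have "hnorm H (P (P x) \<ominus> P x) \<le> (KP * C + C * (KP + C) + \<bar>M\<bar> / 16 + C) * hnorm H x * (1 / 4) ^ k" for k
    proof -
      define e where "e = poly_op H T (newton k)"
      define a where "a = (1 / 4 :: real) ^ k"
      have a: "0 \<le> a" "a \<le> 1" by (simp_all add: a_def power_le_one)
      have ec: "e y \<in> carrier H" if "y \<in> carrier H" for y using cl that by (simp add: e_def)
      have l: "hnorm H (e y \<ominus> P y) \<le> C * a * hnorm H y" if "y \<in> carrier H" for y
        using lim[OF that, of k] by (simp add: e_def a_def)
      have ex: "hnorm H (e x) \<le> (KP + C) * hnorm H x"
      proof -
        have "e x = P x \<oplus> (e x \<ominus> P x)" using x ec clP by (intro vec_eqI) auto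
        then have "hnorm H (e x) \<le> hnorm H (P x) + hnorm H (e x \<ominus> P x)"
          using hnorm_triangle[of "P x" "e x \<ominus> P x"] x ec clP by simp
        also have "\<dots> \<le> KP * hnorm H x + C * 1 * hnorm H x"
          using KP(2)[OF x] l[OF x] a C x by (intro add_mono order_trans[OF l[OF x]] mult_right_mono mult_left_mono) auto
        finally show ?thesis by (simp add: algebra_simps)
      qed
      have "e x \<ominus> e (e x) = poly_op H T (q k) x"
        unfolding q_def e_def using x by (simp add: poly_op_diff[OF T] pmul power2_eq_square)
      then have "hnorm H (e x \<ominus> e (e x)) \<le> \<delta> k * \<nu> x"
        using lower[OF poly_op_closed[OF T x, of "q k"]] qk[OF x, of k] by simp
      also have "\<dots> \<le> \<delta> k * (\<bar>M\<bar> * hnorm H x)"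
        using upper[OF x] mult_right_mono[OF abs_ge_self[of M] hnorm_nonneg[OF x]] \<delta>(1)
        by (intro mult_left_mono) auto
      finally have qb: "hnorm H (e x \<ominus> e (e x)) \<le> \<bar>M\<bar> / 16 * a * hnorm H x"
        by (simp add: \<delta>_def a_def mult.commute mult.left_commute)
      have "P (P x) \<ominus> P x = (e x \<ominus> P x) \<ominus> (P (e x \<ominus> P x) \<oplus> ((e (e x) \<ominus> P (e x)) \<oplus> (e x \<ominus> e (e x))))"
        using x ec clP by (intro vec_eqI) (auto simp: op_linear[OF P])
      also have "hnorm H \<dots> \<le> hnorm H (e x \<ominus> P x) + (hnorm H (P (e x \<ominus> P x)) +
          (hnorm H (e (e x) \<ominus> P (e x)) + hnorm H (e x \<ominus> e (e x))))"
        using x ec clP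
        by (intro order_trans[OF hnorm_triangle_minus] order_trans[OF hnorm_triangle] add_left_mono order_refl) auto
      also have "\<dots> \<le> C * a * hnorm H x + (KP * (C * a * hnorm H x) +
          (C * a * ((KP + C) * hnorm H x) + \<bar>M\<bar> / 16 * a * hnorm H x))"
      proof (intro add_mono qb l x)
        have "hnorm H (P (e x \<ominus> P x)) \<le> KP * hnorm H (e x \<ominus> P x)" using x ec clP by (intro KP) auto
        also have "\<dots> \<le> KP * (C * a * hnorm H x)" using KP l[OF x] by (intro mult_left_mono)
        finally show "hnorm H (P (e x \<ominus> P x)) \<le> KP * (C * a * hnorm H x)" .
        have "hnorm H (e (e x) \<ominus> P (e x)) \<le> C * a * hnorm H (e x)" by (rule l[OF ec[OF x]])
        also have "\<dots> \<le> C * a * ((KP + C) * hnorm H x)" using C a ex by (intro mult_left_mono) auto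
        finally show "hnorm H (e (e x) \<ominus> P (e x)) \<le> C * a * ((KP + C) * hnorm H x)" .
      qed
      finally show ?thesis by (simp add: algebra_simps a_def)
    qed
    then have "P (P x) \<ominus> P x = \<zero>"
      using x clP by (intro hnorm_le_geometric_imp_zero[where a = "1 / 4"]) auto
    then show ?thesis using x clP by simp
  qed
  have comm: "P (T x) = T (P x)" if x: "x \<in> carrier H" for x
  proof -
    have "hnorm H (P (T x) \<ominus> T (P x)) \<le> (C * hnorm H (T x) + L * (C * hnorm H x)) * (1 / 4) ^ k" for k
    proof -
      define e where "e = poly_op H T (newton k)"
      have ec: "e y \<in> carrier H" if "y \<in> carrier H" for y using cl that by (simp add: e_def)
      have eT: "e (T x) = T (e x)" unfolding e_def using poly_op_commute[OF T T _ x] by simp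
      have "P (T x) \<ominus> T (P x) = T (e x \<ominus> P x) \<ominus> (e (T x) \<ominus> P (T x))"
        using x ec clP cl by (intro vec_eqI) (auto simp: op_linear[OF T] eT)
      also have "hnorm H \<dots> \<le> hnorm H (T (e x \<ominus> P x)) + hnorm H (e (T x) \<ominus> P (T x))"
        using x ec clP cl by (intro hnorm_triangle_minus) auto
      also have "\<dots> \<le> L * (C * (1 / 4) ^ k * hnorm H x) + C * (1 / 4) ^ k * hnorm H (T x)"
      proof (rule add_mono)
        have "hnorm H (T (e x \<ominus> P x)) \<le> L * hnorm H (e x \<ominus> P x)" using x ec clP by (intro L) auto
        also have "\<dots> \<le> L * (C * (1 / 4) ^ k * hnorm H x)"
          unfolding e_def using L lim[OF x] by (intro mult_left_mono)
        finally show "hnorm H (T (e x \<ominus> P x)) \<le> L * (C * (1 / 4) ^ k * hnorm H x)" .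
        show "hnorm H (e (T x) \<ominus> P (T x)) \<le> C * (1 / 4) ^ k * hnorm H (T x)"
          unfolding e_def by (rule lim) (use x cl in auto)
      qed
      finally show ?thesis by (simp add: algebra_simps)
    qed
    then have "P (T x) \<ominus> T (P x) = \<zero>"
      using x clP cl by (intro hnorm_le_geometric_imp_zero[where a = "1 / 4"]) auto
    then show ?thesis using x clP cl by simp
  qed
  have "(\<lambda>k. C * (1 / 4 :: real) ^ k) \<longlonglongrightarrow> C * 0"
    by (intro tendsto_mult tendsto_const LIMSEQ_power_zero) auto
  \<comment> \<open>From some \<open>k\<close> on, the iterate is within \<open>1 / 2\<close> of
    \<open>P\<close>, close enough for the Neumann series if \<open>P\<close> is \<open>1\<close> or
    \<open>0\<close>.\<close>
  then have "\<forall>\<^sub>F k in sequentially. C * (1 / 4 :: real) ^ k < 1 / 2"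
    by (intro order_tendstoD(2)[of _ 0]) auto
  then obtain k where "\<forall>j\<ge>k. C * (1 / 4 :: real) ^ j < 1 / 2"
    unfolding eventually_sequentially ..
  then have k: "C * (1 / 4 :: real) ^ k < 1 / 2" by blast
  have inv1: "invertible_op H T" if P1: "\<forall>x\<in>carrier H. P x = x"
  proof -
    obtain s where s: "newton k = [:0, 1:] * s" using newton_dvd[of k] unfolding dvd_def by blast
    have "invertible_op H (poly_op H T (newton k))"
    proof (rule invertible_near_identity[OF poly_op_bounded[OF T]])
      fix x assume x: "x \<in> carrier H"
      have "hnorm H (poly_op H T (newton k) x \<ominus> x) \<le> C * (1 / 4) ^ k * hnorm H x"
        using lim[OF x, of k] P1 x by simp
      also have "\<dots> \<le> 1 / 2 * hnorm H x" using k x by (intro mult_right_mono) auto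
      finally show "hnorm H (poly_op H T (newton k) x \<ominus> x) \<le> 1 / 2 * hnorm H x" .
    qed
    then have "invertible_op H (poly_op H T [:0, 1:])"
      unfolding s by (rule invertible_poly_op_factor[OF T])
    then show ?thesis using invertible_op_cong[OF poly_op_X[OF T]] by simp
  qed
  have inv2: "invertible_op H (poly_op H T [:1, -1:])" if P0: "\<forall>x\<in>carrier H. P x = \<zero>"
  proof -
    obtain s where s: "1 - newton k = [:1, -1:] * s" using one_minus_newton_dvd[of k] unfolding dvd_def by blast
    have "invertible_op H (poly_op H T (1 - newton k))"
    proof (rule invertible_near_identity[OF poly_op_bounded[OF T]])
      fix x assume x: "x \<in> carrier H"
      let ?e = "poly_op H T (newton k) x"
      have "poly_op H T (1 - newton k) x \<ominus> x = (-1) \<odot> (?e \<ominus> P x)"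
        using x cl P0 by (intro vec_eqI) (auto simp: poly_op_diff[OF T] poly_op_1[OF T])
      then have "hnorm H (poly_op H T (1 - newton k) x \<ominus> x) = hnorm H (?e \<ominus> P x)"
        using x cl clP by simp
      also have "\<dots> \<le> C * (1 / 4) ^ k * hnorm H x"
        by (rule lim[OF x])
      also have "\<dots> \<le> 1 / 2 * hnorm H x" using k x by (intro mult_right_mono) auto
      finally show "hnorm H (poly_op H T (1 - newton k) x \<ominus> x) \<le> 1 / 2 * hnorm H x" .
    qed
    then show ?thesis unfolding s by (rule invertible_poly_op_factor[OF T])
  qed
  show ?thesis by (rule bexI[OF _ P]) (use idem comm inv1 inv2 in auto)
qed

text \<open>The assumption makes the supremum \<open>\<nu>\<close> of the left-hand sides a norm equivalent to the original
  one, and in this norm the quasinilpotent operator \<open>T - T\<^sup>2\<close> is small.\<close>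
lemma spectral_idempotent:
  assumes T: "T \<in> bounded_operators H"
    and M: "\<And>n x. x \<in> carrier H \<Longrightarrow>
      16 ^ n * hnorm H ((poly_op H T ([:0, 1:] - [:0, 1:] ^ 2) ^^ n) x) \<le> M * hnorm H x"
  shows "\<exists>P\<in>bounded_operators H. (\<forall>x\<in>carrier H. P (P x) = P x) \<and> (\<forall>x\<in>carrier H. P (T x) = T (P x)) \<and>
     ((\<forall>x\<in>carrier H. P x = x) \<longrightarrow> invertible_op H T) \<and>
     ((\<forall>x\<in>carrier H. P x = \<zero>) \<longrightarrow> invertible_op H (poly_op H T [:1, -1:]))"
proof -
  define q where "q = poly_op H T ([:0, 1:] - [:0, 1:] ^ 2)"
  have q: "q \<in> bounded_operators H" unfolding q_def by (rule poly_op_bounded[OF T])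
  have qn: "(q ^^ n) x = poly_op H T (([:0, 1:] - [:0, 1:] ^ 2) ^ n) x" if "x \<in> carrier H" for n x
    unfolding q_def using poly_op_power[OF T that] by simp
  have qnc: "(q ^^ n) x \<in> carrier H" if "x \<in> carrier H" for n x
    by (rule funpow_closed[OF q that])
  \<comment> \<open>The term \<open>n = 0\<close> is the original norm, and replacing
    \<open>x\<close> by \<open>q x\<close> shifts the sequence by one place, which gains the factor
    \<open>1 / 16\<close>.\<close>
  define f where "f n x = 16 ^ n * hnorm H ((q ^^ n) x)" for n x
  have f: "f n x \<le> M * hnorm H x" if "x \<in> carrier H" for n x
    unfolding f_def q_def by (rule M[OF that])
  have bdd: "bdd_above (range (\<lambda>n. f n x))" if "x \<in> carrier H" for x
    using f[OF that] by (intro bdd_aboveI2)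
  define \<nu> where "\<nu> x = (SUP n. f n x)" for x
  have f_le: "f n x \<le> \<nu> x" if "x \<in> carrier H" for n x
    unfolding \<nu>_def by (rule cSUP_upper[OF _ bdd[OF that]]) simp
  have le: "\<nu> x \<le> b" if "\<And>n. f n x \<le> b" for x b
    unfolding \<nu>_def by (rule cSUP_least) (use that in auto)
  obtain L where L: "L \<ge> 0" "\<And>x. x \<in> carrier H \<Longrightarrow> hnorm H (T x) \<le> L * hnorm H x"
    using op_bound[OF T] by metis
  show ?thesis
  proof (rule newton_idempotent[OF T, where \<nu> = \<nu> and K = L])
    fix x y assume x: "x \<in> carrier H" and y: "y \<in> carrier H"
    show "\<nu> (x \<oplus> y) \<le> \<nu> x + \<nu> y"
    proof (rule le)
      fix n
      have "(q ^^ n) (x \<oplus> y) = (q ^^ n) x \<oplus> (q ^^ n) y"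
        using x y op_add[OF poly_op_bounded[OF T]] by (simp add: qn)
      then have "f n (x \<oplus> y) \<le> f n x + f n y"
        unfolding f_def using hnorm_triangle[OF qnc[OF x] qnc[OF y], of n n]
        by (simp flip: distrib_left)
      then show "f n (x \<oplus> y) \<le> \<nu> x + \<nu> y" using f_le[OF x, of n] f_le[OF y, of n] by linarith
    qed
  next
    \<comment> \<open>Only this inequality is direct; the reverse one results from applying it to
      \<open>inverse a\<close>.\<close>
    have *: "\<nu> (a \<odot> x) \<le> cmod a * \<nu> x" if x: "x \<in> carrier H" for a x
    proof (rule le)
      fix n
      have "(q ^^ n) (a \<odot> x) = a \<odot> (q ^^ n) x"
        using x op_smult[OF poly_op_bounded[OF T]] by (simp add: qn)
      then have "f n (a \<odot> x) = cmod a * f n x"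
        unfolding f_def using qnc[OF x] by simp
      then show "f n (a \<odot> x) \<le> cmod a * \<nu> x" using f_le[OF x, of n] by (simp add: mult_left_mono)
    qed
    fix a x assume x: "x \<in> carrier H"
    show "\<nu> (a \<odot> x) = cmod a * \<nu> x"
    proof (cases "a = 0")
      case True
      have "f n \<zero> = 0" for n using qn[of \<zero> n] op_zero[OF poly_op_bounded[OF T]] by (simp add: f_def)
      then show ?thesis using True x by (simp add: \<nu>_def)
    next
      case False
      have "x = inverse a \<odot> (a \<odot> x)" using x False by (intro vec_eqI) auto
      then have "\<nu> x \<le> cmod (inverse a) * \<nu> (a \<odot> x)" using *[of "a \<odot> x" "inverse a"] x by simp
      then have "cmod a * \<nu> x \<le> \<nu> (a \<odot> x)" using False by (simp add: norm_divide divide_inverse norm_inverse) (simp add: field_simps)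
      then show ?thesis using *[OF x, of a] by simp
    qed
  next
    fix x assume x: "x \<in> carrier H"
    show "hnorm H x \<le> \<nu> x" using f_le[OF x, of 0] by (simp add: f_def)
    show "\<nu> x \<le> M * hnorm H x" by (rule le) (rule f[OF x])
    show "\<nu> (poly_op H T ([:0, 1:] - [:0, 1:] ^ 2) x) \<le> 1 / 16 * \<nu> x"
    proof (rule le)
      fix n
      have "f n (q x) = 1 / 16 * f (Suc n) x" by (simp add: f_def funpow_swap1)
      then show "f n (poly_op H T ([:0, 1:] - [:0, 1:] ^ 2) x) \<le> 1 / 16 * \<nu> x"
        using f_le[OF x, of "Suc n"] by (simp add: q_def)
    qed
  next
    show "L \<ge> 0" by (rule L)
    fix x assume x: "x \<in> carrier H"
    show "\<nu> (T x) \<le> L * \<nu> x"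
    proof (rule le)
      fix n
      \<comment> \<open>\<open>T\<close> commutes with \<open>q\<close>, so it keeps its original
        bound \<open>L\<close> in the new norm.\<close>
      have "(q ^^ n) (T x) = T ((q ^^ n) x)"
        using poly_op_commute[OF T T _ x] x op_closed[OF T] by (simp add: qn)
      then have "f n (T x) \<le> 16 ^ n * (L * hnorm H ((q ^^ n) x))"
        unfolding f_def using L qnc[OF x] by (intro mult_left_mono) auto
      also have "\<dots> = L * f n x" by (simp add: f_def)
      also have "\<dots> \<le> L * \<nu> x" using L f_le[OF x] by (intro mult_left_mono) auto
      finally show "f n (T x) \<le> L * \<nu> x" .
    qed
  qed
qed

end

section \<open>Closed subspaces\<close>

context complex_inner_space
begin

lemma minus_eq_add_smult: "x \<in> carrier H \<Longrightarrow> y \<in> carrier H \<Longrightarrow> x \<ominus> y = x \<oplus> (-1) \<odot> y"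
  by (rule vec_eqI) auto

lemma closed_subspaceI:
  assumes "S \<subseteq> carrier H" "\<zero> \<in> S"
    and "\<And>x y. x \<in> S \<Longrightarrow> y \<in> S \<Longrightarrow> x \<oplus> y \<in> S"
    and "\<And>a x. x \<in> S \<Longrightarrow> a \<odot> x \<in> S"
    and "\<And>x. x \<in> carrier H \<Longrightarrow> (\<And>e. e > 0 \<Longrightarrow> \<exists>y\<in>S. hnorm H (x \<ominus> y) < e) \<Longrightarrow> x \<in> S"
  shows "closed_subspace H S"
proof -
  have "\<ominus> x = (-1) \<odot> x" if "x \<in> S" for x
    using that assms(1) by (intro vec_eqI) auto
  then have "submodule S complex_field H"
    using assms by (intro submoduleI) auto
  moreover have "closedin HM.mtopology S"
    unfolding closedin_iff using assms(1,5) by simp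
  ultimately show ?thesis unfolding closed_subspace_def ..
qed

context
  fixes S assumes S: "closed_subspace H S"
begin

lemma closed_subspace_submodule: "submodule S complex_field H"
  using S by (simp add: closed_subspace_def)

lemma closed_subspace_subset: "S \<subseteq> carrier H"
  using submoduleE(1)[OF closed_subspace_submodule] .

lemma closed_subspace_add: "x \<in> S \<Longrightarrow> y \<in> S \<Longrightarrow> x \<oplus> y \<in> S"
  by (rule submoduleE(5)[OF closed_subspace_submodule])

lemma closed_subspace_smult: "x \<in> S \<Longrightarrow> a \<odot> x \<in> S"
  using submoduleE(4)[OF closed_subspace_submodule] by simp

lemma closed_subspace_zero: "\<zero> \<in> S"
proof -
  obtain x where x: "x \<in> S" using submoduleE(2)[OF closed_subspace_submodule] by blast
  from closed_subspace_smult[OF this, of 0] x closed_subspace_subset show ?thesis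
    by (simp add: subsetD)
qed

lemma closed_subspace_diff:
  assumes "x \<in> S" "y \<in> S"
  shows "x \<ominus> y \<in> S"
proof -
  have "x \<ominus> y = x \<oplus> (-1) \<odot> y"
    by (rule minus_eq_add_smult) (use assms closed_subspace_subset in blast)+
  then show ?thesis using closed_subspace_add closed_subspace_smult assms by simp
qed

lemma closed_subspace_limit:
  "x \<in> carrier H \<Longrightarrow> (\<And>e. e > 0 \<Longrightarrow> \<exists>y\<in>S. hnorm H (x \<ominus> y) < e) \<Longrightarrow> x \<in> S"
  using S unfolding closed_subspace_def closedin_iff by simp

end

lemma closed_subspace_singleton_zero: "closed_subspace H {\<zero>}"
proof (rule closed_subspaceI)
  fix x assume x: "x \<in> carrier H" and *: "\<And>e. e > 0 \<Longrightarrow> \<exists>y\<in>{\<zero>}. hnorm H (x \<ominus> y) < e"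
  have "x \<ominus> \<zero> = x" using x by (intro vec_eqI) auto
  then have "hnorm H x < e" if "e > 0" for e using *[OF that] by simp
  then have "hnorm H x \<le> 0" by (meson linorder_not_le order_less_irrefl)
  then have "hnorm H x = 0" using hnorm_nonneg[OF x] by linarith
  then show "x \<in> {\<zero>}" using x by simp
qed (auto intro: vec_eqI)

lemma closed_subspace_preimage:
  assumes T: "T \<in> bounded_operators H" and M: "closed_subspace H M"
  shows "closed_subspace H {x \<in> carrier H. T x \<in> M}"
proof (rule closed_subspaceI)
  fix x assume x: "x \<in> carrier H"
    and *: "\<And>e. e > 0 \<Longrightarrow> \<exists>y\<in>{x \<in> carrier H. T x \<in> M}. hnorm H (x \<ominus> y) < e"
  obtain K where K: "K \<ge> 0" "\<And>x. x \<in> carrier H \<Longrightarrow> hnorm H (T x) \<le> K * hnorm H x"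
    using op_bound[OF T] by metis
  have "T x \<in> M"
  proof (rule closed_subspace_limit[OF M])
    show "T x \<in> carrier H" by (rule op_closed[OF T x])
    fix e :: real assume e: "e > 0"
    then have "e / (K + 1) > 0" using K by simp
    from *[OF this] obtain y where y: "y \<in> carrier H" "T y \<in> M" "hnorm H (x \<ominus> y) < e / (K + 1)" by blast
    have "hnorm H (T x \<ominus> T y) = hnorm H (T (x \<ominus> y))" using op_diff[OF T x y(1)] by simp
    also have "\<dots> \<le> K * hnorm H (x \<ominus> y)" using x y by (intro K) auto
    also have "\<dots> \<le> (K + 1) * hnorm H (x \<ominus> y)" using x y by (intro mult_right_mono) auto
    also have "\<dots> < (K + 1) * (e / (K + 1))" using y K by (intro mult_strict_left_mono) auto
    also have "\<dots> = e" using K by simp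
    finally show "\<exists>y\<in>M. hnorm H (T x \<ominus> y) < e" using y(2) by blast
  qed
  then show "x \<in> {x \<in> carrier H. T x \<in> M}" using x by simp
qed (auto simp: op_linear[OF T] closed_subspace_zero[OF M] closed_subspace_add[OF M] closed_subspace_smult[OF M])

lemma closed_subspace_Int:
  assumes "closed_subspace H M" "closed_subspace H N"
  shows "closed_subspace H (M \<inter> N)"
proof (rule closed_subspaceI)
  fix x assume x: "x \<in> carrier H" and *: "\<And>e. e > 0 \<Longrightarrow> \<exists>y\<in>M \<inter> N. hnorm H (x \<ominus> y) < e"
  show "x \<in> M \<inter> N"
    using closed_subspace_limit[OF assms(1) x] closed_subspace_limit[OF assms(2) x] * by (metis IntE IntI)
qed (use assms in \<open>auto simp: closed_subspace_zero closed_subspace_add closed_subspace_smult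
      dest: closed_subspace_subset[THEN subsetD]\<close>)

text \<open>The kernel of \<open>P - 1\<close>. For an idempotent this is the range, and ranges
  appear in this form throughout.\<close>

lemma closed_subspace_fixed_points:
  assumes P: "P \<in> bounded_operators H"
  shows "closed_subspace H {x \<in> carrier H. P x = x}"
proof -
  have "closed_subspace H {x \<in> carrier H. P x \<ominus> x \<in> {\<zero>}}"
    by (rule closed_subspace_preimage[OF bounded_diff[OF P bounded_id] closed_subspace_singleton_zero])
  moreover have "P x \<ominus> x \<in> {\<zero>} \<longleftrightarrow> P x = x" if "x \<in> carrier H" for x
    using minus_eq_zero_iff[OF op_closed[OF P that] that] by simp
  ultimately show ?thesis by (simp cong: conj_cong)
qed

text \<open>Lines are closed because they are the fixed points of this operator.\<close>

lemma orthogonal_projection_line: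
  assumes v: "v \<in> carrier H"
  shows "(\<lambda>x. (cinner H x v / cinner H v v) \<odot> v) \<in> bounded_operators H"
proof (rule bounded_operatorsI)
  fix x assume x: "x \<in> carrier H"
  then show "(cinner H x v / cinner H v v) \<odot> v \<in> carrier H" using v by simp
  have "hnorm H ((cinner H x v / cinner H v v) \<odot> v) = cmod (cinner H x v) * (hnorm H v / cmod (cinner H v v))"
    using v x by (simp add: norm_divide)
  also have "\<dots> \<le> (hnorm H x * hnorm H v) * (hnorm H v / cmod (cinner H v v))"
    using Cauchy_Schwarz[OF x v] v by (intro mult_right_mono) auto
  finally show "hnorm H ((cinner H x v / cinner H v v) \<odot> v) \<le> (hnorm H v * hnorm H v / cmod (cinner H v v)) * hnorm H x"
    by (simp add: algebra_simps)
qed (auto intro!: vec_eqI simp: v add_divide_distrib algebra_simps)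

lemma nontrivial_line:
  assumes dim: "dim_at_least_two H" and v: "v \<in> carrier H" "v \<noteq> \<zero>"
  shows "nontrivial_closed_subspace H {x \<in> carrier H. \<exists>a. x = a \<odot> v}"
proof -
  let ?P = "\<lambda>x. (cinner H x v / cinner H v v) \<odot> v"
  have vv: "cinner H v v \<noteq> 0" using cinner_pos[OF v] by auto
  have eq: "{x \<in> carrier H. ?P x = x} = {x \<in> carrier H. \<exists>a. x = a \<odot> v}"
  proof (rule Collect_cong, rule conj_cong[OF refl])
    fix x assume "x \<in> carrier H"
    show "?P x = x \<longleftrightarrow> (\<exists>a. x = a \<odot> v)"
    proof
      assume "\<exists>a. x = a \<odot> v"
      then obtain a where "x = a \<odot> v" ..
      then show "?P x = x" using v vv by simp
    qed metis
  qed
  have "{x \<in> carrier H. \<exists>a. x = a \<odot> v} \<noteq> carrier H"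
  proof
    assume all: "{x \<in> carrier H. \<exists>a. x = a \<odot> v} = carrier H"
    from dim obtain x y where xy: "x \<in> carrier H" "y \<in> carrier H"
      and ind: "\<And>a b. a \<odot> x \<oplus> b \<odot> y = \<zero> \<Longrightarrow> a = 0 \<and> b = 0"
      unfolding dim_at_least_two_def by blast
    obtain c where x: "x = c \<odot> v" using xy(1) all by blast
    obtain d where y: "y = d \<odot> v" using xy(2) all by blast
    \<comment> \<open>Two multiples of \<open>v\<close> always satisfy this relation; independence
      then makes \<open>c\<close>, and with it \<open>x\<close>, vanish, which is
      impossible.\<close>
    have "d \<odot> x \<oplus> (- c) \<odot> y = \<zero>" unfolding x y using v by (intro vec_eqI) auto
    then have "c = 0" using ind by fastforce
    then have "1 \<odot> x \<oplus> 0 \<odot> y = \<zero>" unfolding x y using v by (intro vec_eqI) auto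
    then show False using ind by fastforce
  qed
  moreover have "v \<in> {x \<in> carrier H. \<exists>a. x = a \<odot> v}"
    using v by (auto intro!: exI[of _ 1])
  ultimately show ?thesis
    unfolding nontrivial_closed_subspace_def
    using closed_subspace_fixed_points[OF orthogonal_projection_line[OF v(1)]] v(2) unfolding eq by blast
qed

lemma dim_at_least_two_nonzero:
  assumes "dim_at_least_two H"
  obtains x where "x \<in> carrier H" "x \<noteq> \<zero>"
proof -
  from assms obtain x y where xy: "x \<in> carrier H" "y \<in> carrier H"
    and ind: "\<And>a b. a \<odot> x \<oplus> b \<odot> y = \<zero> \<Longrightarrow> a = 0 \<and> b = 0"
    unfolding dim_at_least_two_def by blast
  have "x \<noteq> \<zero>"
  proof
    assume "x = \<zero>"
    then have "1 \<odot> x \<oplus> 0 \<odot> y = \<zero>" using xy by simp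
    then show False using ind by fastforce
  qed
  then show thesis using that xy by blast
qed

text \<open>Membership of \<open>0\<close> in the spectrum comes for free on a non-zero space, so
  only the other points need checking.\<close>

lemma quasinilpotentI:
  assumes T: "T \<in> bounded_operators H"
    and inv: "\<And>c. c \<noteq> 0 \<Longrightarrow> invertible_op H (poly_op H T [:-c, 1:])"
    and ne: "x \<in> carrier H" "x \<noteq> \<zero>"
  shows "quasinilpotent H T"
proof -
  have "\<not> invertible_op H (poly_op H T [:- 0, 1:])"
    using spectrum_zero_not_invertible[OF T inv ne] invertible_op_cong[OF poly_op_X[OF T]] by simp
  then have "c \<in> spectrum H T \<longleftrightarrow> c = 0" for c
    unfolding in_spectrum_iff[OF T] using inv[of c] by (cases "c = 0") simp_all
  then show ?thesis unfolding quasinilpotent_def by blast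
qed

lemma quasinilpotentD:
  assumes "T \<in> bounded_operators H" "quasinilpotent H T"
  shows "c \<noteq> 0 \<Longrightarrow> invertible_op H (poly_op H T [:-c, 1:])"
    and "\<not> invertible_op H T"
  using assms in_spectrum_iff[OF assms(1), of c] in_spectrum_iff[OF assms(1), of 0]
    invertible_op_cong[OF poly_op_X[OF assms(1)]]
  unfolding quasinilpotent_def by auto

end

section \<open>Restriction of the structure to a closed subspace\<close>

lemma horner_carrier_update [simp]: "horner (H\<lparr>carrier := S\<rparr>) T as x = horner H T as x"
  by (induction as) auto

lemma poly_op_carrier_update [simp]: "poly_op (H\<lparr>carrier := S\<rparr>) T p = poly_op H T p"
  by (rule ext) (simp add: poly_op_def)

lemma hnorm_carrier_update [simp]: "hnorm (H\<lparr>carrier := S\<rparr>) = hnorm H"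
  by (rule ext) (simp add: hnorm_def)

context complex_inner_space
begin

lemma complex_inner_space_restrict:
  assumes S: "closed_subspace H S"
  shows "complex_inner_space (H\<lparr>carrier := S\<rparr>)"
proof (rule complex_inner_space.intro)
  show "Module.module complex_field (H\<lparr>carrier := S\<rparr>)"
    by (rule submodule.submodule_is_module[OF closed_subspace_submodule[OF S] module_axioms])
  have sub: "x \<in> S \<Longrightarrow> x \<in> carrier H" for x using closed_subspace_subset[OF S] by blast
  show "complex_inner_space_axioms (H\<lparr>carrier := S\<rparr>)"
  proof
    fix x y assume "x \<in> carrier (H\<lparr>carrier := S\<rparr>)" "y \<in> carrier (H\<lparr>carrier := S\<rparr>)"
    then have "cinner H x y = cnj (cinner H y x)" by (intro cinner_commute) (simp_all add: sub)
    then show "cinner (H\<lparr>carrier := S\<rparr>) x y = cnj (cinner (H\<lparr>carrier := S\<rparr>) y x)" by simp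
  qed (simp_all add: sub cinner_pos)
qed

text \<open>The additive inverse is defined through the carrier, so subtraction, unlike addition, is
  not preserved by mere unfolding; on both sides it equals
  \<open>x \<oplus> (-1) \<odot> y\<close>.\<close>

lemma minus_carrier_update:
  assumes S: "closed_subspace H S" and "x \<in> S" "y \<in> S"
  shows "x \<ominus>\<^bsub>H\<lparr>carrier := S\<rparr>\<^esub> y = x \<ominus> y"
  using complex_inner_space.minus_eq_add_smult[OF complex_inner_space_restrict[OF S], of x y]
    minus_eq_add_smult[OF subsetD[OF closed_subspace_subset[OF S] assms(2)]
      subsetD[OF closed_subspace_subset[OF S] assms(3)]] assms(2,3) by simp

lemma bounded_restrict:
  assumes T: "T \<in> bounded_operators H" and S: "S \<subseteq> carrier H" and TS: "\<And>x. x \<in> S \<Longrightarrow> T x \<in> S"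
  shows "T \<in> bounded_operators (H\<lparr>carrier := S\<rparr>)"
proof -
  obtain K where K: "\<And>x. x \<in> carrier H \<Longrightarrow> hnorm H (T x) \<le> K * hnorm H x"
    using op_bound[OF T] by metis
  have sub: "x \<in> S \<Longrightarrow> x \<in> carrier H" for x using S by blast
  show ?thesis
    unfolding bounded_operators_def using op_add[OF T] op_smult[OF T] TS sub K by (auto intro!: exI[of _ K])
qed

lemma closed_subspace_trans:
  assumes S: "closed_subspace H S" and M: "closed_subspace (H\<lparr>carrier := S\<rparr>) M"
  shows "closed_subspace H M" "M \<subseteq> S"
proof -
  interpret S: complex_inner_space "H\<lparr>carrier := S\<rparr>" by (rule complex_inner_space_restrict[OF S])
  show MS: "M \<subseteq> S" using S.closed_subspace_subset[OF M] by simp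
  show "closed_subspace H M"
  proof (rule closed_subspaceI)
    show "M \<subseteq> carrier H" using MS closed_subspace_subset[OF S] by blast
    show "\<zero> \<in> M" using S.closed_subspace_zero[OF M] by simp
    show "x \<oplus> y \<in> M" if "x \<in> M" "y \<in> M" for x y using S.closed_subspace_add[OF M that] by simp
    show "a \<odot> x \<in> M" if "x \<in> M" for a x using S.closed_subspace_smult[OF M that] by simp
    fix x assume x: "x \<in> carrier H" and *: "\<And>e. e > 0 \<Longrightarrow> \<exists>y\<in>M. hnorm H (x \<ominus> y) < e"
    have xS: "x \<in> S" by (rule closed_subspace_limit[OF S x]) (use * MS in blast)
    show "x \<in> M"
    proof (rule S.closed_subspace_limit[OF M])
      fix e :: real assume "e > 0"
      from *[OF this] obtain y where y: "y \<in> M" "hnorm H (x \<ominus> y) < e" by blast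
      then have "x \<ominus>\<^bsub>H\<lparr>carrier := S\<rparr>\<^esub> y = x \<ominus> y" using minus_carrier_update[OF S xS] MS by blast
      then show "\<exists>y\<in>M. hnorm (H\<lparr>carrier := S\<rparr>) (x \<ominus>\<^bsub>H\<lparr>carrier := S\<rparr>\<^esub> y) < e"
        using y by (intro bexI[of _ y]) simp_all
    qed (use xS in simp)
  qed
qed

end

context separable_hilbert_space
begin

text \<open>The range is closed, hence complete, and the image under \<open>E\<close> of a countable
  dense set is dense in it, as \<open>E\<close> is bounded and fixes the range.\<close>

lemma separable_hilbert_space_range:
  assumes E: "E \<in> bounded_operators H" and idem: "\<And>x. x \<in> carrier H \<Longrightarrow> E (E x) = E x"
  shows "separable_hilbert_space (H\<lparr>carrier := {x \<in> carrier H. E x = x}\<rparr>)"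
proof -
  define S where "S = {x \<in> carrier H. E x = x}"
  have S: "closed_subspace H S" unfolding S_def by (rule closed_subspace_fixed_points[OF E])
  have sub: "x \<in> S \<Longrightarrow> x \<in> carrier H" for x by (simp add: S_def)
  interpret S: complex_inner_space "H\<lparr>carrier := S\<rparr>" by (rule complex_inner_space_restrict[OF S])
  have norm: "hnorm (H\<lparr>carrier := S\<rparr>) (x \<ominus>\<^bsub>H\<lparr>carrier := S\<rparr>\<^esub> y) = hnorm H (x \<ominus> y)" if "x \<in> S" "y \<in> S" for x y
    using minus_carrier_update[OF S that] by simp
  have "S.HM.mcomplete"
    unfolding S.mcomplete_iff
  proof (intro allI impI)
    fix s :: "nat \<Rightarrow> 'a" assume s: "range s \<subseteq> carrier (H\<lparr>carrier := S\<rparr>)"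
      and cau: "\<forall>e>0. \<exists>N. \<forall>m\<ge>N. \<forall>n\<ge>N. hnorm (H\<lparr>carrier := S\<rparr>) (s m \<ominus>\<^bsub>H\<lparr>carrier := S\<rparr>\<^esub> s n) < e"
    have sS: "s n \<in> S" for n using s by auto
    have "range s \<subseteq> carrier H" using sS sub by blast
    moreover have "\<forall>e>0. \<exists>N. \<forall>m\<ge>N. \<forall>n\<ge>N. hnorm H (s m \<ominus> s n) < e"
      using cau norm[OF sS sS] by simp
    ultimately have "\<exists>x\<in>carrier H. (\<lambda>n. hnorm H (s n \<ominus> x)) \<longlonglongrightarrow> 0"
      by (rule complete[unfolded mcomplete_iff, THEN spec, THEN mp, THEN mp])
    then obtain x where x: "x \<in> carrier H" and lim: "(\<lambda>n. hnorm H (s n \<ominus> x)) \<longlonglongrightarrow> 0" ..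
    have "x \<in> S"
    proof (rule closed_subspace_limit[OF S x])
      fix e :: real assume "e > 0"
      then have "\<forall>\<^sub>F n in sequentially. hnorm H (s n \<ominus> x) < e" by (rule order_tendstoD(2)[OF lim])
      then obtain n where "hnorm H (s n \<ominus> x) < e"
        using eventually_happens'[OF sequentially_bot] by blast
      then show "\<exists>y\<in>S. hnorm H (x \<ominus> y) < e"
        using sS hnorm_minus_commute[OF x sub[OF sS]] by (intro bexI[of _ "s n"]) auto
    qed
    then show "\<exists>x\<in>carrier (H\<lparr>carrier := S\<rparr>). (\<lambda>n. hnorm (H\<lparr>carrier := S\<rparr>) (s n \<ominus>\<^bsub>H\<lparr>carrier := S\<rparr>\<^esub> x)) \<longlonglongrightarrow> 0"
      using lim norm[OF sS] by (intro bexI[of _ x]) simp_all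
  qed
  moreover have "separable_space S.HM.mtopology"
    unfolding S.separable_iff
  proof -
    obtain D where D: "D \<subseteq> carrier H" "countable D" "\<And>x e. x \<in> carrier H \<Longrightarrow> e > 0 \<Longrightarrow> \<exists>d\<in>D. hnorm H (x \<ominus> d) < e"
      using separable unfolding separable_iff by metis
    obtain K where K: "K \<ge> 0" "\<And>x. x \<in> carrier H \<Longrightarrow> hnorm H (E x) \<le> K * hnorm H x"
      using op_bound[OF E] by metis
    have ES: "E x \<in> S" if "x \<in> carrier H" for x
      using op_closed[OF E that] idem[OF that] by (simp add: S_def)
    have "\<exists>d\<in>E ` D. hnorm (H\<lparr>carrier := S\<rparr>) (x \<ominus>\<^bsub>H\<lparr>carrier := S\<rparr>\<^esub> d) < e" if x: "x \<in> S" and e: "e > 0" for x e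
    proof -
      have "e / (K + 1) > 0" using e K by simp
      from D(3)[OF sub[OF x] this] obtain d where d: "d \<in> D" "hnorm H (x \<ominus> d) < e / (K + 1)" by blast
      have dc: "d \<in> carrier H" using d D by blast
      have "x \<ominus> E d = E (x \<ominus> d)"
        using op_diff[OF E sub[OF x] dc] x by (simp add: S_def)
      then have "hnorm H (x \<ominus> E d) \<le> K * hnorm H (x \<ominus> d)" using K(2)[of "x \<ominus> d"] sub[OF x] dc by simp
      also have "\<dots> \<le> (K + 1) * hnorm H (x \<ominus> d)" using sub[OF x] dc by (intro mult_right_mono) auto
      also have "\<dots> < (K + 1) * (e / (K + 1))" using d K by (intro mult_strict_left_mono) auto
      also have "\<dots> = e" using K by simp
      finally show ?thesis using norm[OF x ES[OF dc]] d(1) by (intro bexI[of _ "E d"]) auto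
    qed
    moreover have "E ` D \<subseteq> S" using ES D(1) by blast
    ultimately show "\<exists>D\<subseteq>carrier (H\<lparr>carrier := S\<rparr>). countable D \<and> (\<forall>x\<in>carrier (H\<lparr>carrier := S\<rparr>). \<forall>e>0.
       \<exists>d\<in>D. hnorm (H\<lparr>carrier := S\<rparr>) (x \<ominus>\<^bsub>H\<lparr>carrier := S\<rparr>\<^esub> d) < e)"
      using D(2) by (intro exI[of _ "E ` D"]) simp
  qed
  ultimately show ?thesis
    unfolding S_def[symmetric] by unfold_locales
qed

text \<open>The spectrum of \<open>T\<close> can only contain the roots \<open>0\<close> and
  \<open>1\<close> of \<open>X - X^2\<close>. A single root leads to a translate of a quasinilpotent
  operator; two roots give a proper spectral idempotent commuting with \<open>T\<close>.\<close>

lemma invariant_subspace_of_quasinilpotent_defect: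
  assumes hyp: "\<And>T. T \<in> bounded_operators H \<Longrightarrow> quasinilpotent H T \<Longrightarrow>
      \<exists>S. nontrivial_closed_subspace H S \<and> invariant_under T S"
    and T: "T \<in> bounded_operators H"
    and inv: "\<And>c. c \<noteq> 0 \<Longrightarrow> invertible_op H (poly_op H T ([:0, 1:] - [:0, 1:] ^ 2 - [:c:]))"
    and ne: "z \<in> carrier H" "z \<noteq> \<zero>"
  shows "\<exists>S. nontrivial_closed_subspace H S \<and> invariant_under T S"
proof -
  note cl = op_closed[OF T] poly_op_closed[OF T]
  have inv': "invertible_op H (poly_op H T [:-\<mu>, 1:])" if "\<mu> \<noteq> 0" "\<mu> \<noteq> 1" for \<mu>
  proof (rule invertible_poly_op_factor[OF T])
    \<comment> \<open>\<open>X - X^2\<close> takes the same value at \<open>\<mu>\<close> and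
      \<open>1 - \<mu>\<close>, so subtracting that value leaves these two linear factors.\<close>
    have "[:0, 1:] - [:0, 1:] ^ 2 - [:\<mu> - \<mu>\<^sup>2:] = [:-\<mu>, 1:] * [:1 - \<mu>, -1:]"
      by (simp add: power2_eq_square algebra_simps)
    moreover have "\<mu> - \<mu>\<^sup>2 \<noteq> 0" using that by (simp add: power2_eq_square)
    ultimately show "invertible_op H (poly_op H T ([:-\<mu>, 1:] * [:1 - \<mu>, -1:]))"
      using inv by metis
  qed
  consider "invertible_op H T" | "invertible_op H (poly_op H T [:-1, 1:])"
    | "\<not> invertible_op H T" "\<not> invertible_op H (poly_op H T [:-1, 1:])" by blast
  then show ?thesis
  proof cases
    case 1
    define T1 where "T1 = poly_op H T [:-1, 1:]"
    have T1: "T1 \<in> bounded_operators H" unfolding T1_def by (rule poly_op_bounded[OF T])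
    have T1x: "T1 x = T x \<ominus> x" if "x \<in> carrier H" for x
      using that cl unfolding T1_def by (intro vec_eqI) (auto simp: poly_op_pCons[OF T] op_linear[OF T])
    have "quasinilpotent H T1"
    proof (rule quasinilpotentI[OF T1 _ ne])
      fix c :: complex assume c: "c \<noteq> 0"
      have eq: "poly_op H T [:-(1 + c), 1:] x = poly_op H T1 [:-c, 1:] x" if "x \<in> carrier H" for x
        using that cl op_closed[OF T1]
        by (intro vec_eqI) (auto simp: poly_op_pCons[OF T] op_linear[OF T] poly_op_pCons[OF T1] op_linear[OF T1] T1x algebra_simps)
      have "invertible_op H (poly_op H T [:-(1 + c), 1:])"
      proof (cases "1 + c = 0")
        case True
        then show ?thesis using 1 invertible_op_cong[OF poly_op_X[OF T]] by simp
      next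
        case False
        then show ?thesis using c by (intro inv') simp_all
      qed
      then show "invertible_op H (poly_op H T1 [:-c, 1:])" using invertible_op_cong[OF eq] by simp
    qed
    from hyp[OF T1 this] obtain S where S: "nontrivial_closed_subspace H S" "invariant_under T1 S" by blast
    then have cs: "closed_subspace H S" by (simp add: nontrivial_closed_subspace_def)
    have "T x \<in> S" if x: "x \<in> S" for x
    proof -
      have xc: "x \<in> carrier H" using closed_subspace_subset[OF cs] x by blast
      have "T x = T1 x \<oplus> x" using xc cl T1x by (intro vec_eqI) auto
      moreover have "T1 x \<in> S" using S(2) x unfolding invariant_under_def by blast
      ultimately show ?thesis using closed_subspace_add[OF cs _ x] by simp
    qed
    then show ?thesis using S(1) unfolding invariant_under_def by blast
  next
    case 2
    have "quasinilpotent H T"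
      by (rule quasinilpotentI[OF T _ ne]) (use 2 inv' in metis)
    then show ?thesis by (rule hyp[OF T])
  next
    case 3
    define q where "q = poly_op H T ([:0, 1:] - [:0, 1:] ^ 2)"
    have q: "q \<in> bounded_operators H" unfolding q_def by (rule poly_op_bounded[OF T])
    have "invertible_op H (poly_op H q [:-c, 1:])" if "c \<noteq> 0" for c
    proof -
      have "poly_op H T ([:0, 1:] - [:0, 1:] ^ 2 - [:c:]) x = poly_op H q [:-c, 1:] x" if x: "x \<in> carrier H" for x
      proof -
        have "poly_op H T [:c:] x = c \<odot> x" using x by (simp add: poly_op_pCons[OF T] op_linear[OF T])
        then have "poly_op H T ([:0, 1:] - [:0, 1:] ^ 2 - [:c:]) x = q x \<ominus> c \<odot> x"
          unfolding q_def using poly_op_diff[OF T x, of "[:0, 1:] - [:0, 1:] ^ 2" "[:c:]"] by simp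
        also have "\<dots> = poly_op H q [:-c, 1:] x"
          using x op_closed[OF q] by (intro vec_eqI) (auto simp: poly_op_pCons[OF q] op_linear[OF q])
        finally show ?thesis .
      qed
      from invertible_op_cong[OF this] inv[OF that] show ?thesis by simp
    qed
    \<comment> \<open>The radius is arbitrary for a quasinilpotent operator; \<open>16\<close> is
      the weight required by the Newton iteration.\<close>
    from resolvent_power_bound[OF q this, of 16]
    obtain M where M: "\<forall>n. \<forall>x\<in>carrier H. 16 ^ n * hnorm H ((q ^^ n) x) \<le> M * hnorm H x" by auto
    have bound: "16 ^ n * hnorm H ((poly_op H T ([:0, 1:] - [:0, 1:] ^ 2) ^^ n) x) \<le> M * hnorm H x"
      if "x \<in> carrier H" for n x
      by (rule bspec[OF spec[OF M[unfolded q_def]] that])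
    obtain P where P: "P \<in> bounded_operators H" and idem: "\<forall>x\<in>carrier H. P (P x) = P x"
      and comm: "\<forall>x\<in>carrier H. P (T x) = T (P x)"
      and P1: "(\<forall>x\<in>carrier H. P x = x) \<longrightarrow> invertible_op H T"
      and P0: "(\<forall>x\<in>carrier H. P x = \<zero>) \<longrightarrow> invertible_op H (poly_op H T [:1, -1:])"
    proof -
      show thesis by (rule bexE[OF spectral_idempotent[OF T bound]], assumption, elim conjE, rule that)
    qed
    define S where "S = {x \<in> carrier H. P x = x}"
    have "closed_subspace H S" unfolding S_def by (rule closed_subspace_fixed_points[OF P])
    moreover have "S \<noteq> carrier H" using P1 3(1) unfolding S_def by blast
    moreover have "S \<noteq> {\<zero>}"
    proof -
      have "\<not> invertible_op H (poly_op H T [:1, -1:])"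
      proof
        assume "invertible_op H (poly_op H T [:1, -1:])"
        from invertible_smult[OF this, of "-1"] have "invertible_op H (\<lambda>x. (-1) \<odot> poly_op H T [:1, -1:] x)"
          using poly_op_bounded[OF T] by simp
        moreover have "(-1) \<odot> poly_op H T [:1, -1:] x = poly_op H T [:-1, 1:] x" if "x \<in> carrier H" for x
          using poly_op_smult[OF T that, of "-1" "[:1, -1:]"] by simp
        ultimately show False using 3(2) invertible_op_cong by metis
      qed
      then obtain x where x: "x \<in> carrier H" "P x \<noteq> \<zero>" using P0 by blast
      then have "P x \<in> S" using idem op_closed[OF P] by (simp add: S_def)
      then show ?thesis using x by blast
    qed
    moreover have "invariant_under T S"
      unfolding invariant_under_def S_def using comm cl by auto
    ultimately show ?thesis unfolding nontrivial_closed_subspace_def by blast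
  qed
qed

end

section \<open>Pairs of idempotents\<close>

context complex_inner_space
begin

lemma bounded_complement:
  "E \<in> bounded_operators H \<Longrightarrow> (\<lambda>x. x \<ominus> E x) \<in> bounded_operators H"
  by (rule bounded_diff[OF bounded_id])

lemma complement_idempotent:
  assumes E: "E \<in> bounded_operators H" and idem: "\<And>x. x \<in> carrier H \<Longrightarrow> E (E x) = E x"
    and x: "x \<in> carrier H"
  shows "(x \<ominus> E x) \<ominus> E (x \<ominus> E x) = x \<ominus> E x"
  using x op_closed[OF E] by (intro vec_eqI) (auto simp: op_linear[OF E] idem)

text \<open>Compared with the sum of \<open>M\<close> and the closure of \<open>(1 - E) F M\<close>, which is also invariant
  under both, this pullback needs no closure.\<close>
lemma compression_pullback:
  assumes E: "E \<in> bounded_operators H" and F: "F \<in> bounded_operators H"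
    and idE: "\<And>x. x \<in> carrier H \<Longrightarrow> E (E x) = E x" and idF: "\<And>x. x \<in> carrier H \<Longrightarrow> F (F x) = F x"
    and M: "closed_subspace H M" and EM: "\<And>x. x \<in> M \<Longrightarrow> E x = x" and EF: "\<And>x. x \<in> M \<Longrightarrow> E (F x) \<in> M"
  defines "W \<equiv> {x \<in> carrier H. E x \<in> M \<and> E (F x) \<in> M}"
  shows "closed_subspace H W" "invariant_under E W" "invariant_under F W" "M \<subseteq> W"
proof -
  have "W = {x \<in> carrier H. E x \<in> M} \<inter> {x \<in> carrier H. E (F x) \<in> M}" by (auto simp: W_def)
  then show "closed_subspace H W"
    using closed_subspace_Int[OF closed_subspace_preimage[OF E M]
        closed_subspace_preimage[OF bounded_compose[OF E F] M]] by simp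
  \<comment> \<open>\<open>E x\<close> lies in \<open>M\<close>, where \<open>E\<close> acts as the
    identity and \<open>E F\<close> maps into \<open>M\<close>. For \<open>F x\<close> both
    conditions reduce to the one on \<open>E (F x)\<close>, since \<open>F\<close> is
    idempotent.\<close>
  show "invariant_under E W"
    unfolding invariant_under_def W_def using EM EF op_closed[OF E] idE by auto
  show "invariant_under F W"
    unfolding invariant_under_def W_def using op_closed[OF F] idF by auto
  show "M \<subseteq> W"
    using closed_subspace_subset[OF M] EM EF by (auto simp: W_def)
qed

lemma not_dim_at_least_two:
  assumes "\<not> dim_at_least_two H" and u: "u \<in> carrier H" "u \<noteq> \<zero>" and y: "y \<in> carrier H"
  shows "\<exists>a. y = a \<odot> u"
proof -
  obtain a b where ab: "a \<odot> u \<oplus> b \<odot> y = \<zero>" "\<not> (a = 0 \<and> b = 0)"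
    using assms(1) u(1) y unfolding dim_at_least_two_def by meson
  have "b \<noteq> 0"
  proof
    assume b: "b = 0"
    then have "a \<noteq> 0" using ab by simp
    have "a \<odot> u = \<zero>" using ab(1) b u(1) y by simp
    then have "cmod a * hnorm H u = 0" using hnorm_smult[OF u(1), of a] by simp
    then show False using \<open>a \<noteq> 0\<close> u by simp
  qed
  have "y = (1 / b) \<odot> (a \<odot> u \<oplus> b \<odot> y) \<oplus> (- a / b) \<odot> u"
    using u y \<open>b \<noteq> 0\<close> by (intro vec_eqI) (auto simp: field_simps)
  also have "\<dots> = (- a / b) \<odot> u"
    unfolding ab(1) using u by (intro vec_eqI) auto
  finally show ?thesis ..
qed

text \<open>Covers \<open>E = 0\<close> and \<open>E = 1\<close>, where only \<open>F\<close>
  matters. The range of \<open>F\<close> works unless \<open>F\<close> is \<open>0\<close> or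
  \<open>1\<close>, and then every line does.\<close>

lemma idempotent_invariant_subspace:
  assumes dim: "dim_at_least_two H" and F: "F \<in> bounded_operators H"
    and idF: "\<And>x. x \<in> carrier H \<Longrightarrow> F (F x) = F x"
  shows "\<exists>S. nontrivial_closed_subspace H S \<and> invariant_under F S"
proof -
  obtain v where v: "v \<in> carrier H" "v \<noteq> \<zero>" by (rule dim_at_least_two_nonzero[OF dim])
  let ?L = "{x \<in> carrier H. \<exists>a. x = a \<odot> v}" and ?R = "{x \<in> carrier H. F x = x}"
  have R: "closed_subspace H ?R" by (rule closed_subspace_fixed_points[OF F])
  consider "?R = carrier H" | "?R = {\<zero>}" | "?R \<noteq> carrier H" "?R \<noteq> {\<zero>}" by blast
  then show ?thesis
  proof cases
    case 1
    then have "F x = x" if "x \<in> carrier H" for x using that by blast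
    then have "invariant_under F ?L" unfolding invariant_under_def by auto
    then show ?thesis using nontrivial_line[OF dim v] by blast
  next
    case 2
    have F0: "F x = \<zero>" if "x \<in> carrier H" for x
      using 2 op_closed[OF F that] idF[OF that] by blast
    have "\<exists>a. \<zero> = a \<odot> v" using v smult_zero_left by metis
    then have "invariant_under F ?L"
      unfolding invariant_under_def using F0 by auto
    then show ?thesis using nontrivial_line[OF dim v] by blast
  next
    case 3
    have "invariant_under F ?R" unfolding invariant_under_def using op_closed[OF F] by auto
    then show ?thesis using R 3 unfolding nontrivial_closed_subspace_def by blast
  qed
qed

end

text \<open>The assumption ranges over all spaces of the element type because it is applied to the
  range of \<open>E\<close>, not to \<open>H\<close>. Its bound on the dimension is what restricts
  this argument to ranges of dimension at least two.\<close>

lemma compression_invariant_subspace: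
  fixes H :: "'a hilbert" (structure)
  assumes hyp: "\<And>(K :: 'a hilbert) T. separable_hilbert_space K \<Longrightarrow> dim_at_least_two K \<Longrightarrow>
      T \<in> bounded_operators K \<Longrightarrow> quasinilpotent K T \<Longrightarrow>
      \<exists>S. nontrivial_closed_subspace K S \<and> invariant_under T S"
    and H: "separable_hilbert_space H"
    and E: "E \<in> bounded_operators H" and F: "F \<in> bounded_operators H" and C: "C \<in> bounded_operators H"
    and idE: "\<And>x. x \<in> carrier H \<Longrightarrow> E (E x) = E x" and idF: "\<And>x. x \<in> carrier H \<Longrightarrow> F (F x) = F x"
    and CEF: "\<And>x. x \<in> carrier H \<Longrightarrow> C x = E (F x) \<ominus> F (E x)"
    and inv: "\<And>c. c \<noteq> 0 \<Longrightarrow> invertible_op H (poly_op H C [:-c, 1:])"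
    and dim: "dim_at_least_two (H\<lparr>carrier := {x \<in> carrier H. E x = x}\<rparr>)"
  shows "\<exists>S. nontrivial_closed_subspace H S \<and> invariant_under E S \<and> invariant_under F S"
proof -
  interpret separable_hilbert_space H by (rule H)
  define S where "S = {x \<in> carrier H. E x = x}"
  let ?K = "H\<lparr>carrier := S\<rparr>"
  have S: "closed_subspace H S" unfolding S_def by (rule closed_subspace_fixed_points[OF E])
  have K: "separable_hilbert_space ?K" unfolding S_def by (rule separable_hilbert_space_range[OF E idE])
  interpret K: separable_hilbert_space ?K by (rule K)
  note dim' = dim[folded S_def]
  have sub: "x \<in> S \<Longrightarrow> x \<in> carrier H" for x by (simp add: S_def)
  have ES: "E x \<in> S" if "x \<in> carrier H" for x using op_closed[OF E that] idE[OF that] by (simp add: S_def)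
  have SE: "E x = x" if "x \<in> S" for x using that by (simp add: S_def)
  note cl = op_closed[OF E] op_closed[OF F] op_closed[OF C]
  define T where "T x = E (F x)" for x
  have TH: "T \<in> bounded_operators H" unfolding T_def by (rule bounded_compose[OF E F])
  have T: "T \<in> bounded_operators ?K"
    by (rule bounded_restrict[OF TH closed_subspace_subset[OF S]]) (simp add: T_def ES cl sub)
  have CC: "C (C x) = E (F (E (F x))) \<ominus> E (F (E x)) \<ominus> F (E (F x)) \<oplus> F (E (F (E x)))" if "x \<in> carrier H" for x
    using that cl by (intro vec_eqI) (auto simp: CEF op_linear[OF E] op_linear[OF F] idE idF)
  have "invertible_op ?K (poly_op ?K T ([:0, 1:] - [:0, 1:] ^ 2 - [:c:]))" if "c \<noteq> 0" for c
  proof -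
    \<comment> \<open>With \<open>a^2 = - c\<close> one has
      \<open>C^2 + c = (C - a) (C + a)\<close>, and \<open>a\<close> and \<open>- a\<close> are
      non-zero, hence outside the spectrum of \<open>C\<close>.\<close>
    define a where "a = csqrt (- c)"
    have a: "a * a = - c" "a \<noteq> 0" using that by (auto simp: a_def simp flip: power2_eq_square)
    define G where "G = poly_op H C ([:-a, 1:] * [:a, 1:])"
    have GB: "G \<in> bounded_operators H" unfolding G_def by (rule poly_op_bounded[OF C])
    have "invertible_op H G"
      unfolding G_def using invertible_poly_op_mult[OF C inv[of a] inv[of "-a"]] a(2) by simp
    then obtain R where R: "R \<in> bounded_operators H" "\<And>x. x \<in> carrier H \<Longrightarrow> R (G x) = x"
      "\<And>x. x \<in> carrier H \<Longrightarrow> G (R x) = x"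
      unfolding invertible_op_def by blast
    have G: "G x = C (C x) \<oplus> c \<odot> x" if "x \<in> carrier H" for x
    proof -
      have "[:-a, 1:] * [:a, 1:] = [:c, 0, 1:]" using a by simp
      then show ?thesis unfolding G_def using that cl
        by (intro vec_eqI) (auto simp: poly_op_pCons[OF C] op_linear[OF C])
    qed
    \<comment> \<open>In \<open>E C^2\<close> and in \<open>C^2 E\<close> alike everything cancels
      except \<open>E F E F E - E F E\<close>.\<close>
    have EG: "E (G x) = G (E x)" if x: "x \<in> carrier H" for x
      using x cl by (intro vec_eqI) (auto simp: G CC op_linear[OF E] op_linear[OF F] idE idF)
    have ER: "E (R x) = R (E x)" if x: "x \<in> carrier H" for x
      by (rule inverse_commute[OF E GB R(1) EG R(2,3) x])
    have RS: "R x \<in> S" if x: "x \<in> S" for x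
      using ER[OF sub[OF x]] SE[OF x] op_closed[OF R(1) sub[OF x]] by (simp add: S_def)
    have RK: "R \<in> bounded_operators ?K"
      by (rule bounded_restrict[OF R(1) closed_subspace_subset[OF S] RS])
    have q: "poly_op ?K T ([:0, 1:] - [:0, 1:] ^ 2 - [:c:]) x = (-1) \<odot> G x" if x: "x \<in> S" for x
    proof -
      have "[:0, 1:] - [:0, 1:] ^ 2 - [:c:] = [:-c, 1, -1:]" by (simp add: power2_eq_square)
      then have "poly_op ?K T ([:0, 1:] - [:0, 1:] ^ 2 - [:c:]) x = poly_op H T [:-c, 1, -1:] x" by simp
      also have "\<dots> = (-1) \<odot> G x"
        using sub[OF x] SE[OF x] cl
        by (intro vec_eqI)
           (auto simp: G CC poly_op_pCons[OF TH] op_linear[OF TH] T_def op_linear[OF E] op_linear[OF F] idE idF)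
      finally show ?thesis .
    qed
    have GS: "G x \<in> S" if "x \<in> S" for x
      using EG[OF sub[OF that]] SE[OF that] op_closed[OF GB sub[OF that]] by (simp add: S_def)
    show ?thesis
      unfolding invertible_op_def
    proof (rule bexI[OF _ K.bounded_smult[OF RK, of "-1"]], intro ballI conjI)
      fix x assume "x \<in> carrier ?K"
      then have x: "x \<in> S" by simp
      have eq: "(-1) \<odot> ((-1) \<odot> x) = x" if "x \<in> carrier H" for x using that by (intro vec_eqI) auto
      have "(-1) \<odot> R ((-1) \<odot> G x) = x"
        using sub[OF x] op_closed[OF GB] op_closed[OF R(1)] by (simp add: op_smult[OF R(1)] R(2) eq)
      then show "- 1 \<odot>\<^bsub>?K\<^esub> R (poly_op ?K T ([:0, 1:] - [:0, 1:] ^ 2 - [:c:]) x) = x"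
        unfolding q[OF x] by simp
      have "(-1) \<odot> R x \<in> S" using closed_subspace_smult[OF S RS[OF x]] .
      moreover have "(-1) \<odot> G ((-1) \<odot> R x) = x"
        using sub[OF x] op_closed[OF GB] op_closed[OF R(1)] by (simp add: op_smult[OF GB] R(3) eq)
      ultimately show "poly_op ?K T ([:0, 1:] - [:0, 1:] ^ 2 - [:c:]) (- 1 \<odot>\<^bsub>?K\<^esub> R x) = x"
        using q by simp
    qed
  qed
  moreover obtain z where "z \<in> carrier ?K" "z \<noteq> \<zero>\<^bsub>?K\<^esub>"
    by (rule K.dim_at_least_two_nonzero[OF dim'])
  ultimately obtain M where M: "nontrivial_closed_subspace ?K M" "invariant_under T M"
    using K.invariant_subspace_of_quasinilpotent_defect[OF hyp[OF K dim'] T] by metis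
  have cs: "closed_subspace ?K M" and M0: "M \<noteq> {\<zero>}" and MS: "M \<noteq> S"
    using M(1) by (simp_all add: nontrivial_closed_subspace_def)
  note MH = closed_subspace_trans(1)[OF S cs] and Msub = closed_subspace_trans(2)[OF S cs]
  have EM: "E x = x" if "x \<in> M" for x using SE Msub that by blast
  have EFM: "E (F x) \<in> M" if "x \<in> M" for x using M(2) that unfolding invariant_under_def T_def by blast
  define W where "W = {x \<in> carrier H. E x \<in> M \<and> E (F x) \<in> M}"
  note W = compression_pullback[OF E F idE idF MH EM EFM, folded W_def]
  \<comment> \<open>A vector of the range lies in \<open>W\<close> only if it lies in
    \<open>M\<close>, so \<open>W\<close> is proper because \<open>M\<close> is proper in the
    range.\<close>
  have "W \<noteq> carrier H"
  proof
    assume "W = carrier H"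
    then have "S \<subseteq> M" using SE sub unfolding W_def by force
    then show False using MS Msub by blast
  qed
  moreover have "W \<noteq> {\<zero>}" using W(4) M0 closed_subspace_zero[OF MH] by blast
  ultimately show ?thesis using W unfolding nontrivial_closed_subspace_def by blast
qed

lemma idempotent_pair_invariant_subspace:
  fixes H :: "'a hilbert" (structure)
  assumes hyp: "\<And>(K :: 'a hilbert) T. separable_hilbert_space K \<Longrightarrow> dim_at_least_two K \<Longrightarrow>
      T \<in> bounded_operators K \<Longrightarrow> quasinilpotent K T \<Longrightarrow>
      \<exists>S. nontrivial_closed_subspace K S \<and> invariant_under T S"
    and H: "separable_hilbert_space H" and dim: "dim_at_least_two H"
    and E: "E \<in> bounded_operators H" and F: "F \<in> bounded_operators H"
    and idE: "idempotent_op H E" and idF: "idempotent_op H F"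
    and quasi: "quasinilpotent H (commutator H E F)"
  shows "\<exists>S. nontrivial_closed_subspace H S \<and> invariant_under E S \<and> invariant_under F S"
proof -
  interpret separable_hilbert_space H by (rule H)
  have idE: "E (E x) = E x" if "x \<in> carrier H" for x using idE that by (simp add: idempotent_op_def)
  have idF: "F (F x) = F x" if "x \<in> carrier H" for x using idF that by (simp add: idempotent_op_def)
  note cl = op_closed[OF E] op_closed[OF F]
  define C where "C = commutator H E F"
  have CEF: "C x = E (F x) \<ominus> F (E x)" for x by (simp add: C_def commutator_def op_minus_def)
  have C: "C \<in> bounded_operators H"
    unfolding C_def commutator_def o_def by (rule op_minus_bounded[OF bounded_compose[OF E F] bounded_compose[OF F E]])
  note inv = quasinilpotentD(1)[OF C quasi[folded C_def]]
  define E' where "E' x = x \<ominus> E x" for x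
  have E': "E' \<in> bounded_operators H" unfolding E'_def by (rule bounded_complement[OF E])
  have idE': "E' (E' x) = E' x" if "x \<in> carrier H" for x
    unfolding E'_def by (rule complement_idempotent[OF E idE that])
  have E'E: "invariant_under E S" if S: "closed_subspace H S" and inv: "invariant_under E' S" for S
  proof -
    have "E x \<in> S" if x: "x \<in> S" for x
    proof -
      have xc: "x \<in> carrier H" using x closed_subspace_subset[OF S] by blast
      have "E x = x \<ominus> E' x" using xc cl unfolding E'_def by (intro vec_eqI) auto
      moreover have "E' x \<in> S" using inv x unfolding invariant_under_def by blast
      ultimately show ?thesis using closed_subspace_diff[OF S x] by simp
    qed
    then show ?thesis unfolding invariant_under_def by blast
  qed
  let ?R = "{x \<in> carrier H. E x = x}" and ?N = "{x \<in> carrier H. E' x = x}"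
  have R: "closed_subspace H ?R" and N: "closed_subspace H ?N"
    by (rule closed_subspace_fixed_points[OF E], rule closed_subspace_fixed_points[OF E'])
  interpret R: complex_inner_space "H\<lparr>carrier := ?R\<rparr>" by (rule complex_inner_space_restrict[OF R])
  interpret N: complex_inner_space "H\<lparr>carrier := ?N\<rparr>" by (rule complex_inner_space_restrict[OF N])
  \<comment> \<open>Outside the first four cases \<open>E\<close> and \<open>1 - E\<close> are both
    non-zero with ranges of dimension at most one, so the space is a plane.\<close>
  consider (range) "dim_at_least_two (H\<lparr>carrier := ?R\<rparr>)"
    | (kernel) "dim_at_least_two (H\<lparr>carrier := ?N\<rparr>)"
    | (zero) "\<forall>x\<in>carrier H. E x = \<zero>" | (one) "\<forall>x\<in>carrier H. E x = x"
    | (plane) "\<not> dim_at_least_two (H\<lparr>carrier := ?R\<rparr>)" "\<not> dim_at_least_two (H\<lparr>carrier := ?N\<rparr>)"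
      "\<exists>x\<in>carrier H. E x \<noteq> \<zero>" "\<exists>x\<in>carrier H. E x \<noteq> x" by blast
  then show ?thesis
  proof cases
    case range
    show ?thesis by (rule compression_invariant_subspace[OF hyp H E F C idE idF CEF inv range])
  next
    case kernel
    \<comment> \<open>The commutator of \<open>1 - E\<close> with \<open>F\<close> is
      \<open>- C\<close>, and its spectrum is that of \<open>C\<close> reflected at
      \<open>0\<close>.\<close>
    define C' where "C' x = (-1) \<odot> C x" for x
    have C': "C' \<in> bounded_operators H" unfolding C'_def by (rule bounded_smult[OF C])
    have CEF': "C' x = E' (F x) \<ominus> F (E' x)" if "x \<in> carrier H" for x
      using that cl unfolding C'_def E'_def CEF by (intro vec_eqI) (auto simp: op_linear[OF F])
    have inv': "invertible_op H (poly_op H C' [:-c, 1:])" if "c \<noteq> 0" for c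
    proof -
      have "invertible_op H (\<lambda>x. (-1) \<odot> poly_op H C [:- (- c), 1:] x)"
        by (rule invertible_smult[OF inv _ poly_op_bounded[OF C]]) (use that in auto)
      moreover have "(-1) \<odot> poly_op H C [:- (- c), 1:] x = poly_op H C' [:-c, 1:] x" if "x \<in> carrier H" for x
        using that op_closed[OF C] op_closed[OF C']
        by (intro vec_eqI) (auto simp: poly_op_pCons[OF C] poly_op_pCons[OF C'] op_zero[OF C] op_zero[OF C'] C'_def)
      ultimately show ?thesis using invertible_op_cong by metis
    qed
    from compression_invariant_subspace[OF hyp H E' F C' idE' idF CEF' inv' kernel]
    obtain S where "nontrivial_closed_subspace H S" "invariant_under E' S" "invariant_under F S" by blast
    then show ?thesis using E'E unfolding nontrivial_closed_subspace_def by blast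
  next
    case zero
    obtain S where S: "nontrivial_closed_subspace H S" "invariant_under F S"
      using idempotent_invariant_subspace[OF dim F idF] by blast
    then have cs: "closed_subspace H S" by (simp add: nontrivial_closed_subspace_def)
    have "invariant_under E S"
      unfolding invariant_under_def using zero closed_subspace_subset[OF cs] closed_subspace_zero[OF cs] by auto
    then show ?thesis using S by blast
  next
    case one
    obtain S where S: "nontrivial_closed_subspace H S" "invariant_under F S"
      using idempotent_invariant_subspace[OF dim F idF] by blast
    then have cs: "closed_subspace H S" by (simp add: nontrivial_closed_subspace_def)
    have "invariant_under E S"
      unfolding invariant_under_def using one closed_subspace_subset[OF cs] by auto
    then show ?thesis using S by blast
  next
    case plane
    obtain u where u: "u \<in> carrier H" "E u = u" "u \<noteq> \<zero>"
      using plane(3) idE cl by blast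
    obtain y where y: "y \<in> carrier H" "E y \<noteq> y" using plane(4) by blast
    define v where "v = E' y"
    have v: "v \<in> carrier H" "E' v = v" "v \<noteq> \<zero>"
    proof -
      show "v \<in> carrier H" "E' v = v" unfolding v_def by (rule op_closed[OF E' y(1)], rule idE'[OF y(1)])
      show "v \<noteq> \<zero>" using y cl unfolding v_def E'_def by auto
    qed
    have Ev: "E v = \<zero>" unfolding v_def E'_def using y cl by (simp add: op_linear[OF E] idE)
    have inR: "\<exists>a. x = a \<odot> u" if "x \<in> carrier H" "E x = x" for x
      using R.not_dim_at_least_two[OF plane(1), of u x] u that by simp
    have inN: "\<exists>a. x = a \<odot> v" if "x \<in> carrier H" "E' x = x" for x
      using N.not_dim_at_least_two[OF plane(2), of v x] v that by simp
    have *: "E \<zero> = \<zero>" "F \<zero> = \<zero>" "E' \<zero> = \<zero>" by (rule op_zero[OF E], rule op_zero[OF F], rule op_zero[OF E'])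
    note W0 = compression_pullback[OF E F idE idF closed_subspace_singleton_zero, simplified, simplified *, simplified]
    note W1 = compression_pullback[OF E' F idE' idF closed_subspace_singleton_zero, simplified, simplified *, simplified]
    let ?W0 = "{x \<in> carrier H. E x = \<zero> \<and> E (F x) = \<zero>}" and ?W1 = "{x \<in> carrier H. E' x = \<zero> \<and> E' (F x) = \<zero>}"
    have ne: "?W0 \<noteq> carrier H" "?W1 \<noteq> carrier H" using u v by force+
    \<comment> \<open>\<open>?W0\<close> and \<open>?W1\<close> are the pullbacks of the zero
      subspace along \<open>E\<close> and \<open>1 - E\<close>. If both were zero, \<open>C\<close>
      would be antidiagonal in the basis \<open>u\<close>, \<open>v\<close> with non-zero entries,
      so its square would be a non-zero scalar.\<close>
    have "\<not> (?W0 = {\<zero>} \<and> ?W1 = {\<zero>})"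
    proof
      assume W: "?W0 = {\<zero>} \<and> ?W1 = {\<zero>}"
      have "v \<notin> ?W0" using W v by blast
      then have EFv: "E (F v) \<noteq> \<zero>" using v Ev by simp
      have "u \<notin> ?W1" using W u by blast
      then have EFu: "E' (F u) \<noteq> \<zero>" using u unfolding E'_def by auto
      obtain c where c: "E (F v) = c \<odot> u" using inR[of "E (F v)"] idE cl v by blast
      obtain b where b: "E' (F u) = b \<odot> v" using inN[of "E' (F u)"] idE' cl op_closed[OF E'] u by blast
      have cb: "c \<noteq> 0" "b \<noteq> 0" using EFv EFu c b u v by auto
      have Cv: "C v = c \<odot> u"
        using v u cl by (intro vec_eqI) (auto simp: CEF Ev * c)
      have Cu: "C u = (- b) \<odot> v"
      proof -
        have "C u = (-1) \<odot> E' (F u)" unfolding CEF E'_def u(2) using u cl by (intro vec_eqI) auto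
        then show ?thesis unfolding b using v by (intro vec_eqI) auto
      qed
      \<comment> \<open>\<open>C^2 = - b c = a^2\<close>, so \<open>(C - a) (C + a)\<close> is zero,
        whereas quasinilpotence makes it invertible.\<close>
      define a where "a = csqrt (- (b * c))"
      have a: "a * a = - (b * c)" "a \<noteq> 0" using cb by (auto simp: a_def simp flip: power2_eq_square)
      have zero: "poly_op H C ([:-a, 1:] * [:a, 1:]) x = \<zero>" if x: "x \<in> carrier H" for x
      proof -
        obtain s where s: "E x = s \<odot> u" using inR[of "E x"] idE cl x by blast
        obtain t where t: "E' x = t \<odot> v" using inN[of "E' x"] idE' op_closed[OF E'] x by blast
        have "x = E x \<oplus> E' x" unfolding E'_def using x cl by (intro vec_eqI) auto
        then have x_eq: "x = s \<odot> u \<oplus> t \<odot> v" using s t by simp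
        have "[:-a, 1:] * [:a, 1:] = [:b * c, 0, 1:]" using a by simp
        then show ?thesis using u v op_closed[OF C]
          unfolding x_eq
          by (intro vec_eqI) (auto simp: poly_op_pCons[OF C] op_linear[OF C] Cu Cv algebra_simps)
      qed
      have "invertible_op H (poly_op H C ([:-a, 1:] * [:a, 1:]))"
        using invertible_poly_op_mult[OF C inv[of a] inv[of "-a"]] a(2) by simp
      then obtain Q where Q: "Q \<in> bounded_operators H"
        "\<forall>x\<in>carrier H. Q (poly_op H C ([:-a, 1:] * [:a, 1:]) x) = x"
        unfolding invertible_op_def by blast
      then have "u = Q \<zero>" using zero[OF u(1)] u(1) by metis
      then show False using op_zero[OF Q(1)] u(3) by simp
    qed
    then consider "?W0 \<noteq> {\<zero>}" | "?W1 \<noteq> {\<zero>}" by blast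
    then show ?thesis
    proof cases
      case 1
      then have "nontrivial_closed_subspace H ?W0"
        unfolding nontrivial_closed_subspace_def using W0(1) ne(1) by simp
      then show ?thesis using W0(2,3) by blast
    next
      case 2
      then have "nontrivial_closed_subspace H ?W1"
        unfolding nontrivial_closed_subspace_def using W1(1) ne(2) by simp
      then show ?thesis using W1(3) E'E[OF W1(1,2)] by blast
    qed
  qed
qed

section \<open>The Hilbert space square\<close>

text \<open>An infinite carrier is in bijection with its square, so the direct sum of two copies of \<open>H\<close>
  lives on the carrier of \<open>H\<close>, in the same element type: \<open>f\<close> is the pairing, \<open>g1\<close> and \<open>g2\<close> are the projections.\<close>
locale hilbert_square = separable_hilbert_space +
  fixes f :: "'a \<Rightarrow> 'a \<Rightarrow> 'a" and g1 g2 :: "'a \<Rightarrow> 'a"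
  assumes f_closed [simp]: "x \<in> carrier H \<Longrightarrow> y \<in> carrier H \<Longrightarrow> f x y \<in> carrier H"
    and g1_closed [simp]: "z \<in> carrier H \<Longrightarrow> g1 z \<in> carrier H"
    and g2_closed [simp]: "z \<in> carrier H \<Longrightarrow> g2 z \<in> carrier H"
    and g1_f [simp]: "x \<in> carrier H \<Longrightarrow> y \<in> carrier H \<Longrightarrow> g1 (f x y) = x"
    and g2_f [simp]: "x \<in> carrier H \<Longrightarrow> y \<in> carrier H \<Longrightarrow> g2 (f x y) = y"
    and f_g [simp]: "z \<in> carrier H \<Longrightarrow> f (g1 z) (g2 z) = z"
begin

text \<open>The structure is transported along the bijection \<open>f\<close>. It shares the carrier
  of \<open>H\<close> but not its zero or its operations; \<open>mult\<close> and \<open>one\<close>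
  are copied without meaning.\<close>

definition square :: "'a hilbert" where
  "square = \<lparr>carrier = carrier H, mult = (\<otimes>), one = \<one>, zero = f \<zero> \<zero>,
     add = (\<lambda>x y. f (g1 x \<oplus> g1 y) (g2 x \<oplus> g2 y)),
     smult = (\<lambda>a x. f (a \<odot> g1 x) (a \<odot> g2 x)),
     cinner = (\<lambda>x y. cinner H (g1 x) (g1 y) + cinner H (g2 x) (g2 y))\<rparr>"

lemma square_simps [simp]:
  "carrier square = carrier H"
  "\<zero>\<^bsub>square\<^esub> = f \<zero> \<zero>"
  "x \<oplus>\<^bsub>square\<^esub> y = f (g1 x \<oplus> g1 y) (g2 x \<oplus> g2 y)"
  "a \<odot>\<^bsub>square\<^esub> x = f (a \<odot> g1 x) (a \<odot> g2 x)"
  "cinner square x y = cinner H (g1 x) (g1 y) + cinner H (g2 x) (g2 y)"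
  by (simp_all add: square_def)

lemma pair_eqI:
  assumes x: "x \<in> carrier H" and y: "y \<in> carrier H"
    and "\<And>z. z \<in> carrier H \<Longrightarrow> cinner H (g1 x) z = cinner H (g1 y) z"
    and "\<And>z. z \<in> carrier H \<Longrightarrow> cinner H (g2 x) z = cinner H (g2 y) z"
  shows "x = y"
proof -
  have "g1 x = g1 y" "g2 x = g2 y" using assms by (auto intro: vec_eqI)
  then have "f (g1 x) (g2 x) = f (g1 y) (g2 y)" by simp
  then show ?thesis by (simp only: f_g[OF x] f_g[OF y])
qed

lemma complex_inner_space_square: "complex_inner_space square"
proof (rule complex_inner_space.intro)
  show "Module.module complex_field square"
  proof (rule moduleI[OF cring_complex_field])
    show "abelian_group square"
    proof (rule abelian_groupI)
      fix x assume "x \<in> carrier square"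
      then have x: "x \<in> carrier H" by simp
      show "\<exists>y\<in>carrier square. y \<oplus>\<^bsub>square\<^esub> x = \<zero>\<^bsub>square\<^esub>"
        using x by (intro bexI[of _ "f (\<ominus> g1 x) (\<ominus> g2 x)"]) (simp_all add: M.l_neg)
    qed (simp_all add: M.a_ac)
  qed (auto intro!: pair_eqI simp: algebra_simps)
  show "complex_inner_space_axioms square"
  proof
    fix x y assume "x \<in> carrier square" "y \<in> carrier square"
    then have xy: "x \<in> carrier H" "y \<in> carrier H" by simp_all
    have "cinner H (g1 x) (g1 y) = cnj (cinner H (g1 y) (g1 x))"
      "cinner H (g2 x) (g2 y) = cnj (cinner H (g2 y) (g2 x))"
      using xy by (auto intro: cinner_commute)
    then show "cinner square x y = cnj (cinner square y x)" by simp
  next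
    fix x assume "x \<in> carrier square" "x \<noteq> \<zero>\<^bsub>square\<^esub>"
    then have x: "x \<in> carrier H" "g1 x \<noteq> \<zero> \<or> g2 x \<noteq> \<zero>" by (simp, metis f_g square_simps(1,2))
    have "0 \<le> Re (cinner H (g1 x) (g1 x))" "0 \<le> Re (cinner H (g2 x) (g2 x))"
      using x(1) by (simp_all add: cinner_self_nonneg)
    then show "0 < Re (cinner square x x)"
      using x cinner_pos[of "g1 x"] cinner_pos[of "g2 x"] by auto
  qed (simp_all add: algebra_simps)
qed

sublocale K: complex_inner_space square
  by (rule complex_inner_space_square)

lemma square_minus:
  assumes "x \<in> carrier H" "y \<in> carrier H"
  shows "x \<ominus>\<^bsub>square\<^esub> y = f (g1 x \<ominus> g1 y) (g2 x \<ominus> g2 y)"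
  using K.minus_eq_add_smult[of x y] assms
    minus_eq_add_smult[of "g1 x" "g1 y"] minus_eq_add_smult[of "g2 x" "g2 y"] by simp

lemma hnorm_square:
  assumes "x \<in> carrier H"
  shows "hnorm square x = sqrt ((hnorm H (g1 x))\<^sup>2 + (hnorm H (g2 x))\<^sup>2)"
  using assms by (simp add: hnorm_def[of square] hnorm_sq)

lemma hnorm_square_bounds:
  assumes "x \<in> carrier H"
  shows "hnorm H (g1 x) \<le> hnorm square x" "hnorm H (g2 x) \<le> hnorm square x"
    "hnorm square x \<le> hnorm H (g1 x) + hnorm H (g2 x)"
  using assms by (auto simp: hnorm_square real_le_rsqrt sqrt_sum_squares_le_sum)

lemma separable_hilbert_space_square: "separable_hilbert_space square"
proof unfold_locales
  show "K.HM.mcomplete"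
    unfolding K.mcomplete_iff
  proof (intro allI impI)
    fix s :: "nat \<Rightarrow> 'a" assume ran: "range s \<subseteq> carrier square"
      and cau: "\<forall>e>0. \<exists>N. \<forall>m\<ge>N. \<forall>n\<ge>N. hnorm square (s m \<ominus>\<^bsub>square\<^esub> s n) < e"
    have s: "s n \<in> carrier H" for n using ran by auto
    have conv: "\<exists>x\<in>carrier H. (\<lambda>n. hnorm H (g (s n) \<ominus> x)) \<longlonglongrightarrow> 0"
      if g: "\<And>z. z \<in> carrier H \<Longrightarrow> g z \<in> carrier H"
        and le: "\<And>m n. hnorm H (g (s m) \<ominus> g (s n)) \<le> hnorm square (s m \<ominus>\<^bsub>square\<^esub> s n)" for g
    proof -
      have "range (\<lambda>n. g (s n)) \<subseteq> carrier H" using g s by auto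
      moreover have "\<forall>e>0. \<exists>N. \<forall>m\<ge>N. \<forall>n\<ge>N. hnorm H (g (s m) \<ominus> g (s n)) < e"
      proof (intro allI impI)
        fix e :: real assume "e > 0"
        with cau obtain N where N: "\<forall>m\<ge>N. \<forall>n\<ge>N. hnorm square (s m \<ominus>\<^bsub>square\<^esub> s n) < e" by iprover
        have "hnorm H (g (s m) \<ominus> g (s n)) < e" if "m \<ge> N" "n \<ge> N" for m n
          by (rule order_le_less_trans[OF le]) (use N that in iprover)
        then show "\<exists>N. \<forall>m\<ge>N. \<forall>n\<ge>N. hnorm H (g (s m) \<ominus> g (s n)) < e" by iprover
      qed
      ultimately show ?thesis
        by (rule complete[unfolded mcomplete_iff, THEN spec, THEN mp, THEN mp])
    qed
    have le: "hnorm H (g1 (s m) \<ominus> g1 (s n)) \<le> hnorm square (s m \<ominus>\<^bsub>square\<^esub> s n)"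
      "hnorm H (g2 (s m) \<ominus> g2 (s n)) \<le> hnorm square (s m \<ominus>\<^bsub>square\<^esub> s n)" for m n
      using hnorm_square_bounds(1,2)[of "s m \<ominus>\<^bsub>square\<^esub> s n"] s by (simp_all add: square_minus)
    obtain x where x: "x \<in> carrier H" "(\<lambda>n. hnorm H (g1 (s n) \<ominus> x)) \<longlonglongrightarrow> 0"
      using conv[of g1, OF g1_closed le(1)] by blast
    obtain y where y: "y \<in> carrier H" "(\<lambda>n. hnorm H (g2 (s n) \<ominus> y)) \<longlonglongrightarrow> 0"
      using conv[of g2, OF g2_closed le(2)] by blast
    have "(\<lambda>n. hnorm square (s n \<ominus>\<^bsub>square\<^esub> f x y)) \<longlonglongrightarrow> 0"
    proof (rule tendsto_sandwich[OF _ _ tendsto_const])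
      show "(\<lambda>n. hnorm H (g1 (s n) \<ominus> x) + hnorm H (g2 (s n) \<ominus> y)) \<longlonglongrightarrow> 0"
        using tendsto_add[OF x(2) y(2)] by simp
      have "hnorm square (s n \<ominus>\<^bsub>square\<^esub> f x y) \<le> hnorm H (g1 (s n) \<ominus> x) + hnorm H (g2 (s n) \<ominus> y)" for n
        using hnorm_square_bounds(3)[of "s n \<ominus>\<^bsub>square\<^esub> f x y"] s x y by (simp add: square_minus)
      then show "\<forall>\<^sub>F n in sequentially. hnorm square (s n \<ominus>\<^bsub>square\<^esub> f x y) \<le> hnorm H (g1 (s n) \<ominus> x) + hnorm H (g2 (s n) \<ominus> y)"
        by simp
      have "0 \<le> hnorm square (s n \<ominus>\<^bsub>square\<^esub> f x y)" for n
        using s x y by (intro K.hnorm_nonneg) (simp add: square_minus)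
      then show "\<forall>\<^sub>F n in sequentially. 0 \<le> hnorm square (s n \<ominus>\<^bsub>square\<^esub> f x y)" by simp
    qed
    then show "\<exists>x\<in>carrier square. (\<lambda>n. hnorm square (s n \<ominus>\<^bsub>square\<^esub> x)) \<longlonglongrightarrow> 0"
      using x y by (intro bexI[of _ "f x y"]) simp_all
  qed
  obtain D where D: "D \<subseteq> carrier H" "countable D" "\<And>x e. x \<in> carrier H \<Longrightarrow> e > 0 \<Longrightarrow> \<exists>d\<in>D. hnorm H (x \<ominus> d) < e"
    using separable unfolding separable_iff by metis
  show "separable_space K.HM.mtopology"
    unfolding K.separable_iff
  proof (intro exI[of _ "(\<lambda>(x, y). f x y) ` (D \<times> D)"] conjI ballI allI impI)
    show "(\<lambda>(x, y). f x y) ` (D \<times> D) \<subseteq> carrier square" using D(1) by (auto simp: subsetD)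
    show "countable ((\<lambda>(x, y). f x y) ` (D \<times> D))" using D(2) by auto
    fix z and e :: real assume "z \<in> carrier square" and e: "e > 0"
    then have z: "z \<in> carrier H" by simp
    obtain x where x: "x \<in> D" "hnorm H (g1 z \<ominus> x) < e / 2" using D(3)[of "g1 z" "e / 2"] z e by auto
    obtain y where y: "y \<in> D" "hnorm H (g2 z \<ominus> y) < e / 2" using D(3)[of "g2 z" "e / 2"] z e by auto
    have xy: "x \<in> carrier H" "y \<in> carrier H" using x y D by auto
    have "hnorm square (z \<ominus>\<^bsub>square\<^esub> f x y) \<le> hnorm H (g1 z \<ominus> x) + hnorm H (g2 z \<ominus> y)"
      using hnorm_square_bounds(3)[of "z \<ominus>\<^bsub>square\<^esub> f x y"] z xy by (simp add: square_minus)
    then have "hnorm square (z \<ominus>\<^bsub>square\<^esub> f x y) < e" using x y by linarith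
    then show "\<exists>d\<in>(\<lambda>(x, y). f x y) ` (D \<times> D). hnorm square (z \<ominus>\<^bsub>square\<^esub> d) < e"
      using x(1) y(1) by (intro bexI[of _ "f x y"]) auto
  qed
qed

lemma dim_at_least_two_square:
  assumes "dim_at_least_two H"
  shows "dim_at_least_two square"
proof -
  from assms obtain x y where xy: "x \<in> carrier H" "y \<in> carrier H"
    and ind: "\<And>a b. a \<odot> x \<oplus> b \<odot> y = \<zero> \<Longrightarrow> a = 0 \<and> b = 0"
    unfolding dim_at_least_two_def by blast
  have "a = 0 \<and> b = 0" if "f (a \<odot> x \<oplus> b \<odot> y) (a \<odot> \<zero> \<oplus> b \<odot> \<zero>) = f \<zero> \<zero>" for a b
  proof -
    have "g1 (f (a \<odot> x \<oplus> b \<odot> y) (a \<odot> \<zero> \<oplus> b \<odot> \<zero>)) = g1 (f \<zero> \<zero>)" using that by simp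
    then show ?thesis using xy ind by simp
  qed
  then show ?thesis
    unfolding dim_at_least_two_def using xy
    by (intro bexI[of _ "f x \<zero>"] bexI[of _ "f y \<zero>"]) auto
qed

text \<open>Both idempotents and the diagonal inverse used later are block operators of this
  kind.\<close>

lemma block_operator_bounded:
  assumes P: "P \<in> bounded_operators H" and Q: "Q \<in> bounded_operators H"
    and R: "R \<in> bounded_operators H" and S: "S \<in> bounded_operators H"
  shows "(\<lambda>z. f (P (g1 z) \<oplus> Q (g2 z)) (R (g1 z) \<oplus> S (g2 z))) \<in> bounded_operators square"
proof -
  note cl = op_closed[OF P] op_closed[OF Q] op_closed[OF R] op_closed[OF S]
  have *: "\<exists>k\<ge>0. \<forall>x\<in>carrier H. hnorm H (A (g x)) \<le> k * hnorm square x"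
    if A: "A \<in> bounded_operators H" and g: "\<And>x. x \<in> carrier H \<Longrightarrow> g x \<in> carrier H"
      "\<And>x. x \<in> carrier H \<Longrightarrow> hnorm H (g x) \<le> hnorm square x" for A g
  proof -
    obtain k where k: "k \<ge> 0" "\<And>x. x \<in> carrier H \<Longrightarrow> hnorm H (A x) \<le> k * hnorm H x"
      using op_bound[OF A] by metis
    have "hnorm H (A (g x)) \<le> k * hnorm square x" if "x \<in> carrier H" for x
      using k(2)[OF g(1)[OF that]] mult_left_mono[OF g(2)[OF that] k(1)] by linarith
    then show ?thesis using k(1) by blast
  qed
  obtain p q r s where
    p: "\<And>x. x \<in> carrier H \<Longrightarrow> hnorm H (P (g1 x)) \<le> p * hnorm square x" and
    q: "\<And>x. x \<in> carrier H \<Longrightarrow> hnorm H (Q (g2 x)) \<le> q * hnorm square x" and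
    r: "\<And>x. x \<in> carrier H \<Longrightarrow> hnorm H (R (g1 x)) \<le> r * hnorm square x" and
    s: "\<And>x. x \<in> carrier H \<Longrightarrow> hnorm H (S (g2 x)) \<le> s * hnorm square x"
    using *[OF P g1_closed hnorm_square_bounds(1)] *[OF Q g2_closed hnorm_square_bounds(2)]
      *[OF R g1_closed hnorm_square_bounds(1)] *[OF S g2_closed hnorm_square_bounds(2)] by metis
  show ?thesis
  proof (rule K.bounded_operatorsI)
    fix x assume "x \<in> carrier square"
    then have x: "x \<in> carrier H" by simp
    have "hnorm square (f (P (g1 x) \<oplus> Q (g2 x)) (R (g1 x) \<oplus> S (g2 x)))
        \<le> hnorm H (P (g1 x) \<oplus> Q (g2 x)) + hnorm H (R (g1 x) \<oplus> S (g2 x))"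
      using hnorm_square_bounds(3)[of "f (P (g1 x) \<oplus> Q (g2 x)) (R (g1 x) \<oplus> S (g2 x))"] x cl by simp
    also have "\<dots> \<le> (hnorm H (P (g1 x)) + hnorm H (Q (g2 x))) + (hnorm H (R (g1 x)) + hnorm H (S (g2 x)))"
      using x cl by (intro add_mono hnorm_triangle) auto
    also have "\<dots> \<le> (p + q + r + s) * hnorm square x"
      using p[OF x] q[OF x] r[OF x] s[OF x] by (simp add: algebra_simps)
    finally show "hnorm square (f (P (g1 x) \<oplus> Q (g2 x)) (R (g1 x) \<oplus> S (g2 x))) \<le> (p + q + r + s) * hnorm square x" .
  qed (auto intro!: pair_eqI simp: cl op_linear[OF P] op_linear[OF Q] op_linear[OF R] op_linear[OF S] algebra_simps)
qed

text \<open>The preimage of \<open>S\<close> under the embedding of the first summand, which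
  preserves distances, so limits carry over.\<close>

lemma closed_subspace_first_axis:
  assumes S: "closed_subspace square S"
  shows "closed_subspace H {x \<in> carrier H. f x \<zero> \<in> S}"
proof (rule closed_subspaceI)
  show "\<zero> \<in> {x \<in> carrier H. f x \<zero> \<in> S}" using K.closed_subspace_zero[OF S] by simp
  show "x \<oplus> y \<in> {x \<in> carrier H. f x \<zero> \<in> S}"
    if "x \<in> {x \<in> carrier H. f x \<zero> \<in> S}" "y \<in> {x \<in> carrier H. f x \<zero> \<in> S}" for x y
    using K.closed_subspace_add[OF S, of "f x \<zero>" "f y \<zero>"] that by simp
  show "a \<odot> x \<in> {x \<in> carrier H. f x \<zero> \<in> S}" if "x \<in> {x \<in> carrier H. f x \<zero> \<in> S}" for a x
    using K.closed_subspace_smult[OF S, of "f x \<zero>" a] smult_r_null[of a] that by simp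
  fix x assume x: "x \<in> carrier H" and *: "\<And>e. e > 0 \<Longrightarrow> \<exists>y\<in>{x \<in> carrier H. f x \<zero> \<in> S}. hnorm H (x \<ominus> y) < e"
  have "f x \<zero> \<in> S"
  proof (rule K.closed_subspace_limit[OF S])
    fix e :: real assume "e > 0"
    from *[OF this] obtain y where y: "y \<in> carrier H" "f y \<zero> \<in> S" "hnorm H (x \<ominus> y) < e" by blast
    have "hnorm square (f x \<zero> \<ominus>\<^bsub>square\<^esub> f y \<zero>) \<le> hnorm H (x \<ominus> y)"
      using hnorm_square_bounds(3)[of "f (x \<ominus> y) \<zero>"] x y by (simp add: square_minus)
    then show "\<exists>z\<in>S. hnorm square (f x \<zero> \<ominus>\<^bsub>square\<^esub> z) < e" using y by (intro bexI[of _ "f y \<zero>"]) auto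
  qed (use x in simp)
  then show "x \<in> {x \<in> carrier H. f x \<zero> \<in> S}" using x by simp
qed simp

lemma hilbert_square_swap: "hilbert_square H (\<lambda>x y. f y x) g2 g1"
  by unfold_locales simp_all

end

text \<open>Exchanging the summands yields literally the same structure, because the two inner
  products are merely added in the other order.\<close>

lemma (in hilbert_square) closed_subspace_second_axis:
  assumes S: "closed_subspace square S"
  shows "closed_subspace H {x \<in> carrier H. f \<zero> x \<in> S}"
proof -
  interpret swap: hilbert_square H "\<lambda>x y. f y x" g2 g1 by (rule hilbert_square_swap)
  have "swap.square = square" unfolding square_def swap.square_def by (simp add: add.commute)
  then show ?thesis using swap.closed_subspace_first_axis S by simp
qed

text \<open>The idempotents \<open>E = [[1, 0], [0, 0]]\<close> and \<open>F = [[1 - T, 1], [T (1 - T), T]]\<close> have the commutator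
  \<open>[[0, 1], [- T (1 - T), 0]]\<close>, whose square is \<open>- T (1 - T)\<close> on both summands.\<close>
lemma (in hilbert_square) invariant_subspace_from_square:
  assumes pairs: "\<And>E F. E \<in> bounded_operators square \<Longrightarrow> F \<in> bounded_operators square \<Longrightarrow>
      idempotent_op square E \<Longrightarrow> idempotent_op square F \<Longrightarrow> quasinilpotent square (commutator square E F) \<Longrightarrow>
      \<exists>S. nontrivial_closed_subspace square S \<and> invariant_under E S \<and> invariant_under F S"
    and dim: "dim_at_least_two H" and T: "T \<in> bounded_operators H" and quasi: "quasinilpotent H T"
  shows "\<exists>S. nontrivial_closed_subspace H S \<and> invariant_under T S"
proof -
  note inv = quasinilpotentD(1)[OF T quasi]
  define q where "q x = T x \<ominus> T (T x)" for x
  have q: "q \<in> bounded_operators H"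
    unfolding q_def by (rule bounded_diff[OF T bounded_compose[OF T T]])
  have T1: "(\<lambda>x. x \<ominus> T x) \<in> bounded_operators H" by (rule bounded_complement[OF T])
  have Z: "(\<lambda>x. \<zero>) \<in> bounded_operators H"
    by (rule bounded_operatorsI[where K = 0]) (auto intro: vec_eqI)
  note cl = op_closed[OF T] op_closed[OF q]
  define E where "E z = f (g1 z) \<zero>" for z
  define F where "F z = f ((g1 z \<ominus> T (g1 z)) \<oplus> g2 z) (q (g1 z) \<oplus> T (g2 z))" for z
  have E: "E \<in> bounded_operators square"
    by (rule K.op_cong[OF block_operator_bounded[OF bounded_id Z Z Z]]) (simp add: E_def)
  have F: "F \<in> bounded_operators square"
    unfolding F_def by (rule block_operator_bounded[OF T1 bounded_id q T])
  have idE: "idempotent_op square E"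
    unfolding idempotent_op_def by (simp add: E_def)
  have idF: "idempotent_op square F"
    unfolding idempotent_op_def
  proof
    fix z assume "z \<in> carrier square"
    then show "F (F z) = F z"
      by (intro pair_eqI) (auto simp: F_def q_def cl op_linear[OF T] algebra_simps)
  qed
  define C where "C = commutator square E F"
  have C: "C \<in> bounded_operators square"
    unfolding C_def commutator_def o_def
    by (rule K.op_minus_bounded[OF K.bounded_compose[OF E F] K.bounded_compose[OF F E]])
  have Cz: "C z = f (g2 z) ((-1) \<odot> q (g1 z))" if "z \<in> carrier H" for z
    using that unfolding C_def commutator_def op_minus_def o_def
    by (intro pair_eqI) (auto simp: square_minus E_def F_def cl op_linear[OF T])
  obtain z where z: "z \<in> carrier square" "z \<noteq> \<zero>\<^bsub>square\<^esub>"
    by (rule K.dim_at_least_two_nonzero[OF dim_at_least_two_square[OF dim]])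
  have "quasinilpotent square C"
  proof (rule K.quasinilpotentI[OF C _ z])
    fix c :: complex assume c: "c \<noteq> 0"
    \<comment> \<open>\<open>a\<close> and \<open>b\<close> are the roots of
      \<open>X^2 - X - c^2\<close>, so \<open>(T - a) (T - b) = - q - c^2\<close>, which is the
      diagonal entry of \<open>C^2 - c^2\<close>. Their product \<open>- c^2\<close> is non-zero, so
      both factors are invertible.\<close>
    define s where "s = csqrt (1 + 4 * c\<^sup>2)"
    define a where "a = (1 + s) / 2"
    define b where "b = (1 - s) / 2"
    have ss: "s * s = 1 + 4 * c\<^sup>2" by (simp add: s_def flip: power2_eq_square)
    have ab: "a * b = - c\<^sup>2" "a + b = 1"
      using ss by (simp_all add: a_def b_def field_simps)
    have ab0: "a \<noteq> 0" "b \<noteq> 0" using ab(1) c by auto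
    define G where "G = poly_op H T ([:-a, 1:] * [:-b, 1:])"
    have GB: "G \<in> bounded_operators H" unfolding G_def by (rule poly_op_bounded[OF T])
    have "invertible_op H G"
      unfolding G_def by (rule invertible_poly_op_mult[OF T inv[OF ab0(1)] inv[OF ab0(2)]])
    then obtain R where R: "R \<in> bounded_operators H" "\<And>x. x \<in> carrier H \<Longrightarrow> R (G x) = x"
      "\<And>x. x \<in> carrier H \<Longrightarrow> G (R x) = x"
      unfolding invertible_op_def by blast
    have Gx: "G x = (-1) \<odot> q x \<ominus> c\<^sup>2 \<odot> x" if x: "x \<in> carrier H" for x
    proof -
      have "[:-a, 1:] * [:-b, 1:] = [:a * b, - (a + b), 1:]" by simp
      also have "\<dots> = [:- c\<^sup>2, -1, 1:]" unfolding ab ..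
      finally have "[:-a, 1:] * [:-b, 1:] = [:- c\<^sup>2, -1, 1:]" .
      then show ?thesis unfolding G_def using x cl
        by (intro vec_eqI) (auto simp: poly_op_pCons[OF T] op_linear[OF T] q_def)
    qed
    have CC: "poly_op square C ([:-c, 1:] * [:c, 1:]) z = f (G (g1 z)) (G (g2 z))" if z: "z \<in> carrier H" for z
    proof -
      have "[:-c, 1:] * [:c, 1:] = [:- c\<^sup>2, 0, 1:]" by (simp add: power2_eq_square)
      moreover have "poly_op square C [:- c\<^sup>2, 0, 1:] z = f (G (g1 z)) (G (g2 z))"
      proof -
        have zK: "z \<in> carrier square" using z by simp
        have "poly_op square C [:- c\<^sup>2, 0, 1:] z = (- c\<^sup>2) \<odot>\<^bsub>square\<^esub> z \<oplus>\<^bsub>square\<^esub> C (C z)"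
          using zK K.op_closed[OF C]
          by (intro K.vec_eqI) (simp_all add: K.poly_op_pCons[OF C] K.op_linear[OF C] del: square_simps)
        also have "\<dots> = f (G (g1 z)) (G (g2 z))"
          using z cl op_closed[OF GB]
          by (intro pair_eqI) (auto simp: Cz Gx op_linear[OF q])
        finally show ?thesis .
      qed
      ultimately show ?thesis by simp
    qed
    have R2: "(\<lambda>z. f (R (g1 z)) (R (g2 z))) \<in> bounded_operators square"
      by (rule K.op_cong[OF block_operator_bounded[OF R(1) Z Z R(1)]]) (simp add: op_closed[OF R(1)])
    have "invertible_op square (poly_op square C ([:-c, 1:] * [:c, 1:]))"
      unfolding invertible_op_def
      by (rule bexI[OF _ R2]) (simp add: CC R(2,3) op_closed[OF R(1)] op_closed[OF GB] del: mult_pCons_left mult_pCons_right)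
    then show "invertible_op square (poly_op square C [:-c, 1:])"
      by (rule K.invertible_poly_op_factor[OF C])
  qed
  from pairs[OF E F idE idF this[unfolded C_def]]
  obtain S where S: "nontrivial_closed_subspace square S" "invariant_under E S" "invariant_under F S" by blast
  have cs: "closed_subspace square S" and S0: "S \<noteq> {f \<zero> \<zero>}" and S1: "S \<noteq> carrier H"
    using S(1) by (auto simp: nontrivial_closed_subspace_def)
  \<comment> \<open>Invariance under \<open>E\<close> makes \<open>S\<close> the direct sum of its
    traces \<open>M\<close> and \<open>N\<close> on the two axes.\<close>
  define M where "M = {x \<in> carrier H. f x \<zero> \<in> S}"
  define N where "N = {x \<in> carrier H. f \<zero> x \<in> S}"
  have M: "closed_subspace H M" unfolding M_def by (rule closed_subspace_first_axis[OF cs])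
  have N: "closed_subspace H N" unfolding N_def by (rule closed_subspace_second_axis[OF cs])
  have SH: "z \<in> carrier H" if "z \<in> S" for z using K.closed_subspace_subset[OF cs] that by auto
  have S_M: "g1 z \<in> M" if z: "z \<in> S" for z
    using S(2) z SH[OF z] unfolding invariant_under_def M_def E_def by auto
  have S_N: "g2 z \<in> N" if z: "z \<in> S" for z
  proof -
    have "f (g1 z) \<zero> \<in> S" using S_M[OF z] by (simp add: M_def)
    from K.closed_subspace_diff[OF cs z this] have "f (g1 z \<ominus> g1 z) (g2 z \<ominus> \<zero>) \<in> S"
      using SH[OF z] by (simp add: square_minus)
    moreover have "g2 z \<ominus> \<zero> = g2 z" using SH[OF z] by (intro vec_eqI) auto
    ultimately show ?thesis using SH[OF z] by (simp add: N_def)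
  qed
  have MN_S: "z \<in> S" if z: "z \<in> carrier H" "g1 z \<in> M" "g2 z \<in> N" for z
    using K.closed_subspace_add[OF cs, of "f (g1 z) \<zero>" "f \<zero> (g2 z)"] z by (simp add: M_def N_def)
  have FS: "F z \<in> S" if "z \<in> S" for z using S(3) that unfolding invariant_under_def by blast
  have MF: "x \<ominus> T x \<in> M" "q x \<in> N" if x: "x \<in> M" for x
  proof -
    have xc: "x \<in> carrier H" using x by (simp add: M_def)
    have "F (f x \<zero>) \<in> S" using x by (intro FS) (simp add: M_def)
    moreover have "F (f x \<zero>) = f (x \<ominus> T x) (q x)" using xc cl by (simp add: F_def op_zero[OF T])
    ultimately have *: "f (x \<ominus> T x) (q x) \<in> S" by simp
    show "x \<ominus> T x \<in> M" "q x \<in> N" using S_M[OF *] S_N[OF *] xc cl by simp_all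
  qed
  have TM: "invariant_under T M"
  proof -
    have "T x \<in> M" if x: "x \<in> M" for x
    proof -
      have "x \<in> carrier H" using x by (simp add: M_def)
      then have "T x = x \<ominus> (x \<ominus> T x)" using cl by (intro vec_eqI) auto
      then show ?thesis using closed_subspace_diff[OF M x MF(1)[OF x]] by simp
    qed
    then show ?thesis unfolding invariant_under_def by blast
  qed
  \<comment> \<open>The second column of \<open>F\<close> sends \<open>(0, x)\<close> to
    \<open>(x, T x)\<close>; this gives both the inclusion of \<open>N\<close> in \<open>M\<close>
    and the invariance of \<open>N\<close>.\<close>
  have NF: "x \<in> M" "T x \<in> N" if x: "x \<in> N" for x
  proof -
    have xc: "x \<in> carrier H" using x by (simp add: N_def)
    have "F (f \<zero> x) \<in> S" using x by (intro FS) (simp add: N_def)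
    moreover have "F (f \<zero> x) = f x (T x)"
      using xc cl op_zero[OF T] op_zero[OF q] by (simp add: F_def)
    ultimately have *: "f x (T x) \<in> S" by simp
    show "x \<in> M" "T x \<in> N" using S_M[OF *] S_N[OF *] xc cl by simp_all
  qed
  consider "M \<noteq> {\<zero>}" "M \<noteq> carrier H" | "M = {\<zero>}" | "M = carrier H" "N \<noteq> {\<zero>}" | "M = carrier H" "N = {\<zero>}"
    by blast
  then show ?thesis
  proof cases
    case 1
    then show ?thesis using M TM unfolding nontrivial_closed_subspace_def by blast
  next
    case 2
    have "z = f \<zero> \<zero>" if z: "z \<in> S" for z
    proof -
      have "g1 z = \<zero>" "g2 z = \<zero>" using S_M[OF z] NF(1)[OF S_N[OF z]] 2 by simp_all
      then show ?thesis using f_g[OF SH[OF z]] by metis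
    qed
    moreover have "f \<zero> \<zero> \<in> S" using K.closed_subspace_zero[OF cs] by simp
    ultimately have "S = {f \<zero> \<zero>}" by blast
    then show ?thesis using S0 by contradiction
  next
    case 3
    have "N \<noteq> carrier H"
    proof
      assume "N = carrier H"
      then have "carrier H \<subseteq> S" using MN_S 3(1) by auto
      then show False using S1 SH by blast
    qed
    moreover have "invariant_under T N" using NF(2) unfolding invariant_under_def by blast
    ultimately show ?thesis using N 3(2) unfolding nontrivial_closed_subspace_def by blast
  next
    case 4
    \<comment> \<open>\<open>N = {0}\<close> forces \<open>T - T^2 = 0\<close>, that is
      \<open>(T - 1) T = 0\<close>; since \<open>T - 1\<close> is invertible, \<open>T\<close>
      vanishes and every line is invariant.\<close>
    have T0: "T x = \<zero>" if x: "x \<in> carrier H" for x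
    proof -
      have "q x = \<zero>" using MF(2)[of x] 4 x by simp
      moreover have "poly_op H T [:-1, 1:] (T x) = (-1) \<odot> q x"
        using x cl by (intro vec_eqI) (auto simp: poly_op_pCons[OF T] op_linear[OF T] q_def)
      ultimately have "poly_op H T [:-1, 1:] (T x) = \<zero>" by (simp add: vec_eqI)
      moreover obtain R where R: "R \<in> bounded_operators H" "\<forall>x\<in>carrier H. R (poly_op H T [:-1, 1:] x) = x"
        using inv[of 1] unfolding invertible_op_def by auto
      ultimately have "R \<zero> = T x" using cl(1)[OF x] by metis
      then show ?thesis using op_zero[OF R(1)] by simp
    qed
    obtain v where v: "v \<in> carrier H" "v \<noteq> \<zero>" by (rule dim_at_least_two_nonzero[OF dim])
    have "\<exists>a. \<zero> = a \<odot> v" using v smult_zero_left by metis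
    then have "invariant_under T {x \<in> carrier H. \<exists>a. x = a \<odot> v}"
      unfolding invariant_under_def using T0 by auto
    then show ?thesis using nontrivial_line[OF dim v] by blast
  qed
qed

text \<open>The carrier contains a complex line and is therefore infinite, and an infinite set is
  equinumerous with its square. The bijection may be arbitrary, since the structure is carried over
  along it.\<close>

lemma (in separable_hilbert_space) hilbert_square_exists:
  assumes "x \<in> carrier H" "x \<noteq> \<zero>"
  shows "\<exists>f g1 g2. hilbert_square H f g1 g2"
proof -
  have "inj (\<lambda>a. a \<odot> x)"
  proof (rule injI)
    fix a b assume eq: "a \<odot> x = b \<odot> x"
    have "(a - b) \<odot> x = a \<odot> x \<ominus> b \<odot> x" using assms by (intro vec_eqI) (auto simp: algebra_simps)
    then have "(a - b) \<odot> x = \<zero>" using eq assms by simp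
    then have "cmod (a - b) * hnorm H x = 0" using hnorm_smult[OF assms(1), of "a - b"] by simp
    then show "a = b" using assms by simp
  qed
  moreover have "range (\<lambda>a. a \<odot> x) \<subseteq> carrier H" using assms by auto
  ultimately have "infinite (carrier H)"
    using infinite_UNIV_char_0[where 'a = complex] finite_subset finite_imageD by metis
  from card_of_ordIso[THEN iffD2, OF card_of_Times_same_infinite[OF this]]
  obtain h where h: "bij_betw h (carrier H \<times> carrier H) (carrier H)" ..
  define k where "k = inv_into (carrier H \<times> carrier H) h"
  have kh: "k (h (x, y)) = (x, y)" if "x \<in> carrier H" "y \<in> carrier H" for x y
    unfolding k_def using bij_betw_inv_into_left[OF h] that by simp
  have hk: "k z \<in> carrier H \<times> carrier H" "h (k z) = z" if "z \<in> carrier H" for z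
    unfolding k_def using bij_betw_inv_into_right[OF h that] bij_betw_apply[OF bij_betw_inv_into[OF h] that] by simp_all
  have hc: "h (x, y) \<in> carrier H" if "x \<in> carrier H" "y \<in> carrier H" for x y
    using bij_betw_apply[OF h] that by simp
  have "hilbert_square H (\<lambda>x y. h (x, y)) (\<lambda>z. fst (k z)) (\<lambda>z. snd (k z))"
    by unfold_locales (use hc kh hk in \<open>auto simp: mem_Times_iff\<close>)
  then show ?thesis by blast
qed

theorem theorem1p1:
  shows "(\<forall>H :: 'a hilbert. separable_hilbert_space H \<and> dim_at_least_two H \<longrightarrow>
            (\<forall>T \<in> bounded_operators H. quasinilpotent H T \<longrightarrow>
               (\<exists>S. nontrivial_closed_subspace H S \<and> invariant_under T S)))
     \<longleftrightarrow>
         (\<forall>H :: 'a hilbert. separable_hilbert_space H \<and> dim_at_least_two H \<longrightarrow>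
            (\<forall>T1 \<in> bounded_operators H. \<forall>T2 \<in> bounded_operators H.
               idempotent_op H T1 \<and> idempotent_op H T2 \<and> quasinilpotent H (commutator H T1 T2) \<longrightarrow>
               (\<exists>S. nontrivial_closed_subspace H S \<and> invariant_under T1 S \<and> invariant_under T2 S)))"
  (is "?quasinilpotents \<longleftrightarrow> ?pairs")
proof
  assume ?quasinilpotents
  then have hyp: "\<exists>S. nontrivial_closed_subspace K S \<and> invariant_under T S"
    if "separable_hilbert_space K" "dim_at_least_two K" "T \<in> bounded_operators K" "quasinilpotent K T"
    for K :: "'a hilbert" and T
    using that by blast
  show ?pairs
    by (intro allI impI ballI, elim conjE) (rule idempotent_pair_invariant_subspace[OF hyp])
next
  assume pairs: ?pairs
  show ?quasinilpotents
  proof (intro allI impI ballI, elim conjE)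
    fix H :: "'a hilbert" and T
    assume H: "separable_hilbert_space H" and dim: "dim_at_least_two H"
      and T: "T \<in> bounded_operators H" "quasinilpotent H T"
    interpret separable_hilbert_space H by (rule H)
    obtain x where "x \<in> carrier H" "x \<noteq> \<zero>\<^bsub>H\<^esub>" by (rule dim_at_least_two_nonzero[OF dim])
    from hilbert_square_exists[OF this] obtain f g1 g2 where "hilbert_square H f g1 g2" by blast
    then interpret hilbert_square H f g1 g2 .
    show "\<exists>S. nontrivial_closed_subspace H S \<and> invariant_under T S"
      by (rule invariant_subspace_from_square[OF _ dim T])
        (use pairs separable_hilbert_space_square dim_at_least_two_square[OF dim] in blast)
  qed
qed

end
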